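(* Let $\Gamma$ be a regular ciliated ribbon graph and $\mathcal A^*_\Gamma$ the algebra of functions of the $D(H)$-valued Hopf algebra gauge theory on $\Gamma$. Then there exists a (unique) algebra homomorphism $\chi:\mathcal A^*_\Gamma\to\mathcal H(H)^{op\otimes E}$ with $\chi((a)_e)=\mathrm{Hol}_{p_{e,+}}(a)$ ($=\mathrm{Hol}_{p_{e,-}}(a)$) for all edges $e$ and $a\in D(H)^*$. Explicitly, for edges $e_1<e_2<\cdots<e_k$ and $a^1,\dots,a^k\in D(H)^*$, $$\chi\big((a^1)_{e_1}\cdot_{\mathcal A}\cdots\cdot_{\mathcal A}(a^k)_{e_k}\big)=\mathrm{Hol}_{p_{e_k,\pm}}(a^k)\cdot\cdots\cdot\mathrm{Hol}_{p_{e_1,\pm}}(a^1),$$ where $\cdot$ is the multiplication of $\mathcal H(H)^{\otimes E}$ and, for edges $e\neq f$, $e<f$ means that $e,f$ have no common vertex or that they share a vertex $v$ and $e<f$ in the ordering at $v$.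
   Context: $\mathbb F$ is a field of characteristic zero and $H$ is a finite-dimensional semisimple Hopf algebra over $\mathbb F$ with dual $H^*$; $S$ denotes the antipodes of $H$ and $H^*$ ($S^2=\mathrm{id}$), $\epsilon$ the counits, Sweedler notation without summation sign; $\{x_i\}$ is a basis of $H$, $\{\alpha^i\}$ the dual basis. $D(H)^*$ is the Hopf algebra on $H\otimes H^*$ with multiplication $(y\otimes\gamma)(z\otimes\delta)=zy\otimes\gamma\delta$, unit $1\otimes1$, counit $\epsilon(y)\epsilon(\gamma)$, comultiplication $\Delta_D(y\otimes\gamma)=\sum_{i,j}(y_{(1)}\otimes\alpha^i\gamma_{(1)}\alpha^j)\otimes(S(x_j)y_{(2)}x_i\otimes\gamma_{(2)})$, antipode $S_D(y\otimes\gamma)=\sum_{i,j}x_iS^{-1}(y)x_j\otimes S(\alpha^j)S(\gamma)\alpha^i$. The Drinfeld double $D(H)$ (on $H^*\otimes H$) has $R$-matrix $R=\sum_i(1\otimes x_i)\otimes(\alpha^i\otimes1)$ and is paired with $D(H)^*$ by $\langle\delta\otimes z,y\otimes\gamma\rangle=\delta(y)\gamma(z)$; thus $\langle a\otimes b,R\rangle=\epsilon(y)\epsilon(\delta)\gamma(z)$ for $a=y\otimes\gamma$, $b=z\otimes\delta$. The Heisenberg double $\mathcal H(H)$ is the algebra on $H\otimes H^*$ with unit $1\otimes1$ and multiplication $(h\otimes\alpha)\cdot(h'\otimes\alpha')=\langle\alpha_{(1)},h'_{(2)}\rangle\,hh'_{(1)}\otimes\alpha_{(2)}\alpha'$; $\mathcal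 H(H)^{op\otimes E}$ is $\mathcal H(H)^{\otimes E}$ with the opposite multiplication. For a finite set $X$ and an algebra $A$, $A^{\otimes X}$ is the tensor product of copies of $A$ indexed by $X$; $(a)_x$ denotes the pure tensor with $a$ in the factor $x$ and $1$ elsewhere. Graphs: a ribbon graph is a finite directed graph with a cyclic ordering of the edge ends at each vertex; $e^{-1}$ is the reversed edge, $\mathrm{st},\mathrm{ta}$ starting and target vertex. A ciliated vertex carries a linear ordering of its incident edge ends inducing the cyclic one. Paths are written as words read right to left ($p\circ q$: first $q$ then $p$). A ciliated face is a closed path turning maximally right at each vertex passed (including the start) and traversing each edge at most once in each direction. $\Gamma$ (edge set $E$) is a regular ciliated ribbon graph if all vertices are ciliated, there are no loops or multiple edges, each face traverses each edge at most once and each face contains exactly one cilium. Algebra of functions $\mathcal A^*_\Gamma$: the unital associative algebra generated by elements $(a)_e$, $e\in E$, $a\in D(H)^*$, with $a\mapsto(a)_e$ linear and $(1\otimes1)_e=1$, subject to: (R1) $(b)_e\cdot(a)_e=\langle a_{(1)}\otimes b_{(1)},R\rangle\,(a_{(2)}b_{(2)})_e$; (R2) $(b)_f\cdot(a)_e=(a)_e\cdot(b)_f$ if $e,f$ have no common vertex; (R3) if $e\neq f$ share the vertex $v$ and $e<f$ at $v$: $(b)_f\cdot(a)_e=\langle S_D^{\tau_e}(a_{(1+\tau_e)})\otimes S_D^{\tau_f}(b_{(1+\tau_f)}),R\rangle\,(a_{(2-\tau_e)})_e\cdot(b_{(2-\tau_f)})_f$, where $\tau_g=0$ if $g$ is incoming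 and $\tau_g=1$ if $g$ is outgoing at $v$; comultiplications are those of $D(H)^*$. As a vector space $\mathcal A^*_\Gamma\cong D(H)^{*\otimes E}$. Thickening: $\Gamma_D$ has, for each edge $e$ of $\Gamma$, the four edges $r(e),l(e),r(\bar e),l(\bar e)$: $r(e),l(e)$ run parallel to $e$ on its right resp. left, $r(\bar e)$ crosses $e$ near its target end from right to left, $l(\bar e)$ crosses $e$ near its starting end from right to left; vertices of $\Gamma_D$ are the corners of $\Gamma$. For reversed edges $r(e^{-1})=l(e)^{-1}$, $l(e^{-1})=r(e)^{-1}$, $r(\overline{e^{-1}})=l(\bar e)^{-1}$, $l(\overline{e^{-1}})=r(\bar e)^{-1}$. Holonomy: with the convolution product $\phi\bullet\psi=m'\circ(\phi\otimes\psi)\circ\Delta_D$ on $\mathrm{Hom}_{\mathbb F}(H\otimes H^*,(H\otimes H^* )^{\otimes E})$, $m'$ the multiplication of the tensor product algebra $D(H)^{*\otimes E}$, $\mathrm{Hol}$ is the functor on the path groupoid of $\Gamma_D$ with $\mathrm{Hol}_{p\circ q}=\mathrm{Hol}_p\bullet\mathrm{Hol}_q$ determined by $\mathrm{Hol}_{r(e)}(y\otimes\gamma)=\epsilon(y)(1\otimes\gamma)_e$, $\mathrm{Hol}_{r(\bar e)}(y\otimes\gamma)=\epsilon(\gamma)(y\otimes1)_e$, $\mathrm{Hol}_{l(e)}(y\otimes\gamma)=\epsilon(y)\sum_{i,j}(x_iS(x_j)\otimes\alpha^j\gamma\alpha^i)_e$, $\mathrm{Hol}_{l(\bar e)}(y\otimes\gamma)=\epsilon(\gamma)\sum_{i,j}(x_iyS(x_j)\otimes\alpha^j\alpha^i)_e$,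 $\mathrm{Hol}_{x^{-1}}=\mathrm{Hol}_x\circ S_D$. Edge paths: for an edge $e$ that is the $i$-th edge end at $\mathrm{ta}(e)$ and the $j$-th at $\mathrm{st}(e)$, let $e_1,\dots,e_{i-1}$ (resp. $f_1,\dots,f_{j-1}$) be the edges of lower order at $\mathrm{ta}(e)$ (resp. $\mathrm{st}(e)$), numbered by the ordering, with $e_k^{\epsilon_k}$ incoming at $\mathrm{ta}(e)$ and $f_l^{\phi_l}$ incoming at $\mathrm{st}(e)$; $p_{t(e)<}=r(\overline{e_1^{\epsilon_1}})\circ\cdots\circ r(\overline{e_{i-1}^{\epsilon_{i-1}}})$, $p_{s(e)<}=r(\overline{f_1^{\phi_1}})\circ\cdots\circ r(\overline{f_{j-1}^{\phi_{j-1}}})$, $p_{e,+}=p_{t(e)<}\circ r(\bar e)\circ r(e)\circ p_{s(e)<}^{-1}$, $p_{e,-}=p_{t(e)<}\circ l(e)\circ l(\bar e)\circ p_{s(e)<}^{-1}$; one has $\mathrm{Hol}_{p_{e,+}}=\mathrm{Hol}_{p_{e,-}}=:\mathrm{Hol}_{p_{e,\pm}}$. *)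

theory Defs
  imports Main
begin

text \<open>H has basis x_a (a of the finite type 'i); the dual H* has the dual basis alpha^a.
  Vectors of H and of H* are coordinate functions 'i => 'k.
  x_a x_b = sum_c mu a b c x_c;  1 = sum_c eta c x_c;
  Delta x_a = sum_{b,c} del a b c x_b (x) x_c;  eps(x_a) = ceps a;  S x_a = sum_b ant a b x_b.\<close>

record ('i, 'k) hopf =
  hmu  :: "'i \<Rightarrow> 'i \<Rightarrow> 'i \<Rightarrow> 'k"
  heta :: "'i \<Rightarrow> 'k"
  hdel :: "'i \<Rightarrow> 'i \<Rightarrow> 'i \<Rightarrow> 'k"
  hceps :: "'i \<Rightarrow> 'k"
  hant :: "'i \<Rightarrow> 'i \<Rightarrow> 'k"

definition kd :: "'a \<Rightarrow> 'a \<Rightarrow> 'k::field" where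
  "kd a b = (if a = b then 1 else 0)"

definition hopf_algebra :: "('i::finite, 'k::field) hopf \<Rightarrow> bool" where
  "hopf_algebra H \<longleftrightarrow>
     (\<forall>a b c e. (\<Sum>d\<in>UNIV. hmu H a b d * hmu H d c e) = (\<Sum>d\<in>UNIV. hmu H b c d * hmu H a d e)) \<and>
     (\<forall>b c. (\<Sum>a\<in>UNIV. heta H a * hmu H a b c) = kd b c) \<and>
     (\<forall>b c. (\<Sum>a\<in>UNIV. heta H a * hmu H b a c) = kd b c) \<and>
     (\<forall>a p q r. (\<Sum>d\<in>UNIV. hdel H a d r * hdel H d p q) = (\<Sum>d\<in>UNIV. hdel H a p d * hdel H d q r)) \<and>
     (\<forall>a c. (\<Sum>b\<in>UNIV. hdel H a b c * hceps H b) = kd a c) \<and>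
     (\<forall>a b. (\<Sum>c\<in>UNIV. hdel H a b c * hceps H c) = kd a b) \<and>
     (\<forall>a b p q. (\<Sum>c\<in>UNIV. hmu H a b c * hdel H c p q) =
        (\<Sum>a1\<in>UNIV. \<Sum>a2\<in>UNIV. \<Sum>b1\<in>UNIV. \<Sum>b2\<in>UNIV. hdel H a a1 a2 * hdel H b b1 b2 * hmu H a1 b1 p * hmu H a2 b2 q)) \<and>
     (\<forall>p q. (\<Sum>c\<in>UNIV. heta H c * hdel H c p q) = heta H p * heta H q) \<and>
     (\<forall>a b. (\<Sum>c\<in>UNIV. hmu H a b c * hceps H c) = hceps H a * hceps H b) \<and>
     (\<Sum>c\<in>UNIV. heta H c * hceps H c) = 1 \<and>
     (\<forall>a e. (\<Sum>b\<in>UNIV. \<Sum>c\<in>UNIV. \<Sum>d\<in>UNIV. hdel H a b c * hant H b d * hmu H d c e) = hceps H a * heta H e) \<and>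
     (\<forall>a e. (\<Sum>b\<in>UNIV. \<Sum>c\<in>UNIV. \<Sum>d\<in>UNIV. hdel H a b c * hant H c d * hmu H b d e) = hceps H a * heta H e)"

definition bv :: "'a \<Rightarrow> 'a \<Rightarrow> 'k::field" where
  "bv a = (\<lambda>c. if c = a then 1 else 0)"

definition lin :: "('s::finite \<Rightarrow> 'w \<Rightarrow> 'k::field) \<Rightarrow> ('s \<Rightarrow> 'k) \<Rightarrow> 'w \<Rightarrow> 'k" where
  "lin f u = (\<lambda>w. \<Sum>s\<in>UNIV. u s * f s w)"

definition hm :: "('i::finite, 'k::field) hopf \<Rightarrow> ('i \<Rightarrow> 'k) \<Rightarrow> ('i \<Rightarrow> 'k) \<Rightarrow> 'i \<Rightarrow> 'k" where
  "hm H x y = (\<lambda>c. \<Sum>a\<in>UNIV. \<Sum>b\<in>UNIV. x a * y b * hmu H a b c)"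

definition hS :: "('i::finite, 'k::field) hopf \<Rightarrow> ('i \<Rightarrow> 'k) \<Rightarrow> 'i \<Rightarrow> 'k" where
  "hS H x = (\<lambda>b. \<Sum>a\<in>UNIV. x a * hant H a b)"

text \<open>multiplication of H*: alpha^b alpha^d = sum_q del q b d alpha^q\<close>
definition dm :: "('i::finite, 'k::field) hopf \<Rightarrow> ('i \<Rightarrow> 'k) \<Rightarrow> ('i \<Rightarrow> 'k) \<Rightarrow> 'i \<Rightarrow> 'k" where
  "dm H g d = (\<lambda>q. \<Sum>b\<in>UNIV. \<Sum>c\<in>UNIV. g b * d c * hdel H q b c)"

text \<open>antipode of H*: S(alpha^a) = alpha^a o S = sum_b ant b a alpha^b\<close>
definition dS :: "('i::finite, 'k::field) hopf \<Rightarrow> ('i \<Rightarrow> 'k) \<Rightarrow> 'i \<Rightarrow> 'k" where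
  "dS H g = (\<lambda>b. \<Sum>a\<in>UNIV. g a * hant H b a)"

definition left_ideal :: "('i::finite, 'k::field) hopf \<Rightarrow> ('i \<Rightarrow> 'k) set \<Rightarrow> bool" where
  "left_ideal H I \<longleftrightarrow> (\<lambda>_. 0) \<in> I \<and> (\<forall>x\<in>I. \<forall>y\<in>I. (\<lambda>i. x i + y i) \<in> I) \<and>
     (\<forall>c. \<forall>x\<in>I. (\<lambda>i. c * x i) \<in> I) \<and> (\<forall>h. \<forall>x\<in>I. hm H h x \<in> I)"

definition semisimple :: "('i::finite, 'k::field) hopf \<Rightarrow> bool" where
  "semisimple H \<longleftrightarrow> (\<forall>I. left_ideal H I \<longrightarrow> (\<exists>J. left_ideal H J \<and> I \<inter> J = {(\<lambda>_. 0)} \<and>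
      (\<forall>x. \<exists>u\<in>I. \<exists>w\<in>J. x = (\<lambda>i. u i + w i))))"

text \<open>An element u of H (x) H* has coordinates u (a,b) w.r.t. x_a (x) alpha^b.\<close>

definition tens :: "('i \<Rightarrow> 'k::field) \<Rightarrow> ('j \<Rightarrow> 'k) \<Rightarrow> 'i \<times> 'j \<Rightarrow> 'k" where
  "tens x g = (\<lambda>(a, b). x a * g b)"

definition vsum :: "('s \<Rightarrow> 'w \<Rightarrow> 'k::field) \<Rightarrow> 's set \<Rightarrow> 'w \<Rightarrow> 'k" where
  "vsum f A = (\<lambda>w. \<Sum>s\<in>A. f s w)"

definition sc :: "'k::field \<Rightarrow> ('w \<Rightarrow> 'k) \<Rightarrow> 'w \<Rightarrow> 'k" where
  "sc c v = (\<lambda>w. c * v w)"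

definition dmul :: "('i::finite, 'k::field) hopf \<Rightarrow> ('i \<times> 'i \<Rightarrow> 'k) \<Rightarrow> ('i \<times> 'i \<Rightarrow> 'k) \<Rightarrow> 'i \<times> 'i \<Rightarrow> 'k" where
  "dmul H u v = lin (\<lambda>(a, b). lin (\<lambda>(c, d). tens (hm H (bv c) (bv a)) (dm H (bv b) (bv d))) v) u"

text \<open>unit 1 (x) 1 (of D(H)* and of the Heisenberg double); note 1_{H*} = eps\<close>
definition unitD :: "('i::finite, 'k::field) hopf \<Rightarrow> 'i \<times> 'i \<Rightarrow> 'k" where
  "unitD H = tens (heta H) (hceps H)"

text \<open>counit eps(y) eps(gamma); eps_{H*}(alpha^b) = alpha^b(1) = eta b\<close>
definition depsD :: "('i::finite, 'k::field) hopf \<Rightarrow> ('i \<times> 'i \<Rightarrow> 'k) \<Rightarrow> 'k" where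
  "depsD H u = (\<Sum>(a, b)\<in>UNIV. u (a, b) * hceps H a * heta H b)"

definition ttens :: "('s \<Rightarrow> 'k::field) \<Rightarrow> ('t \<Rightarrow> 'k) \<Rightarrow> 's \<times> 't \<Rightarrow> 'k" where
  "ttens u v = (\<lambda>(s, t). u s * v t)"

text \<open>Delta_D(y (x) gamma) = sum_{i,j} (y_(1) (x) alpha^i gamma_(1) alpha^j) (x) (S(x_j) y_(2) x_i (x) gamma_(2)),
  with Delta(x_a) = sum del a a1 a2 x_a1 (x) x_a2 and Delta(alpha^b) = sum mu b1 b2 b alpha^b1 (x) alpha^b2.\<close>
definition DeltaD :: "('i::finite, 'k::field) hopf \<Rightarrow> ('i \<times> 'i \<Rightarrow> 'k) \<Rightarrow> ('i \<times> 'i) \<times> ('i \<times> 'i) \<Rightarrow> 'k" where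
  "DeltaD H u = lin (\<lambda>(a, b). vsum (\<lambda>(i, j, a1, a2, b1, b2).
       sc (hdel H a a1 a2 * hmu H b1 b2 b)
          (ttens (tens (bv a1) (dm H (dm H (bv i) (bv b1)) (bv j)))
                 (tens (hm H (hm H (hS H (bv j)) (bv a2)) (bv i)) (bv b2)))) UNIV) u"

text \<open>S_D(y (x) gamma) = sum_{i,j} x_i S^{-1}(y) x_j (x) S(alpha^j) S(gamma) alpha^i   (S^{-1} = S since S^2 = id)\<close>
definition SD :: "('i::finite, 'k::field) hopf \<Rightarrow> ('i \<times> 'i \<Rightarrow> 'k) \<Rightarrow> 'i \<times> 'i \<Rightarrow> 'k" where
  "SD H u = lin (\<lambda>(a, b). vsum (\<lambda>(i, j).
       tens (hm H (hm H (bv i) (hS H (bv a))) (bv j)) (dm H (dm H (dS H (bv j)) (dS H (bv b))) (bv i))) UNIV) u"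

text \<open>pairing <a (x) b, R> = eps(y) eps(delta) gamma(z) for a = y (x) gamma, b = z (x) delta\<close>
definition Rpair :: "('i::finite, 'k::field) hopf \<Rightarrow> ('i \<times> 'i \<Rightarrow> 'k) \<Rightarrow> ('i \<times> 'i \<Rightarrow> 'k) \<Rightarrow> 'k" where
  "Rpair H u v = (\<Sum>(a, b)\<in>UNIV. \<Sum>(c, d)\<in>UNIV. u (a, b) * v (c, d) * hceps H a * heta H d * kd b c)"

text \<open>Heisenberg double: (h (x) alpha)(h' (x) alpha') = <alpha_(1), h'_(2)> h h'_(1) (x) alpha_(2) alpha'\<close>
definition heis :: "('i::finite, 'k::field) hopf \<Rightarrow> ('i \<times> 'i \<Rightarrow> 'k) \<Rightarrow> ('i \<times> 'i \<Rightarrow> 'k) \<Rightarrow> 'i \<times> 'i \<Rightarrow> 'k" where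
  "heis H u v = lin (\<lambda>(a, b). lin (\<lambda>(c, d). vsum (\<lambda>(b1, b2, c1, c2).
       sc (hmu H b1 b2 b * hdel H c c1 c2 * kd b1 c2)
          (tens (hm H (bv a) (bv c1)) (dm H (bv b2) (bv d)))) UNIV) v) u"

text \<open>An element of (H (x) H*)^{(x) E} is a coordinate function on ('e => 'i x 'i).\<close>

definition pure :: "('i::finite, 'k::field) hopf \<Rightarrow> 'e::finite \<Rightarrow> ('i \<times> 'i \<Rightarrow> 'k) \<Rightarrow> ('e \<Rightarrow> 'i \<times> 'i) \<Rightarrow> 'k" where
  "pure H e u = (\<lambda>f. u (f e) * (\<Prod>e'\<in>UNIV - {e}. unitD H (f e')))"

definition tone :: "('i::finite, 'k::field) hopf \<Rightarrow> ('e::finite \<Rightarrow> 'i \<times> 'i) \<Rightarrow> 'k" where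
  "tone H = (\<lambda>f. \<Prod>e\<in>UNIV. unitD H (f e))"

definition tmul :: "(('s::finite \<Rightarrow> 'k::field) \<Rightarrow> ('s \<Rightarrow> 'k) \<Rightarrow> 's \<Rightarrow> 'k) \<Rightarrow>
     (('e::finite \<Rightarrow> 's) \<Rightarrow> 'k) \<Rightarrow> (('e \<Rightarrow> 's) \<Rightarrow> 'k) \<Rightarrow> ('e \<Rightarrow> 's) \<Rightarrow> 'k" where
  "tmul M U V = (\<lambda>h. \<Sum>f\<in>UNIV. \<Sum>g\<in>UNIV. U f * V g * (\<Prod>e\<in>UNIV. M (bv (f e)) (bv (g e)) (h e)))"

type_synonym ('i, 'k, 'e) holmap = "('i \<times> 'i \<Rightarrow> 'k) \<Rightarrow> ('e \<Rightarrow> 'i \<times> 'i) \<Rightarrow> 'k"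

definition conv :: "('i::finite, 'k::field) hopf \<Rightarrow> ('i, 'k, 'e::finite) holmap \<Rightarrow> ('i, 'k, 'e) holmap \<Rightarrow> ('i, 'k, 'e) holmap" where
  "conv H \<phi> \<psi> u = (\<lambda>h. \<Sum>(s, t)\<in>UNIV. DeltaD H u (s, t) * tmul (dmul H) (\<phi> (bv s)) (\<psi> (bv t)) h)"

definition hol_unit :: "('i::finite, 'k::field) hopf \<Rightarrow> ('i, 'k, 'e::finite) holmap" where
  "hol_unit H u = sc (depsD H u) (tone H)"

text \<open>edges of the thickening Gamma_D: TR e = r(e), TL e = l(e), TRB e = r(bar e), TLB e = l(bar e)\<close>
datatype 'e tedge = TR 'e | TL 'e | TRB 'e | TLB 'e

fun hol_edge :: "('i::finite, 'k::field) hopf \<Rightarrow> 'e::finite tedge \<Rightarrow> ('i, 'k, 'e) holmap" where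
  "hol_edge H (TR e) u = pure H e (\<lambda>(p, q). heta H p * (\<Sum>a\<in>UNIV. u (a, q) * hceps H a))"
| "hol_edge H (TRB e) u = pure H e (\<lambda>(p, q). (\<Sum>b\<in>UNIV. u (p, b) * heta H b) * hceps H q)"
| "hol_edge H (TL e) u = pure H e (lin (\<lambda>(a, b). sc (hceps H a) (vsum (\<lambda>(i, j).
       tens (hm H (bv i) (hS H (bv j))) (dm H (dm H (bv j) (bv b)) (bv i))) UNIV)) u)"
| "hol_edge H (TLB e) u = pure H e (lin (\<lambda>(a, b). sc (heta H b) (vsum (\<lambda>(i, j).
       tens (hm H (hm H (bv i) (bv a)) (hS H (bv j))) (dm H (bv j) (bv i))) UNIV)) u)"

text \<open>a letter of a path word: (x, False) = x, (x, True) = x^{-1};  Hol_{x^{-1}} = Hol_x o S_D\<close>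
definition hol_letter :: "('i::finite, 'k::field) hopf \<Rightarrow> 'e::finite tedge \<times> bool \<Rightarrow> ('i, 'k, 'e) holmap" where
  "hol_letter H xb = (if snd xb then hol_edge H (fst xb) \<circ> SD H else hol_edge H (fst xb))"

text \<open>words are read right to left: [p, q] = p o q, and Hol_{p o q} = Hol_p . Hol_q\<close>
definition hol_path :: "('i::finite, 'k::field) hopf \<Rightarrow> ('e::finite tedge \<times> bool) list \<Rightarrow> ('i, 'k, 'e) holmap" where
  "hol_path H w = foldr (conv H) (map (hol_letter H) w) (hol_unit H)"

definition inv_path :: "('e tedge \<times> bool) list \<Rightarrow> ('e tedge \<times> bool) list" where
  "inv_path w = rev (map (\<lambda>(x, b). (x, \<not> b)) w)"

text \<open>Edge ends: (e, True) is the target end of e, (e, False) its starting end.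
  gord v is the linear ordering (cilium) of the edge ends at v.\<close>
record ('v, 'e) cgraph =
  gsrc :: "'e \<Rightarrow> 'v"
  gtgt :: "'e \<Rightarrow> 'v"
  gord :: "'v \<Rightarrow> ('e \<times> bool) list"

definition end_vertex :: "('v, 'e) cgraph \<Rightarrow> 'e \<times> bool \<Rightarrow> 'v" where
  "end_vertex G x = (if snd x then gtgt G (fst x) else gsrc G (fst x))"

definition ends_at :: "('v, 'e) cgraph \<Rightarrow> 'v \<Rightarrow> ('e \<times> bool) set" where
  "ends_at G v = {x. end_vertex G x = v}"

definition ciliated_graph :: "('v::finite, 'e::finite) cgraph \<Rightarrow> bool" where
  "ciliated_graph G \<longleftrightarrow> (\<forall>v. distinct (gord G v) \<and> set (gord G v) = ends_at G v)"

definition pos :: "'a list \<Rightarrow> 'a \<Rightarrow> nat" where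
  "pos xs x = length (takeWhile (\<lambda>y. y \<noteq> x) xs)"

definition cyc_next :: "('v, 'e) cgraph \<Rightarrow> 'e \<times> bool \<Rightarrow> 'e \<times> bool" where
  "cyc_next G x = (let l = gord G (end_vertex G x) in l ! ((pos l x + 1) mod length l))"

text \<open>Darts (edges with a direction of traversal) are identified with the edge end through
  which they arrive: (e, True) traverses e from st(e) to ta(e), (e, False) traverses e^{-1}.
  A face path arriving through the end x continues through the neighbouring end of x in the
  cyclic ordering (maximal turn); faces are the orbits of this map.\<close>
definition face_next :: "('v, 'e) cgraph \<Rightarrow> 'e \<times> bool \<Rightarrow> 'e \<times> bool" where
  "face_next G d = (let y = cyc_next G d in (fst y, \<not> snd y))"

definition face_of :: "('v, 'e) cgraph \<Rightarrow> 'e \<times> bool \<Rightarrow> ('e \<times> bool) set" where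
  "face_of G d = {(face_next G ^^ n) d | n. True}"

text \<open>a face passes the cilium at v when it passes the corner between the last and the first edge end at v\<close>
definition cilia_in_face :: "('v, 'e) cgraph \<Rightarrow> ('e \<times> bool) set \<Rightarrow> nat" where
  "cilia_in_face G F = card {d\<in>F. d = last (gord G (end_vertex G d))}"

definition regular_ciliated :: "('v::finite, 'e::finite) cgraph \<Rightarrow> bool" where
  "regular_ciliated G \<longleftrightarrow> ciliated_graph G \<and>
     (\<forall>e. gsrc G e \<noteq> gtgt G e) \<and>
     (\<forall>e f. e \<noteq> f \<longrightarrow> {gsrc G e, gtgt G e} \<noteq> {gsrc G f, gtgt G f}) \<and>
     (\<forall>d e. \<not> ((e, True) \<in> face_of G d \<and> (e, False) \<in> face_of G d)) \<and>
     (\<forall>d. cilia_in_face G (face_of G d) = 1)"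

text \<open>the end of the edge g at the vertex v (for graphs without loops)\<close>
definition end_at :: "('v, 'e) cgraph \<Rightarrow> 'v \<Rightarrow> 'e \<Rightarrow> 'e \<times> bool" where
  "end_at G v g = (g, gtgt G g = v)"

definition incident :: "('v, 'e) cgraph \<Rightarrow> 'v \<Rightarrow> 'e \<Rightarrow> bool" where
  "incident G v g \<longleftrightarrow> gsrc G g = v \<or> gtgt G g = v"

definition less_at :: "('v, 'e) cgraph \<Rightarrow> 'v \<Rightarrow> 'e \<Rightarrow> 'e \<Rightarrow> bool" where
  "less_at G v e f \<longleftrightarrow> incident G v e \<and> incident G v f \<and>
     pos (gord G v) (end_at G v e) < pos (gord G v) (end_at G v f)"

definition no_common_vertex :: "('v, 'e) cgraph \<Rightarrow> 'e \<Rightarrow> 'e \<Rightarrow> bool" where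
  "no_common_vertex G e f \<longleftrightarrow> {gsrc G e, gtgt G e} \<inter> {gsrc G f, gtgt G f} = {}"

definition edge_less :: "('v, 'e) cgraph \<Rightarrow> 'e \<Rightarrow> 'e \<Rightarrow> bool" where
  "edge_less G e f \<longleftrightarrow> e \<noteq> f \<and> (no_common_vertex G e f \<or> (\<exists>v. less_at G v e f))"

text \<open>r(bar(g^eps)) for the orientation g^eps of g that is incoming at the vertex of the end x:
  r(bar g) if g is incoming, r(bar(g^{-1})) = l(bar g)^{-1} if g is outgoing\<close>
definition inc_letter :: "'e \<times> bool \<Rightarrow> 'e tedge \<times> bool" where
  "inc_letter x = (if snd x then (TRB (fst x), False) else (TLB (fst x), True))"

definition p_ta :: "('v, 'e) cgraph \<Rightarrow> 'e \<Rightarrow> ('e tedge \<times> bool) list" where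
  "p_ta G e = map inc_letter (takeWhile (\<lambda>y. y \<noteq> (e, True)) (gord G (gtgt G e)))"

definition p_st :: "('v, 'e) cgraph \<Rightarrow> 'e \<Rightarrow> ('e tedge \<times> bool) list" where
  "p_st G e = map inc_letter (takeWhile (\<lambda>y. y \<noteq> (e, False)) (gord G (gsrc G e)))"

definition p_plus :: "('v, 'e) cgraph \<Rightarrow> 'e \<Rightarrow> ('e tedge \<times> bool) list" where
  "p_plus G e = p_ta G e @ [(TRB e, False), (TR e, False)] @ inv_path (p_st G e)"

definition p_minus :: "('v, 'e) cgraph \<Rightarrow> 'e \<Rightarrow> ('e tedge \<times> bool) list" where
  "p_minus G e = p_ta G e @ [(TL e, False), (TLB e, False)] @ inv_path (p_st G e)"

text \<open>Free unital associative algebra on generators (e, s), s a basis index of D(H)*: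
  finitely supported functions on words.\<close>
type_synonym ('g, 'k) fa = "'g list \<Rightarrow> 'k"

definition fa_carrier :: "('g, 'k::field) fa set" where
  "fa_carrier = {P. finite {w. P w \<noteq> 0}}"

definition fa_zero :: "('g, 'k::field) fa" where "fa_zero = (\<lambda>w. 0)"
definition fa_one :: "('g, 'k::field) fa" where "fa_one = (\<lambda>w. if w = [] then 1 else 0)"
definition fa_add :: "('g, 'k::field) fa \<Rightarrow> ('g, 'k) fa \<Rightarrow> ('g, 'k) fa" where
  "fa_add P Q = (\<lambda>w. P w + Q w)"
definition fa_diff :: "('g, 'k::field) fa \<Rightarrow> ('g, 'k) fa \<Rightarrow> ('g, 'k) fa" where
  "fa_diff P Q = (\<lambda>w. P w - Q w)"
definition fa_scale :: "'k::field \<Rightarrow> ('g, 'k) fa \<Rightarrow> ('g, 'k) fa" where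
  "fa_scale c P = (\<lambda>w. c * P w)"
definition fa_mul :: "('g, 'k::field) fa \<Rightarrow> ('g, 'k) fa \<Rightarrow> ('g, 'k) fa" where
  "fa_mul P Q = (\<lambda>w. \<Sum>k\<in>{0..length w}. P (take k w) * Q (drop k w))"

definition gen :: "'e \<Rightarrow> ('i \<times> 'i \<Rightarrow> 'k::field) \<Rightarrow> ('e \<times> ('i \<times> 'i), 'k) fa" where
  "gen e a = (\<lambda>w. if length w = 1 \<and> fst (hd w) = e then a (snd (hd w)) else 0)"

text \<open>incoming (tau = 0) or outgoing (tau = 1) at v;
  split_R gives S_D^tau(a_(1+tau)) and split_G gives a_(2-tau) for a_(1) (x) a_(2) = s (x) t\<close>
definition split_R :: "('i::finite, 'k::field) hopf \<Rightarrow> bool \<Rightarrow> 'i \<times> 'i \<Rightarrow> 'i \<times> 'i \<Rightarrow> 'i \<times> 'i \<Rightarrow> 'k" where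
  "split_R H incoming s t = (if incoming then bv s else SD H (bv t))"
definition split_G :: "bool \<Rightarrow> 'i \<times> 'i \<Rightarrow> 'i \<times> 'i \<Rightarrow> 'i \<times> 'i \<Rightarrow> 'k::field" where
  "split_G incoming s t = (if incoming then bv t else bv s)"

definition fa_vsum :: "('s \<Rightarrow> ('g, 'k::field) fa) \<Rightarrow> 's set \<Rightarrow> ('g, 'k) fa" where
  "fa_vsum F A = (\<lambda>w. \<Sum>s\<in>A. F s w)"

definition relations :: "('i::finite, 'k::field) hopf \<Rightarrow> ('v::finite, 'e::finite) cgraph \<Rightarrow> ('e \<times> ('i \<times> 'i), 'k) fa set" where
  "relations H G =
     {fa_diff (gen e (unitD H)) fa_one | e. True} \<union>
     \<comment> \<open>(R1)\<close>
     {fa_diff (fa_mul (gen e b) (gen e a))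
        (fa_vsum (\<lambda>((s, t), (s', t')). fa_scale (DeltaD H a (s, t) * DeltaD H b (s', t') * Rpair H (bv s) (bv s'))
           (gen e (dmul H (bv t) (bv t')))) UNIV) | e a b. True} \<union>
     \<comment> \<open>(R2)\<close>
     {fa_diff (fa_mul (gen f b) (gen e a)) (fa_mul (gen e a) (gen f b)) | e f a b. no_common_vertex G e f} \<union>
     \<comment> \<open>(R3)\<close>
     {fa_diff (fa_mul (gen f b) (gen e a))
        (fa_vsum (\<lambda>((s, t), (s', t')). fa_scale (DeltaD H a (s, t) * DeltaD H b (s', t') *
              Rpair H (split_R H (gtgt G e = v) s t) (split_R H (gtgt G f = v) s' t'))
           (fa_mul (gen e (split_G (gtgt G e = v) s t)) (gen f (split_G (gtgt G f = v) s' t')))) UNIV)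
      | e f v a b. e \<noteq> f \<and> less_at G v e f}"

inductive_set fa_ideal :: "('g, 'k::field) fa set \<Rightarrow> ('g, 'k) fa set" for R where
  zero: "fa_zero \<in> fa_ideal R"
| gen: "r \<in> R \<Longrightarrow> X \<in> fa_carrier \<Longrightarrow> Y \<in> fa_carrier \<Longrightarrow> fa_mul (fa_mul X r) Y \<in> fa_ideal R"
| add: "P \<in> fa_ideal R \<Longrightarrow> Q \<in> fa_ideal R \<Longrightarrow> fa_add P Q \<in> fa_ideal R"
| scale: "P \<in> fa_ideal R \<Longrightarrow> fa_scale c P \<in> fa_ideal R"

text \<open>An algebra homomorphism A*_Gamma = F<gens>/I -> H(H)^{op (x) E}, represented by its
  composite with the quotient map: a unital algebra map on the free algebra (into the opposite
  algebra) vanishing on the ideal of relations.\<close>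
definition alg_hom_op :: "('i::finite, 'k::field) hopf \<Rightarrow> ('v::finite, 'e::finite) cgraph \<Rightarrow>
     (('e \<times> ('i \<times> 'i), 'k) fa \<Rightarrow> ('e \<Rightarrow> 'i \<times> 'i) \<Rightarrow> 'k) \<Rightarrow> bool" where
  "alg_hom_op H G \<chi> \<longleftrightarrow>
     (\<forall>P\<in>fa_carrier. \<forall>Q\<in>fa_carrier. \<chi> (fa_add P Q) = (\<lambda>h. \<chi> P h + \<chi> Q h)) \<and>
     (\<forall>c. \<forall>P\<in>fa_carrier. \<chi> (fa_scale c P) = (\<lambda>h. c * \<chi> P h)) \<and>
     (\<forall>P\<in>fa_carrier. \<forall>Q\<in>fa_carrier. \<chi> (fa_mul P Q) = tmul (heis H) (\<chi> Q) (\<chi> P)) \<and>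
     \<chi> fa_one = tone H \<and>
     (\<forall>P\<in>fa_ideal (relations H G). \<chi> P = (\<lambda>h. 0))"

end

theory Submission
  imports Defs "HOL-Library.FuncSet"
begin

text \<open>
  The Heisenberg double acts faithfully on \<open>H\<close>: elements of \<open>H\<close> by left multiplication \<open>L\<close>, elements of
  \<open>H*\<close> by \<open>T g k = k_(1) <g, k_(2)>\<close>. Because \<open>S^2 = id\<close>, the holonomy of \<open>l(bar e)\<close> acts by right
  multiplication \<open>R\<close>, so the letters of the two ends of an edge commute. Without loops and multiple edges
  all letters of \<open>p_(e,+)\<close> outside \<open>e\<close> lie on different edges, and a path \<open>p_<\<close> along the lower edge ends
  at a vertex yields an algebra map \<open>Phi\<close> from \<open>H\<close>. With the invertible element
  \<open>V = sum_i T(alpha^i) Phi_(s(e)<)(x_i)\<close> one finds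
  \<open>Hol_(p_(e,+))(y (x) g) = V^-1 Phi_(t(e)<)(y_(1)) L(y_(2)) T(g) V\<close>, which makes the relation (R1) the
  multiplicativity of a conjugated representation of the Heisenberg double. For (R3), the holonomy of the larger
  edge \<open>f\<close> contains the factor \<open>Phi\<close> of the path passing \<open>e\<close>; moving it past the holonomy of \<open>e\<close>
  produces exactly the R-matrix, while everything else in the holonomy of \<open>f\<close> commutes with that of \<open>e\<close>.
\<close>

section \<open>Square matrices as a ring\<close>

text \<open>Holonomies are convolved with the multiplication of \<open>D(H)^*\<close>, whereas the
  target carries the Heisenberg multiplication, so a holonomy is not visibly a product in the
  target. The two multiplications agree on factors of different edges, and along
  \<open>p_(e,+)\<close> only the two letters of \<open>e\<close> itself share a factor. That single
  product is computed by hand; all others become products of matrices. The dual-basis sums in the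
  comultiplication of \<open>D(H)^*\<close> are conjugations by a canonical element in disguise.
  This turns identities with many Sweedler indices into the cancellation of an invertible factor.
  Identities that have to hold for arbitrary data inserted into a coefficient tensor are tested on
  one linearly independent family of products of commuting matrices. For (R3), one extraction of an
  element of \<open>H\<close> from the second argument has to be regrouped into two successive ones.
  This is a coaction property; it is immediate at an incoming end and is the hardest identity at an
  outgoing end, where the antipode of \<open>D(H)^*\<close> intervenes.\<close>

typedef ('s, 'k) mat = "UNIV :: ('s \<Rightarrow> 's \<Rightarrow> 'k) set"
  morphisms ent Mat by simp

lemma ent_Mat [simp]: "ent (Mat f) = f"
  by (simp add: Mat_inverse)

lemma mat_eqI: "(\<And>i j. ent X i j = ent Y i j) \<Longrightarrow> X = Y"
  by (metis ent_inject ext)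

instantiation mat :: (finite, field) ring_1
begin

definition "zero_mat = Mat (\<lambda>i j. 0)"
definition "one_mat = Mat kd"
definition "plus_mat X Y = Mat (\<lambda>i j. ent X i j + ent Y i j)"
definition "uminus_mat X = Mat (\<lambda>i j. - ent X i j)"
definition "minus_mat X Y = Mat (\<lambda>i j. ent X i j - ent Y i j)"
definition "times_mat X Y = Mat (\<lambda>i j. \<Sum>h\<in>UNIV. ent X i h * ent Y h j)"

instance
proof
  fix a b c :: "('a, 'b) mat"
  show "a + b + c = a + (b + c)" by (simp add: plus_mat_def add.assoc)
  show "a + b = b + a" by (simp add: plus_mat_def add.commute)
  show "0 + a = a" by (simp add: plus_mat_def zero_mat_def ent_inverse)
  show "- a + a = 0" by (simp add: plus_mat_def uminus_mat_def zero_mat_def)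
  show "a - b = a + - b" by (simp add: plus_mat_def uminus_mat_def minus_mat_def)
  show "1 * a = a"
    by (intro mat_eqI) (simp add: times_mat_def one_mat_def kd_def if_distrib[of "\<lambda>u. u * _"] cong: if_cong)
  show "a * 1 = a"
    by (intro mat_eqI) (simp add: times_mat_def one_mat_def kd_def if_distrib[of "\<lambda>u. _ * u"] cong: if_cong)
  show "(a + b) * c = a * c + b * c"
    by (simp add: times_mat_def plus_mat_def distrib_right sum.distrib)
  show "a * (b + c) = a * b + a * c"
    by (simp add: times_mat_def plus_mat_def distrib_left sum.distrib)
  show "a * b * c = a * (b * c)"
  proof (intro mat_eqI)
    fix i j
    have "(\<Sum>h\<in>UNIV. (\<Sum>l\<in>UNIV. ent a i l * ent b l h) * ent c h j)
        = (\<Sum>h\<in>UNIV. \<Sum>l\<in>UNIV. ent a i l * ent b l h * ent c h j)"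
      by (simp add: sum_distrib_right)
    also have "\<dots> = (\<Sum>l\<in>UNIV. \<Sum>h\<in>UNIV. ent a i l * ent b l h * ent c h j)"
      by (rule sum.swap)
    finally show "ent (a * b * c) i j = ent (a * (b * c)) i j"
      by (simp add: times_mat_def sum_distrib_left mult.assoc)
  qed
  show "0 \<noteq> (1 :: ('a, 'b) mat)"
  proof
    assume "0 = (1 :: ('a, 'b) mat)"
    then have "ent (0 :: ('a, 'b) mat) undefined undefined = ent (1 :: ('a, 'b) mat) undefined undefined"
      by simp
    then show False by (simp add: zero_mat_def one_mat_def kd_def)
  qed
qed

end

lemma ent_simps [simp]:
  "ent (0 :: ('s::finite, 'k::field) mat) i j = 0"
  "ent (1 :: ('s::finite, 'k::field) mat) i j = kd i j"
  "ent ((X :: ('s::finite, 'k::field) mat) + Y) i j = ent X i j + ent Y i j"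
  by (simp_all add: zero_mat_def one_mat_def plus_mat_def)

lemma ent_times: "ent ((X :: ('s::finite, 'k::field) mat) * Y) i j = (\<Sum>h\<in>UNIV. ent X i h * ent Y h j)"
  by (simp add: times_mat_def)

lemma ent_sum [simp]: "ent (sum F A :: ('s::finite, 'k::field) mat) i j = (\<Sum>a\<in>A. ent (F a) i j)"
  by (induction A rule: infinite_finite_induct) auto

definition scl :: "'k::field \<Rightarrow> ('s::finite, 'k) mat \<Rightarrow> ('s, 'k) mat" (infixr "\<bullet>" 75) where
  "c \<bullet> X = Mat (\<lambda>i j. c * ent X i j)"

lemma ent_scl [simp]: "ent (c \<bullet> X) i j = c * ent X i j"
  by (simp add: scl_def)

lemma scl_simps [simp]:
  "1 \<bullet> X = X" "0 \<bullet> X = 0" "c \<bullet> 0 = 0" "c \<bullet> d \<bullet> X = (c * d) \<bullet> X"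
  "(c \<bullet> X) * Y = c \<bullet> (X * Y)" "X * (c \<bullet> Y) = c \<bullet> (X * Y)"
  by (auto intro!: mat_eqI simp: ent_times sum_distrib_left ac_simps)

lemma scl_add: "c \<bullet> (X + Y) = c \<bullet> X + c \<bullet> Y" "(c + d) \<bullet> X = c \<bullet> X + d \<bullet> X"
  by (auto intro!: mat_eqI simp: algebra_simps)

lemma scl_sum: "c \<bullet> sum F A = (\<Sum>a\<in>A. c \<bullet> F a)"
  by (auto intro!: mat_eqI simp: sum_distrib_left)

lemma sum_scl: "sum c A \<bullet> X = (\<Sum>a\<in>A. c a \<bullet> X)"
  by (auto intro!: mat_eqI simp: sum_distrib_right)

subsection \<open>Linear extension of families of matrices\<close>

definition lc :: "('t::finite \<Rightarrow> 'k::field) \<Rightarrow> ('t \<Rightarrow> ('s::finite, 'k) mat) \<Rightarrow> ('s, 'k) mat" where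
  "lc u F = (\<Sum>t\<in>UNIV. u t \<bullet> F t)"

lemma ent_lc: "ent (lc u F) i j = (\<Sum>t\<in>UNIV. u t * ent (F t) i j)"
  by (simp add: lc_def)

lemma lc_mult_left: "lc u F * X = lc u (\<lambda>t. F t * X)"
  by (simp add: lc_def sum_distrib_right)

lemma lc_mult_right: "X * lc u F = lc u (\<lambda>t. X * F t)"
  by (simp add: lc_def sum_distrib_left)

lemma lc_mult: "lc u F * lc v G = lc u (\<lambda>s. lc v (\<lambda>t. F s * G t))"
  by (simp only: lc_mult_left) (simp only: lc_mult_right)

lemma lc_scl: "lc u (\<lambda>t. c \<bullet> F t) = c \<bullet> lc u F"
  by (simp add: lc_def scl_sum mult.commute)

lemma lc_sum: "lc u (\<lambda>t. \<Sum>a\<in>A. F t a) = (\<Sum>a\<in>A. lc u (\<lambda>t. F t a))"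
  by (simp add: lc_def scl_sum sum.swap[of _ A])

lemma lc_swap: "lc u (\<lambda>s. lc v (\<lambda>t. F s t)) = lc v (\<lambda>t. lc u (\<lambda>s. F s t))"
  unfolding lc_def[of v] by (simp add: lc_sum lc_scl)

lemma lc_bv [simp]: "lc (bv a) F = F a"
proof -
  have "lc (bv a) F = (\<Sum>t\<in>UNIV. if t = a then F t else 0)"
    unfolding lc_def bv_def by (intro sum.cong) auto
  then show ?thesis by simp
qed

lemma lc_kd [simp]: "lc (kd a) F = F a"
proof -
  have "kd a = (bv a :: _ \<Rightarrow> 'b)" by (auto simp: kd_def bv_def)
  then show ?thesis by simp
qed

lemma lc_add: "lc (\<lambda>t. u t + v t) F = lc u F + lc v F"
  by (simp add: lc_def scl_add sum.distrib)

lemma lc_smult: "lc (\<lambda>t. c * u t) F = c \<bullet> lc u F"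
  by (simp add: lc_def scl_sum)

lemma lc_sum_vec: "lc (\<lambda>t. \<Sum>a\<in>A. u a t) F = (\<Sum>a\<in>A. lc (u a) F)"
  by (simp add: lc_def sum_scl sum.swap[of _ A])

lemma lc_lin: "lc (lin f u) F = lc u (\<lambda>s. lc (f s) F)"
  unfolding lin_def by (simp add: lc_sum_vec lc_smult) (simp add: lc_def)

lemma lc_vsum: "lc (vsum f A) F = (\<Sum>s\<in>A. lc (f s) F)"
  unfolding vsum_def by (rule lc_sum_vec)

lemma lc_sc: "lc (sc c v) F = c \<bullet> lc v F"
  unfolding sc_def by (rule lc_smult)

lemma lc_pair: "lc u F = (\<Sum>a\<in>UNIV. \<Sum>b\<in>UNIV. u (a, b) \<bullet> F (a, b))"
  unfolding lc_def by (simp add: sum.cartesian_product split_def)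

lemma lc_tens: "lc (tens x g) F = lc x (\<lambda>a. lc g (\<lambda>b. F (a, b)))"
  by (simp add: lc_pair tens_def) (simp add: lc_def scl_sum)

lemma lc_ttens: "lc (ttens x g) F = lc x (\<lambda>a. lc g (\<lambda>b. F (a, b)))"
  by (simp add: lc_pair ttens_def) (simp add: lc_def scl_sum)

lemma lc_hm: "lc (hm H x y) F = lc x (\<lambda>a. lc y (\<lambda>b. lc (hmu H a b) F))"
  unfolding hm_def by (simp add: lc_sum_vec lc_smult) (simp add: lc_def scl_sum mult.assoc)

lemma lc_dm: "lc (dm H g d) F = lc g (\<lambda>b. lc d (\<lambda>c. lc (\<lambda>q. hdel H q b c) F))"
  unfolding dm_def by (simp add: lc_sum_vec lc_smult) (simp add: lc_def scl_sum mult.assoc)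

lemma lc_hS: "lc (hS H x) F = lc x (\<lambda>a. lc (hant H a) F)"
  unfolding hS_def by (simp add: lc_sum_vec lc_smult) (simp add: lc_def)

lemma lc_dS: "lc (dS H g) F = lc g (\<lambda>a. lc (\<lambda>b. hant H b a) F)"
  unfolding dS_def by (simp add: lc_sum_vec lc_smult) (simp add: lc_def)

text \<open>Matrices of size one are scalars, so the families \<open>F\<close> include the
  coordinate functionals. The rewrite rules for \<open>lc\<close> thereby also prove equality of
  vectors.\<close>

lemma vec_eqI_lc:
  assumes "\<And>F :: 't \<Rightarrow> (unit, 'k) mat. lc u F = lc v F"
  shows "u = (v :: 't::finite \<Rightarrow> 'k::field)"
proof
  fix t
  have "ent (lc u (\<lambda>s. kd t s \<bullet> 1)) () () = ent (lc v (\<lambda>s. kd t s \<bullet> (1 :: (unit, 'k) mat))) () ()"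
    using assms by simp
  then show "u t = v t"
    by (simp add: ent_lc kd_def if_distrib[of "\<lambda>u. _ * u"] cong: if_cong)
qed

section \<open>Hopf algebras in coordinates\<close>

locale hopf_coords =
  fixes H :: "('i::finite, 'k::field) hopf"
  assumes hopf: "hopf_algebra H"
    and hS_hS [simp]: "hS H (hS H x) = x"
begin

lemmas mu_assoc = hopf[unfolded hopf_algebra_def, THEN conjunct1, rule_format]
lemmas mu_eta_left = hopf[unfolded hopf_algebra_def, THEN conjunct2, THEN conjunct1, rule_format]
lemmas mu_eta_right = hopf[unfolded hopf_algebra_def, THEN conjunct2, THEN conjunct2, THEN conjunct1, rule_format]
lemmas del_coassoc = hopf[unfolded hopf_algebra_def, THEN conjunct2, THEN conjunct2, THEN conjunct2, THEN conjunct1, rule_format]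
lemmas del_ceps_left = hopf[unfolded hopf_algebra_def, THEN conjunct2, THEN conjunct2, THEN conjunct2, THEN conjunct2, THEN conjunct1, rule_format]
lemmas del_ceps_right = hopf[unfolded hopf_algebra_def, THEN conjunct2, THEN conjunct2, THEN conjunct2, THEN conjunct2, THEN conjunct2, THEN conjunct1, rule_format]
lemmas mu_del = hopf[unfolded hopf_algebra_def, THEN conjunct2, THEN conjunct2, THEN conjunct2, THEN conjunct2, THEN conjunct2, THEN conjunct2, THEN conjunct1, rule_format]
lemmas eta_del = hopf[unfolded hopf_algebra_def, THEN conjunct2, THEN conjunct2, THEN conjunct2, THEN conjunct2, THEN conjunct2, THEN conjunct2, THEN conjunct2, THEN conjunct1, rule_format]
lemmas mu_ceps = hopf[unfolded hopf_algebra_def, THEN conjunct2, THEN conjunct2, THEN conjunct2, THEN conjunct2, THEN conjunct2, THEN conjunct2, THEN conjunct2, THEN conjunct2, THEN conjunct1, rule_format]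
lemmas eta_ceps = hopf[unfolded hopf_algebra_def, THEN conjunct2, THEN conjunct2, THEN conjunct2, THEN conjunct2, THEN conjunct2, THEN conjunct2, THEN conjunct2, THEN conjunct2, THEN conjunct2, THEN conjunct1, rule_format]
lemmas ant_left = hopf[unfolded hopf_algebra_def, THEN conjunct2, THEN conjunct2, THEN conjunct2, THEN conjunct2, THEN conjunct2, THEN conjunct2, THEN conjunct2, THEN conjunct2, THEN conjunct2, THEN conjunct2, THEN conjunct1, rule_format]
lemmas ant_right = hopf[unfolded hopf_algebra_def, THEN conjunct2, THEN conjunct2, THEN conjunct2, THEN conjunct2, THEN conjunct2, THEN conjunct2, THEN conjunct2, THEN conjunct2, THEN conjunct2, THEN conjunct2, THEN conjunct2, rule_format]

abbreviation conj_vec :: "'i \<Rightarrow> 'i \<Rightarrow> 'i \<Rightarrow> 'i \<Rightarrow> 'k" where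
  "conj_vec j a i \<equiv> hm H (hm H (hS H (bv j)) (bv a)) (bv i)"

abbreviation dm3 :: "'i \<Rightarrow> 'i \<Rightarrow> 'i \<Rightarrow> 'i \<Rightarrow> 'k" where
  "dm3 i b j \<equiv> dm H (dm H (bv i) (bv b)) (bv j)"

text \<open>\<open>DD a F\<close> stands for \<open>F a_(1) a_(2)\<close> with the comultiplication of \<open>H\<close>, and \<open>Dmu\<close> does the same
  for the comultiplication of \<open>H*\<close>.\<close>

definition DD :: "'i \<Rightarrow> ('i \<Rightarrow> 'i \<Rightarrow> ('s::finite, 'k) mat) \<Rightarrow> ('s, 'k) mat" where
  "DD a F = (\<Sum>b\<in>UNIV. \<Sum>c\<in>UNIV. hdel H a b c \<bullet> F b c)"

definition Dmu :: "'i \<Rightarrow> ('i \<Rightarrow> 'i \<Rightarrow> ('s::finite, 'k) mat) \<Rightarrow> ('s, 'k) mat" where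
  "Dmu g F = (\<Sum>b\<in>UNIV. \<Sum>c\<in>UNIV. hmu H b c g \<bullet> F b c)"

lemma DD_mult_left: "DD a F * X = DD a (\<lambda>b c. F b c * X)"
  by (simp add: DD_def sum_distrib_right)

lemma DD_mult_right: "X * DD a F = DD a (\<lambda>b c. X * F b c)"
  by (simp add: DD_def sum_distrib_left)

lemma DD_scl: "DD a (\<lambda>b c. x \<bullet> F b c) = x \<bullet> DD a F"
  by (simp add: DD_def scl_sum mult.commute)

lemma DD_sum: "DD a (\<lambda>b c. \<Sum>s\<in>A. F b c s) = (\<Sum>s\<in>A. DD a (\<lambda>b c. F b c s))"
  unfolding DD_def scl_sum by (simp add: sum.swap[of _ A])

lemma DD_lc: "DD a (\<lambda>b c. lc u (F b c)) = lc u (\<lambda>s. DD a (\<lambda>b c. F b c s))"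
  unfolding lc_def by (simp add: DD_sum DD_scl)

lemma DD_swap: "DD a (\<lambda>b c. DD d (F b c)) = DD d (\<lambda>p q. DD a (\<lambda>b c. F b c p q))"
  unfolding DD_def[of d] by (simp add: DD_sum DD_scl)

lemma Dmu_mult_left: "Dmu a F * X = Dmu a (\<lambda>b c. F b c * X)"
  by (simp add: Dmu_def sum_distrib_right)

lemma Dmu_mult_right: "X * Dmu a F = Dmu a (\<lambda>b c. X * F b c)"
  by (simp add: Dmu_def sum_distrib_left)

lemma Dmu_scl: "Dmu a (\<lambda>b c. x \<bullet> F b c) = x \<bullet> Dmu a F"
  by (simp add: Dmu_def scl_sum mult.commute)

lemma Dmu_sum: "Dmu a (\<lambda>b c. \<Sum>s\<in>A. F b c s) = (\<Sum>s\<in>A. Dmu a (\<lambda>b c. F b c s))"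
  unfolding Dmu_def scl_sum by (simp add: sum.swap[of _ A])

lemma Dmu_DD: "Dmu a (\<lambda>b c. DD d (F b c)) = DD d (\<lambda>p q. Dmu a (\<lambda>b c. F b c p q))"
  unfolding DD_def by (simp add: Dmu_sum Dmu_scl)

lemma DD_coassoc: "DD a (\<lambda>d r. DD d (\<lambda>p q. F p q r)) = DD a (\<lambda>p d. DD d (\<lambda>q r. F p q r))"
proof -
  have coef: "(\<Sum>d\<in>UNIV. hdel H a d r * hdel H d p q) = (\<Sum>d\<in>UNIV. hdel H a p d * hdel H d q r)" for p q r
    by (rule del_coassoc)
  have "DD a (\<lambda>d r. DD d (\<lambda>p q. F p q r))
      = (\<Sum>d\<in>UNIV. \<Sum>r\<in>UNIV. \<Sum>p\<in>UNIV. \<Sum>q\<in>UNIV. (hdel H a d r * hdel H d p q) \<bullet> F p q r)"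
    by (simp add: DD_def scl_sum)
  also have "\<dots> = (\<Sum>p\<in>UNIV. \<Sum>q\<in>UNIV. \<Sum>r\<in>UNIV. \<Sum>d\<in>UNIV. (hdel H a d r * hdel H d p q) \<bullet> F p q r)"
    unfolding sum.cartesian_product
    by (rule sum.reindex_bij_witness[of _ "\<lambda>(p,q,r,d). (d,r,p,q)" "\<lambda>(d,r,p,q). (p,q,r,d)"]) auto
  also have "\<dots> = (\<Sum>p\<in>UNIV. \<Sum>q\<in>UNIV. \<Sum>r\<in>UNIV. \<Sum>d\<in>UNIV. (hdel H a p d * hdel H d q r) \<bullet> F p q r)"
    by (simp add: coef flip: sum_scl)
  also have "\<dots> = (\<Sum>p\<in>UNIV. \<Sum>d\<in>UNIV. \<Sum>q\<in>UNIV. \<Sum>r\<in>UNIV. (hdel H a p d * hdel H d q r) \<bullet> F p q r)"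
    unfolding sum.cartesian_product
    by (rule sum.reindex_bij_witness[of _ "\<lambda>(p,d,q,r). (p,q,r,d)" "\<lambda>(p,q,r,d). (p,d,q,r)"]) auto
  also have "\<dots> = DD a (\<lambda>p d. DD d (\<lambda>q r. F p q r))"
    by (simp add: DD_def scl_sum)
  finally show ?thesis .
qed

lemma DD_counit_left: "DD a (\<lambda>b c. hceps H b \<bullet> F c) = F a"
proof -
  have coef: "(\<Sum>b\<in>UNIV. hdel H a b c * hceps H b) = kd a c" for c
    by (rule del_ceps_left)
  have "DD a (\<lambda>b c. hceps H b \<bullet> F c) = (\<Sum>c\<in>UNIV. \<Sum>b\<in>UNIV. (hdel H a b c * hceps H b) \<bullet> F c)"
    unfolding DD_def by (subst sum.swap) simp
  also have "\<dots> = lc (kd a) F"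
    by (simp add: coef lc_def flip: sum_scl)
  finally show ?thesis by simp
qed

lemma DD_counit_right: "DD a (\<lambda>b c. hceps H c \<bullet> F b) = F a"
proof -
  have coef: "(\<Sum>c\<in>UNIV. hdel H a b c * hceps H c) = kd a b" for b
    by (rule del_ceps_right)
  have "DD a (\<lambda>b c. hceps H c \<bullet> F b) = (\<Sum>c\<in>UNIV. \<Sum>b\<in>UNIV. (hdel H a c b * hceps H b) \<bullet> F c)"
    unfolding DD_def by simp
  also have "\<dots> = lc (kd a) F"
    by (simp add: coef lc_def flip: sum_scl)
  finally show ?thesis by simp
qed

lemma lc_eta_mu: "lc (heta H) (\<lambda>a. lc (hmu H a b) F) = F b" "lc (heta H) (\<lambda>a. lc (hmu H b a) F) = F b"
proof -
  have "lc (heta H) (\<lambda>a. lc (hmu H a b) F) = lc (\<lambda>c. \<Sum>a\<in>UNIV. heta H a * hmu H a b c) F"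
    by (simp add: lc_sum_vec lc_smult) (simp add: lc_def)
  also have "\<dots> = lc (kd b) F"
    by (simp only: mu_eta_left scl_simps)
  finally show "lc (heta H) (\<lambda>a. lc (hmu H a b) F) = F b" by simp
  have "lc (heta H) (\<lambda>a. lc (hmu H b a) F) = lc (\<lambda>c. \<Sum>a\<in>UNIV. heta H a * hmu H b a c) F"
    by (simp add: lc_sum_vec lc_smult) (simp add: lc_def)
  also have "\<dots> = lc (kd b) F"
    by (simp only: mu_eta_right scl_simps)
  finally show "lc (heta H) (\<lambda>a. lc (hmu H b a) F) = F b" by simp
qed

lemma lc_mu_ceps: "lc (hmu H a b) (\<lambda>c. hceps H c \<bullet> X) = (hceps H a * hceps H b) \<bullet> X"
proof -
  have "lc (hmu H a b) (\<lambda>c. hceps H c \<bullet> X) = (\<Sum>c\<in>UNIV. hmu H a b c * hceps H c) \<bullet> X"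
    by (simp add: lc_def sum_scl)
  also have "\<dots> = (hceps H a * hceps H b) \<bullet> X"
    by (simp only: mu_ceps scl_simps)
  finally show ?thesis .
qed

lemma lc_eta_ceps: "lc (heta H) (\<lambda>c. hceps H c \<bullet> X) = X"
proof -
  have "lc (heta H) (\<lambda>c. hceps H c \<bullet> X) = (\<Sum>c\<in>UNIV. heta H c * hceps H c) \<bullet> X"
    by (simp add: lc_def sum_scl)
  also have "\<dots> = X"
    by (simp only: eta_ceps scl_simps)
  finally show ?thesis .
qed

lemma lc_eta_DD: "lc (heta H) (\<lambda>c. DD c F) = lc (heta H) (\<lambda>p. lc (heta H) (\<lambda>q. F p q))"
proof -
  have coef: "(\<Sum>c\<in>UNIV. heta H c * hdel H c p q) = heta H p * heta H q" for p q
    by (rule eta_del)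
  have "lc (heta H) (\<lambda>c. DD c F) = (\<Sum>c\<in>UNIV. \<Sum>p\<in>UNIV. \<Sum>q\<in>UNIV. (heta H c * hdel H c p q) \<bullet> F p q)"
    by (simp add: lc_def DD_def scl_sum)
  also have "\<dots> = (\<Sum>p\<in>UNIV. \<Sum>q\<in>UNIV. \<Sum>c\<in>UNIV. (heta H c * hdel H c p q) \<bullet> F p q)"
    unfolding sum.cartesian_product
    by (rule sum.reindex_bij_witness[of _ "\<lambda>(p,q,r). (r,p,q)" "\<lambda>(r,p,q). (p,q,r)"]) auto
  also have "\<dots> = lc (heta H) (\<lambda>p. lc (heta H) (\<lambda>q. F p q))"
    by (simp add: coef lc_def scl_sum flip: sum_scl)
  finally show ?thesis .
qed

lemma lc_mu_DD:
  "lc (hmu H a b) (\<lambda>c. DD c F) =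
   DD a (\<lambda>a1 a2. DD b (\<lambda>b1 b2. lc (hmu H a1 b1) (\<lambda>p. lc (hmu H a2 b2) (\<lambda>q. F p q))))"
proof -
  have coef: "(\<Sum>c\<in>UNIV. hmu H a b c * hdel H c p q) =
     (\<Sum>a1\<in>UNIV. \<Sum>a2\<in>UNIV. \<Sum>b1\<in>UNIV. \<Sum>b2\<in>UNIV. hdel H a a1 a2 * hdel H b b1 b2 * hmu H a1 b1 p * hmu H a2 b2 q)" for p q
    by (rule mu_del)
  have "lc (hmu H a b) (\<lambda>c. DD c F) = (\<Sum>c\<in>UNIV. \<Sum>p\<in>UNIV. \<Sum>q\<in>UNIV. (hmu H a b c * hdel H c p q) \<bullet> F p q)"
    by (simp add: lc_def DD_def scl_sum)
  also have "\<dots> = (\<Sum>p\<in>UNIV. \<Sum>q\<in>UNIV. \<Sum>c\<in>UNIV. (hmu H a b c * hdel H c p q) \<bullet> F p q)"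
    unfolding sum.cartesian_product
    by (rule sum.reindex_bij_witness[of _ "\<lambda>(p,q,r). (r,p,q)" "\<lambda>(r,p,q). (p,q,r)"]) auto
  also have "\<dots> = (\<Sum>p\<in>UNIV. \<Sum>q\<in>UNIV. \<Sum>a1\<in>UNIV. \<Sum>a2\<in>UNIV. \<Sum>b1\<in>UNIV. \<Sum>b2\<in>UNIV.
       (hdel H a a1 a2 * (hdel H b b1 b2 * (hmu H a1 b1 p * hmu H a2 b2 q))) \<bullet> F p q)"
    by (simp add: coef mult.assoc flip: sum_scl)
  also have "\<dots> = (\<Sum>a1\<in>UNIV. \<Sum>a2\<in>UNIV. \<Sum>b1\<in>UNIV. \<Sum>b2\<in>UNIV. \<Sum>p\<in>UNIV. \<Sum>q\<in>UNIV.
       (hdel H a a1 a2 * (hdel H b b1 b2 * (hmu H a1 b1 p * hmu H a2 b2 q))) \<bullet> F p q)"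
    unfolding sum.cartesian_product
    by (rule sum.reindex_bij_witness[of _ "\<lambda>(a1,a2,b1,b2,p,q). (p,q,a1,a2,b1,b2)" "\<lambda>(p,q,a1,a2,b1,b2). (a1,a2,b1,b2,p,q)"]) auto
  also have "\<dots> = DD a (\<lambda>a1 a2. DD b (\<lambda>b1 b2. lc (hmu H a1 b1) (\<lambda>p. lc (hmu H a2 b2) (\<lambda>q. F p q))))"
    by (simp add: lc_def DD_def scl_sum)
  finally show ?thesis .
qed

lemma DD_antipode_left: "DD a (\<lambda>b c. lc (hant H b) (\<lambda>d. lc (hmu H d c) F)) = hceps H a \<bullet> lc (heta H) F"
proof -
  have coef: "(\<Sum>b\<in>UNIV. \<Sum>c\<in>UNIV. \<Sum>d\<in>UNIV. hdel H a b c * hant H b d * hmu H d c e) = hceps H a * heta H e" for e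
    by (rule ant_left)
  have "DD a (\<lambda>b c. lc (hant H b) (\<lambda>d. lc (hmu H d c) F))
     = lc (\<lambda>e. \<Sum>b\<in>UNIV. \<Sum>c\<in>UNIV. \<Sum>d\<in>UNIV. hdel H a b c * hant H b d * hmu H d c e) F"
    by (simp add: DD_def lc_sum_vec lc_smult) (simp add: lc_def scl_sum mult.assoc)
  also have "\<dots> = hceps H a \<bullet> lc (heta H) F"
    by (simp add: coef lc_smult)
  finally show ?thesis .
qed

lemma DD_antipode_right: "DD a (\<lambda>b c. lc (hant H c) (\<lambda>d. lc (hmu H b d) F)) = hceps H a \<bullet> lc (heta H) F"
proof -
  have coef: "(\<Sum>b\<in>UNIV. \<Sum>c\<in>UNIV. \<Sum>d\<in>UNIV. hdel H a b c * hant H c d * hmu H b d e) = hceps H a * heta H e" for e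
    by (rule ant_right)
  have "DD a (\<lambda>b c. lc (hant H c) (\<lambda>d. lc (hmu H b d) F))
     = lc (\<lambda>e. \<Sum>b\<in>UNIV. \<Sum>c\<in>UNIV. \<Sum>d\<in>UNIV. hdel H a b c * hant H c d * hmu H b d e) F"
    by (simp add: DD_def lc_sum_vec lc_smult) (simp add: lc_def scl_sum mult.assoc)
  also have "\<dots> = hceps H a \<bullet> lc (heta H) F"
    by (simp add: coef lc_smult)
  finally show ?thesis .
qed

subsection \<open>Convolution\<close>

definition convm :: "('i \<Rightarrow> ('s::finite, 'k) mat) \<Rightarrow> ('i \<Rightarrow> ('s, 'k) mat) \<Rightarrow> 'i \<Rightarrow> ('s, 'k) mat" (infixr "\<star>" 70) where
  "(F \<star> G) a = DD a (\<lambda>b c. F b * G c)"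

definition cone :: "'i \<Rightarrow> ('s::finite, 'k) mat" where
  "cone a = hceps H a \<bullet> 1"

lemma convm_assoc: "(F \<star> G) \<star> K = F \<star> (G \<star> K)"
  by (simp add: fun_eq_iff convm_def DD_mult_left DD_mult_right mult.assoc
      DD_coassoc[of _ "\<lambda>p q r. F p * (G q * K r)"])

lemma convm_cone [simp]: "cone \<star> F = F" "F \<star> cone = F"
  by (simp_all add: fun_eq_iff convm_def cone_def DD_counit_left DD_counit_right)

lemma convm_inverse_unique: "F \<star> G = cone \<Longrightarrow> G \<star> K = cone \<Longrightarrow> F = K"
  by (metis convm_assoc convm_cone)

definition hom :: "('i \<Rightarrow> ('s::finite, 'k) mat) \<Rightarrow> bool" where
  "hom F \<longleftrightarrow> (\<forall>a b. F a * F b = lc (hmu H a b) F) \<and> lc (heta H) F = 1"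

definition antihom :: "('i \<Rightarrow> ('s::finite, 'k) mat) \<Rightarrow> bool" where
  "antihom F \<longleftrightarrow> (\<forall>a b. F b * F a = lc (hmu H a b) F) \<and> lc (heta H) F = 1"

definition ap :: "('i \<Rightarrow> ('s::finite, 'k) mat) \<Rightarrow> 'i \<Rightarrow> ('s, 'k) mat" where
  "ap F a = lc (hant H a) F"

lemma hom_mult: "hom F \<Longrightarrow> F a * F b = lc (hmu H a b) F"
  by (simp add: hom_def)

lemma antihom_mult: "antihom F \<Longrightarrow> F b * F a = lc (hmu H a b) F"
  by (simp add: antihom_def)

lemma hom_eta: "hom F \<Longrightarrow> lc (heta H) F = 1"
  by (simp add: hom_def)

lemma antihom_eta: "antihom F \<Longrightarrow> lc (heta H) F = 1"
  by (simp add: antihom_def)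

lemma hom_hm: "hom F \<Longrightarrow> lc (hm H x y) F = lc x F * lc y F"
  by (simp add: lc_hm lc_mult_left lc_mult_right hom_mult lc_swap[of y])

lemma antihom_hm: "antihom F \<Longrightarrow> lc (hm H x y) F = lc y F * lc x F"
  by (simp add: lc_hm lc_mult_left lc_mult_right antihom_mult lc_swap[of y])

lemma lc_hS_ap: "lc (hS H x) F = lc x (ap F)"
  by (simp add: lc_hS ap_def[abs_def])

lemma ap_ap [simp]: "ap (ap F) = F"
proof
  fix a
  have "ap (ap F) a = lc (hS H (hS H (bv a))) F"
    by (simp only: lc_hS_ap lc_bv)
  then show "ap (ap F) a = F a" by simp
qed

lemma hom_convm_ap:
  assumes "hom F" shows "ap F \<star> F = cone" "F \<star> ap F = cone"
  using assms DD_antipode_left[of _ F] DD_antipode_right[of _ F]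
  by (simp_all add: fun_eq_iff convm_def ap_def lc_mult_left lc_mult_right hom_mult hom_eta cone_def)

text \<open>\<open>F \<star> G\<close> is the comultiplication followed by \<open>F\<close>,
  \<open>G\<close> and multiplication; the last step is multiplicative exactly because the two
  images commute.\<close>

lemma hom_convm:
  assumes F: "hom F" and G: "hom G" and comm: "\<And>a b. F a * G b = G b * F a"
  shows "hom (F \<star> G)"
proof -
  have "(F \<star> G) a * (F \<star> G) b = lc (hmu H a b) (F \<star> G)" for a b
  proof -
    have eq: "F x * G y * F z * G w = (F x * F z) * (G y * G w)" for x y z w
      by (metis comm mult.assoc)
    have "(F \<star> G) a * (F \<star> G) b = DD a (\<lambda>a1 a2. DD b (\<lambda>b1 b2. F a1 * G a2 * F b1 * G b2))"
      by (simp add: convm_def DD_mult_left DD_mult_right mult.assoc) (simp only: DD_swap[of b a])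
    also have "\<dots> = DD a (\<lambda>a1 a2. DD b (\<lambda>b1 b2. (F a1 * F b1) * (G a2 * G b2)))"
      by (simp only: eq)
    also have "\<dots> = lc (hmu H a b) (F \<star> G)"
      by (simp only: hom_mult F G convm_def[abs_def] lc_mu_DD lc_mult_left) (simp only: lc_mult_right)
    finally show ?thesis .
  qed
  moreover have "lc (heta H) (F \<star> G) = 1"
    by (simp add: convm_def[abs_def] lc_eta_DD) (simp add: hom_eta F G flip: lc_mult_left lc_mult_right)
  ultimately show ?thesis by (simp add: hom_def)
qed

lemma hom_cone: "hom cone"
  unfolding hom_def cone_def[abs_def] by (simp add: lc_mu_ceps lc_eta_ceps mult.commute)


subsection \<open>The antipode\<close>

definition Lm :: "'i \<Rightarrow> ('i, 'k) mat" where
  "Lm a = Mat (\<lambda>f g. hmu H a g f)"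

lemma hom_Lm: "hom Lm"
proof -
  have coef: "(\<Sum>d\<in>UNIV. hmu H a b d * hmu H d c e) = (\<Sum>d\<in>UNIV. hmu H b c d * hmu H a d e)" for a b c e
    by (rule mu_assoc)
  have "Lm a * Lm b = lc (hmu H a b) Lm" for a b
  proof (intro mat_eqI)
    fix f g
    have "(\<Sum>h\<in>UNIV. hmu H a h f * hmu H b g h) = (\<Sum>h\<in>UNIV. hmu H b g h * hmu H a h f)"
      by (intro sum.cong refl mult.commute)
    then show "ent (Lm a * Lm b) f g = ent (lc (hmu H a b) Lm) f g"
      unfolding ent_times ent_lc Lm_def ent_Mat using coef[of a b g f] by (simp only:)
  qed
  moreover have "lc (heta H) Lm = 1"
    by (intro mat_eqI) (auto simp: ent_lc Lm_def mu_eta_left kd_def)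
  ultimately show ?thesis by (simp add: hom_def)
qed

text \<open>Applying both operators to the unit element of \<open>H\<close> recovers
  \<open>u\<close> and \<open>v\<close>.\<close>

lemma Lm_faithful:
  assumes "lc u Lm = lc v Lm" shows "u = v"
proof
  fix c
  have coef: "(\<Sum>a\<in>UNIV. heta H a * hmu H b a c) = kd b c" for b
    by (rule mu_eta_right)
  have "(\<Sum>a\<in>UNIV. heta H a * ent (lc w Lm) c a) = w c" for w
  proof -
    have "(\<Sum>a\<in>UNIV. heta H a * ent (lc w Lm) c a) = (\<Sum>b\<in>UNIV. w b * (\<Sum>a\<in>UNIV. heta H a * hmu H b a c))"
      unfolding ent_lc Lm_def ent_Mat sum_distrib_left by (subst sum.swap) (simp only: mult.left_commute)
    also have "\<dots> = w c"
      by (simp add: coef kd_def if_distrib[of "\<lambda>x. _ * x"] cong: if_cong)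
    finally show ?thesis .
  qed
  then show "u c = v c" using assms by metis
qed

text \<open>The antipode is anti-multiplicative: as functions of two arguments,
  \<open>F(S(ab))\<close> is a left and \<open>F(S(b)) F(S(a))\<close> a right convolution inverse
  of \<open>F(a) F(b)\<close>, so the two coincide.\<close>

lemma ap_hom_mult:
  assumes F: "hom F"
  shows "lc (hmu H a b) (ap F) = ap F b * ap F a"
proof -
  let ?P = "\<lambda>a b. lc (hmu H a b) (ap F)"
  have 1: "DD a (\<lambda>a1 a2. DD b (\<lambda>b1 b2. ?P a1 b1 * (F a2 * F b2))) = (hceps H a * hceps H b) \<bullet> 1" for a b
  proof -
    have "DD a (\<lambda>a1 a2. DD b (\<lambda>b1 b2. ?P a1 b1 * (F a2 * F b2))) = lc (hmu H a b) (ap F \<star> F)"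
      by (simp only: hom_mult F convm_def[abs_def] lc_mu_DD lc_mult_left) (simp only: lc_mult_right)
    also have "\<dots> = (hceps H a * hceps H b) \<bullet> 1"
      by (simp add: hom_convm_ap F cone_def[abs_def] lc_mu_ceps)
    finally show ?thesis .
  qed
  have cv: "(F \<star> ap F) c = hceps H c \<bullet> 1" for c
    by (simp add: hom_convm_ap(2)[OF F] cone_def)
  have 2: "DD a (\<lambda>a1 a2. DD b (\<lambda>b1 b2. F a1 * (F b1 * (ap F b2 * ap F a2)))) = (hceps H a * hceps H b) \<bullet> 1" for a b
  proof -
    have "DD a (\<lambda>a1 a2. DD b (\<lambda>b1 b2. F a1 * (F b1 * (ap F b2 * ap F a2))))
       = DD a (\<lambda>a1 a2. F a1 * (F \<star> ap F) b * ap F a2)"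
      by (simp add: convm_def DD_mult_left DD_mult_right mult.assoc)
    also have "\<dots> = (hceps H a * hceps H b) \<bullet> 1"
      by (simp add: hom_convm_ap(2)[OF F] cone_def DD_scl) (simp add: cv[unfolded convm_def] mult.commute)
    finally show ?thesis .
  qed
  \<comment> \<open>The usual uniqueness argument for inverses: insert the counit on the right,
    expand it by \<open>2\<close>, regroup by coassociativity in both arguments and contract the
    left part by \<open>1\<close>.\<close>
  have "?P a b = DD a (\<lambda>a1 a2. DD b (\<lambda>b1 b2. ?P a1 b1 * ((hceps H a2 * hceps H b2) \<bullet> 1)))"
    by (simp add: DD_scl DD_counit_right flip: scl_simps(4))
  also have "\<dots> = DD a (\<lambda>a1 a'. DD b (\<lambda>b1 b'. ?P a1 b1 *
      DD a' (\<lambda>a2 a3. DD b' (\<lambda>b2 b3. F a2 * (F b2 * (ap F b3 * ap F a3))))))"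
    by (simp only: 2)
  also have "\<dots> = DD a (\<lambda>a1 a'. DD a' (\<lambda>a2 a3. DD b (\<lambda>b1 b'. DD b' (\<lambda>b2 b3. ?P a1 b1 * (F a2 * (F b2 * (ap F b3 * ap F a3)))))))"
    by (simp only: DD_mult_right DD_swap[of b])
  also have "\<dots> = DD a (\<lambda>a' a3. DD a' (\<lambda>a1 a2. DD b (\<lambda>b' b3. DD b' (\<lambda>b1 b2. ?P a1 b1 * (F a2 * (F b2 * (ap F b3 * ap F a3)))))))"
    by (simp only: DD_coassoc)
  also have "\<dots> = DD a (\<lambda>a' a3. DD b (\<lambda>b' b3. DD a' (\<lambda>a1 a2. DD b' (\<lambda>b1 b2. ?P a1 b1 * (F a2 * F b2))) * (ap F b3 * ap F a3)))"
    by (simp only: DD_mult_left DD_swap[of b] mult.assoc)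
  also have "\<dots> = DD a (\<lambda>a' a3. DD b (\<lambda>b' b3. (hceps H a' * hceps H b') \<bullet> (ap F b3 * ap F a3)))"
    by (simp add: 1)
  also have "\<dots> = ap F b * ap F a"
    by (simp add: DD_scl DD_counit_left flip: scl_simps(4))
  finally show ?thesis .
qed

lemma hS_hm: "hS H (hm H x y) = hm H (hS H y) (hS H x)"
proof (rule Lm_faithful)
  have "lc (hS H (hm H x y)) Lm = lc x (\<lambda>a. lc y (\<lambda>b. lc (hmu H a b) (ap Lm)))"
    by (simp add: lc_hS_ap lc_hm)
  also have "\<dots> = lc (hS H y) Lm * lc (hS H x) Lm"
    by (simp add: ap_hom_mult hom_Lm lc_hS_ap lc_mult_left lc_mult_right lc_swap[of y])
  finally show "lc (hS H (hm H x y)) Lm = lc (hm H (hS H y) (hS H x)) Lm"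
    by (simp add: hom_hm hom_Lm)
qed

lemma lc_eta_hm: "hm H (heta H) x = x" "hm H x (heta H) = x"
  by (rule Lm_faithful, simp add: hom_hm hom_Lm hom_eta)+

text \<open>As \<open>S\<close> is an involution, \<open>S(S(1) 1)\<close> equals \<open>1\<close>;
  as it reverses products, the same element equals \<open>S(1) S(S(1)) = S(1)\<close>.\<close>

lemma hS_eta: "hS H (heta H) = heta H"
  using hS_hm[of "hS H (heta H)" "heta H"] lc_eta_hm by simp

lemma lc_eta_ap: "lc (heta H) (ap F) = lc (heta H) F"
  using lc_hS_ap[of "heta H" F] by (simp add: hS_eta)

lemma lc_mu_ap: "lc (hmu H a b) (ap F) = lc (hm H (hS H (bv b)) (hS H (bv a))) F"
proof -
  have "lc (hmu H a b) (ap F) = lc (hS H (hm H (bv a) (bv b))) F"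
    by (simp only: lc_hS_ap lc_hm lc_bv)
  then show ?thesis by (simp only: hS_hm)
qed

lemma antihom_ap: "hom F \<Longrightarrow> antihom (ap F)"
  unfolding antihom_def lc_mu_ap by (simp add: hom_hm lc_hS_ap hom_eta lc_eta_ap)

lemma hom_ap: "antihom F \<Longrightarrow> hom (ap F)"
  unfolding hom_def lc_mu_ap by (simp add: antihom_hm lc_hS_ap antihom_eta lc_eta_ap)

lemma antihom_convm_ap:
  assumes "antihom F" shows "F \<star> ap F = cone" "ap F \<star> F = cone"
  using hom_convm_ap[OF hom_ap[OF assms]] by simp_all

lemma antihom_flip:
  assumes "antihom F" shows "DD a (\<lambda>b c. F c * ap F b) = hceps H a \<bullet> 1" "DD a (\<lambda>b c. ap F c * F b) = hceps H a \<bullet> 1"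
  using assms DD_antipode_left[of a F] DD_antipode_right[of a F]
  by (simp_all add: ap_def lc_mult_left lc_mult_right antihom_mult antihom_eta)

text \<open>In general these are the identities of the inverse antipode. Here \<open>ap F\<close> is
  anti-multiplicative and \<open>ap (ap F) = F\<close> because \<open>S^2 = id\<close>, which lets
  the antipode itself appear.\<close>

lemma hom_flip:
  assumes "hom F" shows "DD a (\<lambda>b c. F c * ap F b) = hceps H a \<bullet> 1" "DD a (\<lambda>b c. ap F c * F b) = hceps H a \<bullet> 1"
  using antihom_flip[OF antihom_ap[OF assms]] by simp_all

lemma antihom_convm:
  assumes F: "antihom F" and G: "antihom G" and comm: "\<And>a b. F a * G b = G b * F a"
  shows "antihom (F \<star> G)"
proof -
  have "(F \<star> G) b * (F \<star> G) a = lc (hmu H a b) (F \<star> G)" for a b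
  proof -
    have eq: "F x * G y * F z * G w = (F x * F z) * (G y * G w)" for x y z w
      by (metis comm mult.assoc)
    have "(F \<star> G) b * (F \<star> G) a = DD a (\<lambda>a1 a2. DD b (\<lambda>b1 b2. F b1 * G b2 * F a1 * G a2))"
      by (simp add: convm_def DD_mult_left DD_mult_right mult.assoc)
    also have "\<dots> = DD a (\<lambda>a1 a2. DD b (\<lambda>b1 b2. (F b1 * F a1) * (G b2 * G a2)))"
      by (simp only: eq)
    also have "\<dots> = lc (hmu H a b) (F \<star> G)"
      by (simp only: antihom_mult F G convm_def[abs_def] lc_mu_DD lc_mult_left) (simp only: lc_mult_right)
    finally show ?thesis .
  qed
  moreover have "lc (heta H) (F \<star> G) = 1"
    by (simp add: convm_def[abs_def] lc_eta_DD) (simp add: antihom_eta F G flip: lc_mult_left lc_mult_right)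
  ultimately show ?thesis by (simp add: antihom_def)
qed

text \<open>The counit is the convolution unit and therefore its own inverse, and composition with
  \<open>S\<close> produces the inverse.\<close>

lemma ceps_ap:
  fixes X :: "('s::finite, 'k) mat"
  shows "ap (\<lambda>a. hceps H a \<bullet> X) a = hceps H a \<bullet> X"
proof -
  have "ap cone = (cone :: 'i \<Rightarrow> ('s, 'k) mat)"
    using hom_convm_ap(1)[OF hom_cone] by (metis convm_cone(2))
  then have "ap (cone :: 'i \<Rightarrow> ('s, 'k) mat) a * X = cone a * X"
    by simp
  then show ?thesis
    by (simp add: ap_def cone_def[abs_def] lc_mult_left)
qed

subsection \<open>Canonical elements\<close>

text \<open>An algebra map on the dual of \<open>H\<close>, given by the images of the dual basis.
  The product of the dual has the structure constants of the comultiplication, and its unit is the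
  counit.\<close>

definition dhom :: "('i \<Rightarrow> ('s::finite, 'k) mat) \<Rightarrow> bool" where
  "dhom t \<longleftrightarrow> (\<forall>p q. t p * t q = lc (\<lambda>r. hdel H r p q) t) \<and> lc (hceps H) t = 1"

lemma dhom_mult: "dhom t \<Longrightarrow> t p * t q = lc (\<lambda>r. hdel H r p q) t"
  by (simp add: dhom_def)

lemma dhom_dm: "dhom t \<Longrightarrow> lc (dm H g d) t = lc g t * lc d t"
  by (simp add: lc_dm lc_mult_left lc_mult_right dhom_mult lc_swap[of d])

text \<open>The image of the canonical element, the sum of all \<alpha>^i (x) x_i, under
  \<open>t\<close> and \<open>F\<close>.\<close>

definition can :: "('i \<Rightarrow> ('s::finite, 'k) mat) \<Rightarrow> ('i \<Rightarrow> ('s, 'k) mat) \<Rightarrow> ('s, 'k) mat" where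
  "can t F = (\<Sum>i\<in>UNIV. t i * F i)"

text \<open>Linear maps from \<open>H\<close> to matrices form the tensor product of the dual of
  \<open>H\<close> with the matrices, and convolution is its product. The commutation of
  \<open>F\<close> with \<open>t\<close> makes the passage from this tensor product to matrices
  multiplicative here.\<close>

lemma can_convm:
  assumes t: "dhom t" and comm: "\<And>a b. F a * t b = t b * F a"
  shows "can t (F \<star> G) = can t F * can t G"
proof -
  have "can t F * can t G = (\<Sum>i\<in>UNIV. \<Sum>j\<in>UNIV. t i * F i * (t j * G j))"
    unfolding can_def by (rule sum_product)
  also have "\<dots> = (\<Sum>i\<in>UNIV. \<Sum>j\<in>UNIV. t i * t j * (F i * G j))"
    by (intro sum.cong refl) (metis comm mult.assoc)
  also have "\<dots> = (\<Sum>i\<in>UNIV. \<Sum>j\<in>UNIV. \<Sum>r\<in>UNIV. hdel H r i j \<bullet> (t r * (F i * G j)))"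
    by (simp add: dhom_mult t lc_mult_left) (simp add: lc_def)
  also have "\<dots> = (\<Sum>r\<in>UNIV. \<Sum>i\<in>UNIV. \<Sum>j\<in>UNIV. hdel H r i j \<bullet> (t r * (F i * G j)))"
    unfolding sum.cartesian_product
    by (rule sum.reindex_bij_witness[of _ "\<lambda>(r,p,q). (p,q,r)" "\<lambda>(p,q,r). (r,p,q)"]) auto
  also have "\<dots> = can t (F \<star> G)"
    by (simp add: can_def convm_def DD_mult_right) (simp add: DD_def)
  finally show ?thesis by simp
qed

lemma can_cone: "dhom t \<Longrightarrow> can t cone = 1"
  by (simp add: can_def cone_def dhom_def) (simp add: lc_def)

end

lemma sum_UNIV_pair: "(\<Sum>x\<in>UNIV. f x) = (\<Sum>a\<in>UNIV. \<Sum>b\<in>UNIV. f (a, b))"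
  for f :: "'a::finite \<times> 'b::finite \<Rightarrow> 'c::comm_monoid_add"
  by (simp add: sum.cartesian_product split_def)

lemma sum_mult_kd [simp]: "(\<Sum>x\<in>UNIV. f x * kd x y) = f y" "(\<Sum>x\<in>UNIV. f x * kd y x) = f y"
   "(\<Sum>x\<in>UNIV. kd x y * f x) = f y" "(\<Sum>x\<in>UNIV. kd y x * f x) = f y"
  for f :: "'a::finite \<Rightarrow> 'k::field"
  by (simp_all add: kd_def if_distrib[of "\<lambda>x. _ * x"] if_distrib[of "\<lambda>x. x * _"] cong: if_cong)

lemma sum_kd_scl [simp]: "(\<Sum>x\<in>UNIV. kd x y \<bullet> F x) = F y" "(\<Sum>x\<in>UNIV. kd y x \<bullet> F x) = F y"
  for F :: "'a::finite \<Rightarrow> ('s::finite, 'k::field) mat"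
  by (auto intro!: mat_eqI)

section \<open>Tensor powers of matrices\<close>

lemma prod_sum_UNIV:
  "(\<Prod>e\<in>UNIV. \<Sum>s\<in>UNIV. f e s) = (\<Sum>h\<in>UNIV. \<Prod>e\<in>UNIV. f e (h e))"
  for f :: "'e::finite \<Rightarrow> 's::finite \<Rightarrow> 'k::field"
  using prod_sum_PiE[of UNIV "\<lambda>_. UNIV" f] by (simp add: PiE_UNIV_domain)

definition tp :: "('e::finite \<Rightarrow> ('i::finite, 'k::field) mat) \<Rightarrow> ('e \<Rightarrow> 'i, 'k) mat" where
  "tp A = Mat (\<lambda>f g. \<Prod>e\<in>UNIV. ent (A e) (f e) (g e))"

lemma tp_mult: "tp A * tp B = tp (\<lambda>e. A e * B e)"
  by (intro mat_eqI) (simp add: ent_times tp_def prod_sum_UNIV flip: prod.distrib)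

lemma tp_one: "tp (\<lambda>e. 1) = 1"
  by (intro mat_eqI) (auto simp: tp_def kd_def fun_eq_iff)

lemma tp_lc: "tp (\<lambda>e. lc (u e) (F e)) = lc (\<lambda>h. \<Prod>e\<in>UNIV. u e (h e)) (\<lambda>h. tp (\<lambda>e. F e (h e)))"
  by (intro mat_eqI) (simp add: ent_lc tp_def prod_sum_UNIV flip: prod.distrib)

definition emb :: "'e::finite \<Rightarrow> ('i::finite, 'k::field) mat \<Rightarrow> ('e \<Rightarrow> 'i, 'k) mat" where
  "emb e A = tp ((\<lambda>_. 1)(e := A))"

lemma emb_mult: "emb e A * emb e B = emb e (A * B)"
  by (simp add: emb_def tp_mult) (intro arg_cong[of _ _ tp], auto)

lemma emb_one [simp]: "emb e 1 = 1"
  by (simp add: emb_def fun_upd_idem tp_one)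

lemma emb_comm: "e \<noteq> f \<Longrightarrow> emb e A * emb f B = emb f B * emb e A"
  by (simp add: emb_def tp_mult) (intro arg_cong[of _ _ tp], auto)

lemma ent_emb: "ent (emb e A) f g = ent A (f e) (g e) * (\<Prod>e'\<in>UNIV - {e}. kd (f e') (g e'))"
proof -
  have "ent (emb e A) f g = (\<Prod>e'\<in>insert e (UNIV - {e}). ent (((\<lambda>_. 1)(e := A)) e') (f e') (g e'))"
    by (simp add: emb_def tp_def insert_absorb)
  also have "\<dots> = ent A (f e) (g e) * (\<Prod>e'\<in>UNIV - {e}. kd (f e') (g e'))"
    by (subst prod.insert) (auto intro!: prod.cong)
  finally show ?thesis .
qed

lemma emb_lc: "emb e (lc u F) = lc u (\<lambda>s. emb e (F s))"
  by (intro mat_eqI) (simp add: ent_emb ent_lc sum_distrib_right mult.assoc)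

lemma emb_scl: "emb e (c \<bullet> A) = c \<bullet> emb e A"
  by (intro mat_eqI) (simp add: ent_emb mult.assoc)

lemma emb_sum: "emb e (sum F S) = (\<Sum>s\<in>S. emb e (F s))"
  by (intro mat_eqI) (simp add: ent_emb sum_distrib_right)

context hopf_coords
begin

lemma emb_DD: "emb e (DD a F) = DD a (\<lambda>b c. emb e (F b c))"
  by (simp add: DD_def emb_sum emb_scl)

lemma hom_emb: "hom F \<Longrightarrow> hom (\<lambda>a. emb e (F a))"
  by (simp add: hom_def emb_mult flip: emb_lc)

lemma antihom_emb: "antihom F \<Longrightarrow> antihom (\<lambda>a. emb e (F a))"
  by (simp add: antihom_def emb_mult flip: emb_lc)

lemma dhom_emb: "dhom F \<Longrightarrow> dhom (\<lambda>a. emb e (F a))"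
  by (simp add: dhom_def emb_mult flip: emb_lc)

section \<open>The action of the Heisenberg double on $H$\<close>

definition Rm :: "'i \<Rightarrow> ('i, 'k) mat" where
  "Rm a = Mat (\<lambda>f g. hmu H g a f)"

definition Tm :: "'i \<Rightarrow> ('i, 'k) mat" where
  "Tm q = Mat (\<lambda>f g. hdel H g f q)"

lemma antihom_Rm: "antihom Rm"
proof -
  have "Rm b * Rm a = lc (hmu H a b) Rm" for a b
  proof (intro mat_eqI)
    fix f g
    have "(\<Sum>h\<in>UNIV. hmu H h b f * hmu H g a h) = (\<Sum>h\<in>UNIV. hmu H g a h * hmu H h b f)"
      by (intro sum.cong refl mult.commute)
    then show "ent (Rm b * Rm a) f g = ent (lc (hmu H a b) Rm) f g"
      unfolding ent_times ent_lc Rm_def ent_Mat using mu_assoc[of g a b f] by (simp only:)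
  qed
  moreover have "lc (heta H) Rm = 1"
    by (intro mat_eqI) (auto simp: ent_lc Rm_def mu_eta_right kd_def)
  ultimately show ?thesis by (simp add: antihom_def)
qed

lemma Lm_Rm: "Lm a * Rm b = Rm b * Lm a"
proof (intro mat_eqI)
  fix f g
  have "(\<Sum>h\<in>UNIV. hmu H a h f * hmu H g b h) = (\<Sum>h\<in>UNIV. hmu H g b h * hmu H a h f)"
       "(\<Sum>h\<in>UNIV. hmu H h b f * hmu H a g h) = (\<Sum>h\<in>UNIV. hmu H a g h * hmu H h b f)"
    by (intro sum.cong refl mult.commute)+
  then show "ent (Lm a * Rm b) f g = ent (Rm b * Lm a) f g"
    unfolding ent_times Rm_def Lm_def ent_Mat using mu_assoc[of a g b f] by (simp only:)
qed

lemma dhom_Tm: "dhom Tm"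
proof -
  have "Tm p * Tm q = lc (\<lambda>r. hdel H r p q) Tm" for p q
  proof (intro mat_eqI)
    fix f g
    have "(\<Sum>h\<in>UNIV. hdel H h f p * hdel H g h q) = (\<Sum>h\<in>UNIV. hdel H g h q * hdel H h f p)"
         "(\<Sum>h\<in>UNIV. hdel H h p q * hdel H g f h) = (\<Sum>h\<in>UNIV. hdel H g f h * hdel H h p q)"
      by (intro sum.cong refl mult.commute)+
    then show "ent (Tm p * Tm q) f g = ent (lc (\<lambda>r. hdel H r p q) Tm) f g"
      unfolding ent_times ent_lc Tm_def ent_Mat using del_coassoc[of g q f p] by (simp only:)
  qed
  moreover have "lc (hceps H) Tm = 1"
    by (intro mat_eqI) (auto simp: ent_lc Tm_def mult.commute[of "hceps H _"] del_ceps_right kd_def)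
  ultimately show ?thesis by (simp add: dhom_def)
qed

text \<open>The commutation relation of the Heisenberg double: expand the comultiplication of a
  product \<open>a k\<close> and pair its second tensor factor with \<open>g\<close>.\<close>

lemma Tm_Lm: "Tm g * Lm a = DD a (\<lambda>a1 a2. \<Sum>g2\<in>UNIV. hmu H a2 g2 g \<bullet> (Lm a1 * Tm g2))"
proof (intro mat_eqI)
  fix f k
  have "ent (Tm g * Lm a) f k = (\<Sum>h\<in>UNIV. hmu H a k h * hdel H h f g)"
    by (simp add: ent_times Tm_def Lm_def mult.commute)
  also have "\<dots> = (\<Sum>a1\<in>UNIV. \<Sum>a2\<in>UNIV. \<Sum>h\<in>UNIV. \<Sum>g2\<in>UNIV.
      hdel H a a1 a2 * hdel H k h g2 * hmu H a1 h f * hmu H a2 g2 g)"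
    by (rule mu_del)
  also have "\<dots> = (\<Sum>a1\<in>UNIV. \<Sum>a2\<in>UNIV. \<Sum>g2\<in>UNIV. \<Sum>h\<in>UNIV.
      hdel H a a1 a2 * hdel H k h g2 * hmu H a1 h f * hmu H a2 g2 g)"
    by (intro sum.cong refl sum.swap)
  also have "\<dots> = ent (DD a (\<lambda>a1 a2. \<Sum>g2\<in>UNIV. hmu H a2 g2 g \<bullet> (Lm a1 * Tm g2))) f k"
    by (simp add: DD_def ent_times Tm_def Lm_def sum_distrib_left ac_simps)
  finally show "ent (Tm g * Lm a) f k = \<dots>" .
qed

lemma Tm_Rm: "Tm g * Rm a = DD a (\<lambda>a1 a2. \<Sum>g1\<in>UNIV. hmu H g1 a2 g \<bullet> (Rm a1 * Tm g1))"
proof (intro mat_eqI)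
  fix f k
  have "ent (Tm g * Rm a) f k = (\<Sum>h\<in>UNIV. hmu H k a h * hdel H h f g)"
    by (simp add: ent_times Tm_def Rm_def mult.commute)
  also have "\<dots> = (\<Sum>h\<in>UNIV. \<Sum>g1\<in>UNIV. \<Sum>a1\<in>UNIV. \<Sum>a2\<in>UNIV.
      hdel H k h g1 * hdel H a a1 a2 * hmu H h a1 f * hmu H g1 a2 g)"
    by (rule mu_del)
  also have "\<dots> = (\<Sum>a1\<in>UNIV. \<Sum>a2\<in>UNIV. \<Sum>g1\<in>UNIV. \<Sum>h\<in>UNIV.
      hdel H k h g1 * hdel H a a1 a2 * hmu H h a1 f * hmu H g1 a2 g)"
    unfolding sum.cartesian_product
    by (rule sum.reindex_bij_witness[of _ "\<lambda>(a1,a2,g1,h). (h,g1,a1,a2)" "\<lambda>(h,g1,a1,a2). (a1,a2,g1,h)"]) auto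
  also have "\<dots> = ent (DD a (\<lambda>a1 a2. \<Sum>g1\<in>UNIV. hmu H g1 a2 g \<bullet> (Rm a1 * Tm g1))) f k"
    by (simp add: DD_def ent_times Tm_def Rm_def sum_distrib_left ac_simps)
  finally show "ent (Tm g * Rm a) f k = \<dots>" .
qed

lemma antipode_flip_coord:
  "(\<Sum>b\<in>UNIV. \<Sum>c\<in>UNIV. \<Sum>d\<in>UNIV. hdel H a b c * (hant H c d * hmu H d b e)) = hceps H a * heta H e"
proof -
  have "(\<lambda>e. \<Sum>b\<in>UNIV. \<Sum>c\<in>UNIV. \<Sum>d\<in>UNIV. hdel H a b c * (hant H c d * hmu H d b e)) = (\<lambda>e. hceps H a * heta H e)"
    (is "?u = ?v")
  proof (rule Lm_faithful)
    have "lc ?u Lm = DD a (\<lambda>b c. ap Lm c * Lm b)"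
      by (simp add: lc_sum_vec lc_smult DD_def ap_def lc_mult_left hom_mult hom_Lm) (simp add: lc_def scl_sum mult.assoc)
    also have "\<dots> = lc ?v Lm"
      by (simp add: hom_flip hom_Lm lc_smult hom_eta)
    finally show "lc ?u Lm = lc ?v Lm" .
  qed
  then show ?thesis by (rule fun_cong)
qed

text \<open>Since $S^2 = \mathrm{id}$, the action of the holonomy of $l(\bar e)$ is right multiplication.\<close>

lemma Rm_eq: "Rm a = (\<Sum>i\<in>UNIV. \<Sum>j\<in>UNIV. Lm i * Lm a * ap Lm j * (Tm j * Tm i))"
proof -
  \<comment> \<open>\<open>J\<close> sends \<open>k\<close> to \<open>S(k_(2)) k_(1)\<close>, which
    is \<open>k\<close>'s counit times the unit by the flipped antipode identity. Hence
    \<open>J * Tm i\<close> returns the i-th coordinate of \<open>k\<close> times the unit, and the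
    sum over \<open>i\<close> rebuilds \<open>k\<close> to the left of \<open>a\<close>.\<close>
  define J where "J = (\<Sum>j\<in>UNIV. ap Lm j * Tm j)"
  have J: "ent J f k = hceps H k * heta H f" for f k
  proof -
    have "ent J f k = (\<Sum>j\<in>UNIV. \<Sum>p\<in>UNIV. \<Sum>q\<in>UNIV. hdel H k p j * (hant H j q * hmu H q p f))"
      by (simp add: J_def ent_times ap_def ent_lc Lm_def Tm_def sum_distrib_left sum_distrib_right ac_simps)
    also have "\<dots> = hceps H k * heta H f"
      by (subst sum.swap) (rule antipode_flip_coord)
    finally show ?thesis .
  qed
  have JT: "ent (J * Tm i) f k = heta H f * kd k i" for i f k
  proof -
    have "ent (J * Tm i) f k = heta H f * (\<Sum>h\<in>UNIV. hdel H k h i * hceps H h)"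
      by (simp add: ent_times J Tm_def sum_distrib_left ac_simps)
    then show ?thesis by (simp add: del_ceps_left)
  qed
  have "ent (\<Sum>i\<in>UNIV. Lm i * Lm a * (J * Tm i)) f k = hmu H k a f" for f k
  proof -
    have "ent (\<Sum>i\<in>UNIV. Lm i * Lm a * (J * Tm i)) f k
       = (\<Sum>i\<in>UNIV. (\<Sum>h\<in>UNIV. ent (lc (hmu H i a) Lm) f h * heta H h) * kd k i)"
      by (simp add: ent_times[of "lc _ _"] JT hom_mult hom_Lm sum_distrib_right mult.assoc)
    also have "\<dots> = (\<Sum>h\<in>UNIV. ent (lc (hmu H k a) Lm) f h * heta H h)"
      by (rule sum_mult_kd)
    also have "\<dots> = (\<Sum>h\<in>UNIV. \<Sum>c\<in>UNIV. hmu H k a c * (heta H h * hmu H c h f))"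
      by (simp add: ent_lc Lm_def sum_distrib_left sum_distrib_right ac_simps)
    also have "\<dots> = (\<Sum>c\<in>UNIV. hmu H k a c * (\<Sum>h\<in>UNIV. heta H h * hmu H c h f))"
      by (subst sum.swap) (simp add: sum_distrib_left)
    also have "\<dots> = hmu H k a f"
      by (simp add: mu_eta_right)
    finally show ?thesis .
  qed
  then have "Rm a = (\<Sum>i\<in>UNIV. Lm i * Lm a * (J * Tm i))"
    by (intro mat_eqI) (simp add: Rm_def)
  then show ?thesis
    by (simp add: J_def sum_distrib_left sum_distrib_right mult.assoc)
qed

definition hr :: "'i \<times> 'i \<Rightarrow> ('i, 'k) mat" where
  "hr s = Lm (fst s) * Tm (snd s)"

lemma lc_heis: "lc (heis H u v) hr = lc u hr * lc v hr"
proof -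
  have "(\<Sum>(b1, b2, c1, c2)\<in>UNIV. (hmu H b1 b2 b * hdel H c c1 c2 * kd b1 c2) \<bullet> (Lm a * Lm c1 * (Tm b2 * Tm d)))
     = Lm a * Tm b * (Lm c * Tm d)" for a b c d
  proof -
    have "(\<Sum>(b1, b2, c1, c2)\<in>UNIV. (hmu H b1 b2 b * hdel H c c1 c2 * kd b1 c2) \<bullet> (Lm a * Lm c1 * (Tm b2 * Tm d)))
     = (\<Sum>c1\<in>UNIV. \<Sum>c2\<in>UNIV. \<Sum>b2\<in>UNIV. \<Sum>b1\<in>UNIV. kd b1 c2 \<bullet> ((hmu H b1 b2 b * hdel H c c1 c2) \<bullet> (Lm a * Lm c1 * (Tm b2 * Tm d))))"
      unfolding sum.cartesian_product UNIV_Times_UNIV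
      by (rule sum.reindex_bij_witness[of _ "\<lambda>(c1,c2,b2,b1). (b1,b2,c1,c2)" "\<lambda>(b1,b2,c1,c2). (c1,c2,b2,b1)"])
         (auto simp: mult.commute)
    also have "\<dots> = Lm a * (Tm b * Lm c) * Tm d"
      unfolding sum_kd_scl Tm_Lm DD_def by (simp add: sum_distrib_left sum_distrib_right scl_sum mult.assoc mult.commute[of "hmu H _ _ _"])
    finally show ?thesis by (simp add: mult.assoc)
  qed
  then show ?thesis
    by (simp add: heis_def lc_lin lc_vsum lc_sc lc_tens split_def hr_def lc_mult_left lc_mult_right
       hom_hm hom_Lm dhom_dm dhom_Tm lc_swap[of v u] flip: lc_mult_left[of _ "\<lambda>x. Lm x"] lc_mult_right[of _ _ Tm])
qed

end

section \<open>Multiplication of pure tensors and tests for linear independence\<close>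

definition bil :: "(('s::finite \<Rightarrow> 'k::field) \<Rightarrow> ('s \<Rightarrow> 'k) \<Rightarrow> 's \<Rightarrow> 'k) \<Rightarrow> bool" where
  "bil M \<longleftrightarrow> (\<forall>u v w. M u v w = (\<Sum>s\<in>UNIV. \<Sum>t\<in>UNIV. u s * v t * M (bv s) (bv t) w))"

lemma sum_bv [simp]: "(\<Sum>x\<in>UNIV. bv y x * f x) = f y" "(\<Sum>x\<in>UNIV. f x * bv y x) = f y"
  for f :: "'a::finite \<Rightarrow> 'k::field"
  by (simp_all add: bv_def if_distrib[of "\<lambda>x. _ * x"] if_distrib[of "\<lambda>x. x * _"] cong: if_cong)

lemma bil_lin: "bil (\<lambda>u v. lin (\<lambda>s. lin (X s) v) u)"
  unfolding bil_def lin_def by (simp add: sum_distrib_left mult.assoc)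

lemma bil_dmul: "bil (dmul H)"
  using bil_lin[of "\<lambda>s t. tens (hm H (bv (fst t)) (bv (fst s))) (dm H (bv (snd s)) (bv (snd t)))"]
  by (simp add: dmul_def[abs_def] split_def)

definition pt :: "('e::finite \<Rightarrow> 's \<Rightarrow> 'k::field) \<Rightarrow> ('e \<Rightarrow> 's) \<Rightarrow> 'k" where
  "pt u = (\<lambda>f. \<Prod>e\<in>UNIV. u e (f e))"

lemma pure_pt: "pure H e u = pt ((\<lambda>_. unitD H)(e := u))"
proof
  fix f
  have "pt ((\<lambda>_. unitD H)(e := u)) f = (\<Prod>e'\<in>insert e (UNIV - {e}). ((\<lambda>_. unitD H)(e := u)) e' (f e'))"
    by (simp add: pt_def insert_absorb)
  also have "\<dots> = pure H e u f"
    by (subst prod.insert) (auto simp: pure_def intro!: prod.cong)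
  finally show "pure H e u f = pt ((\<lambda>_. unitD H)(e := u)) f" by simp
qed

lemma tone_pt: "tone H = pt (\<lambda>_. unitD H)"
  by (simp add: tone_def pt_def)

text \<open>\<open>tmul\<close> evaluates \<open>M\<close> on basis vectors only; bilinearity is
  what identifies it with the factorwise product.\<close>

lemma tmul_pt:
  assumes "bil M" shows "tmul M (pt u) (pt v) = pt (\<lambda>e. M (u e) (v e))"
proof
  fix h
  have "pt (\<lambda>e. M (u e) (v e)) h = (\<Prod>e\<in>UNIV. \<Sum>s\<in>UNIV. \<Sum>t\<in>UNIV. u e s * v e t * M (bv s) (bv t) (h e))"
    unfolding pt_def by (intro prod.cong refl assms[unfolded bil_def, rule_format])
  also have "\<dots> = tmul M (pt u) (pt v) h"
    by (simp add: prod_sum_UNIV tmul_def pt_def prod.distrib)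
  finally show "tmul M (pt u) (pt v) h = pt (\<lambda>e. M (u e) (v e)) h" by simp
qed

lemma lc_tmul:
  "lc (tmul M X Y) F = lc X (\<lambda>f. lc Y (\<lambda>g. lc (pt (\<lambda>e. M (bv (f e)) (bv (g e)))) F))"
  unfolding tmul_def by (simp add: lc_sum_vec lc_smult pt_def) (simp add: lc_def scl_sum mult.assoc)

lemma tmul_add_right: "tmul M U (\<lambda>h. X h + Y h) = (\<lambda>h. tmul M U X h + tmul M U Y h)"
  by (simp add: tmul_def algebra_simps sum.distrib)

lemma tmul_scale_right: "tmul M U (\<lambda>h. c * X h) = (\<lambda>h. c * tmul M U X h)"
  by (simp add: tmul_def algebra_simps sum_distrib_left)

lemma tmul_zero_right: "tmul M U (\<lambda>h. 0) = (\<lambda>h. 0)"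
  by (simp add: tmul_def)

lemma lc_hm_right: "lc x (\<lambda>i. lc (hm H u (bv i)) F) = lc (hm H u x) F"
  by (simp add: lc_hm lc_swap[of x])

lemma lc_hm_left: "lc x (\<lambda>i. lc (hm H (bv i) u) F) = lc (hm H x u) F"
  by (simp add: lc_hm)

lemma lc_hm_mid: "lc x (\<lambda>i. lc (hm H (hm H (bv i) w) u) F) = lc (hm H (hm H x w) u) F"
  by (simp add: lc_hm)

lemma lc_hm_mid_hS: "lc x (\<lambda>i. lc (hm H (hm H (hS H (bv i)) w) u) F) = lc (hm H (hm H (hS H x) w) u) F"
  by (simp add: lc_hm lc_hS)

lemma lc_dm_right: "lc x (\<lambda>i. lc (dm H u (bv i)) F) = lc (dm H u x) F"
  by (simp add: lc_dm lc_swap[of x])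

lemma lc_dm_left: "lc x (\<lambda>i. lc (dm H (bv i) u) F) = lc (dm H x u) F"
  by (simp add: lc_dm)

lemma lc_dm_mid: "lc x (\<lambda>i. lc (dm H (dm H (bv i) w) u) F) = lc (dm H (dm H x w) u) F"
  by (simp add: lc_dm)

text \<open>Linear independence expressed by dual functionals on matrices: in this form it passes to
  tensor products by multiplying the functionals.\<close>

definition dual_family :: "('x \<Rightarrow> ('i::finite, 'k::field) mat) \<Rightarrow> bool" where
  "dual_family F \<longleftrightarrow> (\<exists>l. \<forall>s s'. (\<Sum>f\<in>UNIV. \<Sum>g\<in>UNIV. l s f g * ent (F s') f g) = kd s s')"

lemma dual_familyI:
  "(\<And>s s'. (\<Sum>f\<in>UNIV. \<Sum>g\<in>UNIV. l s f g * ent (F s') f g) = kd s s') \<Longrightarrow> dual_family F"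
  unfolding dual_family_def by blast

text \<open>The products of the dual functionals over the tensor factors are dual to the family of
  tensor products. The map \<open>enc\<close> distributes the components of an index over the
  factors, so that one lemma serves all test families.\<close>

lemma tp_faithful:
  fixes N :: "'e::finite \<Rightarrow> 'x \<Rightarrow> ('i::finite, 'k::field) mat" and enc :: "'y::finite \<Rightarrow> 'e \<Rightarrow> 'x"
  assumes dual: "\<And>e. dual_family (N e)" and inj: "inj enc"
    and eq: "lc u (\<lambda>y. tp (\<lambda>e. N e (enc y e))) = lc v (\<lambda>y. tp (\<lambda>e. N e (enc y e)))"
  shows "u = v"
proof -
  obtain l where l: "\<And>e s s'. (\<Sum>f\<in>UNIV. \<Sum>g\<in>UNIV. l e s f g * ent (N e s') f g) = kd s s'"
    using dual unfolding dual_family_def by metis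
  have "(\<Sum>f\<in>UNIV. \<Sum>g\<in>UNIV. (\<Prod>e\<in>UNIV. l e (enc x e) (f e) (g e)) * ent (lc w (\<lambda>y. tp (\<lambda>e. N e (enc y e)))) f g) = w x"
    (is "?S = _") for w x
  proof -
    have "?S = (\<Sum>f\<in>UNIV. \<Sum>g\<in>UNIV. \<Sum>y\<in>UNIV. w y * (\<Prod>e\<in>UNIV. l e (enc x e) (f e) (g e) * ent (N e (enc y e)) (f e) (g e)))"
      by (simp add: ent_lc tp_def sum_distrib_left prod.distrib ac_simps)
    also have "\<dots> = (\<Sum>y\<in>UNIV. \<Sum>f\<in>UNIV. \<Sum>g\<in>UNIV. w y * (\<Prod>e\<in>UNIV. l e (enc x e) (f e) (g e) * ent (N e (enc y e)) (f e) (g e)))"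
      unfolding sum.cartesian_product
      by (rule sum.reindex_bij_witness[of _ "\<lambda>(y,f,g). (f,g,y)" "\<lambda>(f,g,y). (y,f,g)"]) auto
    also have "\<dots> = (\<Sum>y\<in>UNIV. w y * (\<Prod>e\<in>UNIV. \<Sum>f\<in>UNIV. \<Sum>g\<in>UNIV. l e (enc x e) f g * ent (N e (enc y e)) f g))"
      by (simp add: prod_sum_UNIV sum_distrib_left)
    also have "\<dots> = (\<Sum>y\<in>UNIV. w y * kd x y)"
      using inj by (intro sum.cong refl arg_cong2[of _ _ _ _ "(*)"]) (auto simp: l kd_def inj_def fun_eq_iff)
    finally show ?thesis by simp
  qed
  from this[of _ u] this[of _ v] eq show ?thesis by (metis ext)
qed

context hopf_coords
begin

lemma lc_eps_del: "lc (hceps H) (\<lambda>b. lc (\<lambda>q. hdel H q b d) F) = F d"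
  "lc (hceps H) (\<lambda>b. lc (\<lambda>q. hdel H q d b) F) = F d"
proof -
  have "lc (hceps H) (\<lambda>b. lc (\<lambda>q. hdel H q b d) F) = lc (\<lambda>q. \<Sum>b\<in>UNIV. hdel H q b d * hceps H b) F"
    by (simp add: mult.commute[of _ "hceps H _"] lc_sum_vec lc_smult) (simp add: lc_def)
  then show "lc (hceps H) (\<lambda>b. lc (\<lambda>q. hdel H q b d) F) = F d"
    by (simp add: del_ceps_left) (simp add: lc_def)
  have "lc (hceps H) (\<lambda>b. lc (\<lambda>q. hdel H q d b) F) = lc (\<lambda>q. \<Sum>b\<in>UNIV. hdel H q d b * hceps H b) F"
    by (simp add: mult.commute[of _ "hceps H _"] lc_sum_vec lc_smult) (simp add: lc_def)
  then show "lc (hceps H) (\<lambda>b. lc (\<lambda>q. hdel H q d b) F) = F d"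
    by (simp add: del_ceps_right) (simp add: lc_def)
qed

lemma dm_eps: "dm H (hceps H) x = x" "dm H x (hceps H) = x"
  by (rule vec_eqI_lc, simp add: lc_dm lc_eps_del lc_swap[of "hceps H" x])+

lemma lc_dmul: "lc (dmul H u v) F = lc u (\<lambda>s. lc v (\<lambda>t. lc (hm H (bv (fst t)) (bv (fst s)))
     (\<lambda>x. lc (dm H (bv (snd s)) (bv (snd t))) (\<lambda>y. F (x, y)))))"
  by (simp add: dmul_def lc_lin lc_tens split_def)

lemma lc_unitD: "lc (unitD H) F = lc (heta H) (\<lambda>a. lc (hceps H) (\<lambda>b. F (a, b)))"
  by (simp add: unitD_def lc_tens)

lemma dmul_unit: "dmul H (unitD H) v = v" "dmul H v (unitD H) = v"
proof -
  show "dmul H (unitD H) v = v"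
  proof (rule vec_eqI_lc)
    fix F :: "'i \<times> 'i \<Rightarrow> (unit, 'k) mat"
    have "lc (dmul H (unitD H) v) F = lc v (\<lambda>t. lc (heta H) (\<lambda>a. lc (hm H (bv (fst t)) (bv a))
        (\<lambda>x. lc (hceps H) (\<lambda>b. lc (dm H (bv b) (bv (snd t))) (\<lambda>y. F (x, y))))))"
      by (simp add: lc_dmul lc_unitD lc_swap[of _ v] lc_swap[of "hceps H" "hm H _ _"])
    also have "\<dots> = lc v F"
      by (simp add: lc_dm lc_eps_del lc_hm lc_eta_mu)
    finally show "lc (dmul H (unitD H) v) F = lc v F" .
  qed
  show "dmul H v (unitD H) = v"
  proof (rule vec_eqI_lc)
    fix F :: "'i \<times> 'i \<Rightarrow> (unit, 'k) mat"
    have "lc (dmul H v (unitD H)) F = lc v (\<lambda>t. lc (heta H) (\<lambda>a. lc (hm H (bv a) (bv (fst t)))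
        (\<lambda>x. lc (hceps H) (\<lambda>b. lc (dm H (bv (snd t)) (bv b)) (\<lambda>y. F (x, y))))))"
      by (simp add: lc_dmul lc_unitD lc_swap[of "hceps H" "hm H _ _"])
    also have "\<dots> = lc v F"
      by (simp add: lc_dm lc_eps_del lc_hm lc_eta_mu)
    finally show "lc (dmul H v (unitD H)) F = lc v F" .
  qed
qed

section \<open>The action of the tensor power of the Heisenberg double\<close>

lemma lc_unitD_hr: "lc (unitD H) hr = 1"
proof -
  have "lc (unitD H) hr = lc (heta H) Lm * lc (hceps H) Tm"
    by (simp add: lc_unitD hr_def lc_mult)
  then show ?thesis
    using dhom_Tm by (simp add: hom_eta hom_Lm dhom_def)
qed

definition rhoE :: "(('e::finite \<Rightarrow> 'i \<times> 'i) \<Rightarrow> 'k) \<Rightarrow> ('e \<Rightarrow> 'i, 'k) mat" where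
  "rhoE X = lc X (\<lambda>h. tp (\<lambda>e. hr (h e)))"

lemma rhoE_pt: "rhoE (pt u) = tp (\<lambda>e. lc (u e) hr)"
  by (simp add: rhoE_def tp_lc) (simp add: pt_def)

lemma rhoE_tone: "rhoE (tone H) = 1"
  by (simp add: tone_pt rhoE_pt lc_unitD_hr tp_one)

lemma rhoE_heis: "rhoE (tmul (heis H) X Y) = rhoE X * rhoE Y"
proof -
  have "rhoE (tmul (heis H) X Y) = lc X (\<lambda>f. lc Y (\<lambda>g. rhoE (pt (\<lambda>e. heis H (bv (f e)) (bv (g e))))))"
    by (simp add: rhoE_def lc_tmul)
  also have "\<dots> = rhoE X * rhoE Y"
    by (simp add: rhoE_pt lc_heis) (simp add: lc_mult tp_mult rhoE_def)
  finally show ?thesis .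
qed

text \<open>The functionals: for \<open>Lm\<close> and \<open>Rm\<close>, apply the operator to the
  unit and read off a coordinate; for \<open>Tm\<close>, apply it to a basis element and then take
  the counit, which gives the evaluation pairing.\<close>

lemma dual_Lm: "dual_family Lm" and dual_Rm: "dual_family Rm" and dual_Tm: "dual_family Tm"
proof -
  have "(\<Sum>f\<in>UNIV. \<Sum>g\<in>UNIV. kd a f * heta H g * ent (Lm b) f g) = kd a b" for a b
  proof -
    have "(\<Sum>f\<in>UNIV. \<Sum>g\<in>UNIV. kd a f * heta H g * ent (Lm b) f g) = (\<Sum>f\<in>UNIV. kd a f * (\<Sum>g\<in>UNIV. heta H g * hmu H b g f))"
      by (simp add: Lm_def sum_distrib_left mult.assoc)
    then show ?thesis by (simp add: mu_eta_right)
  qed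
  then show "dual_family Lm" by (rule dual_familyI)
  have "(\<Sum>f\<in>UNIV. \<Sum>g\<in>UNIV. kd a f * heta H g * ent (Rm b) f g) = kd a b" for a b
  proof -
    have "(\<Sum>f\<in>UNIV. \<Sum>g\<in>UNIV. kd a f * heta H g * ent (Rm b) f g) = (\<Sum>f\<in>UNIV. kd a f * (\<Sum>g\<in>UNIV. heta H g * hmu H g b f))"
      by (simp add: Rm_def sum_distrib_left mult.assoc)
    then show ?thesis by (simp add: mu_eta_left)
  qed
  then show "dual_family Rm" by (rule dual_familyI)
  have "(\<Sum>f\<in>UNIV. \<Sum>g\<in>UNIV. hceps H f * kd g a * ent (Tm b) f g) = kd a b" for a b
  proof -
    have "(\<Sum>f\<in>UNIV. \<Sum>g\<in>UNIV. hceps H f * kd g a * ent (Tm b) f g) = (\<Sum>g\<in>UNIV. kd g a * (\<Sum>f\<in>UNIV. hdel H g f b * hceps H f))"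
      by (subst sum.swap) (simp add: Tm_def sum_distrib_left ac_simps)
    then show ?thesis by (simp add: del_ceps_left) (simp add: kd_def)
  qed
  then show "dual_family Tm" by (rule dual_familyI)
qed

text \<open>An operator \<open>M\<close> determines the map sending \<open>k\<close> to
  \<open>M(k_(2)) S(k_(1))\<close>. For the action of \<open>h (x) \<alpha>\<close> this is the
  multiple of \<open>h\<close> by the value of \<open>\<alpha>\<close> at \<open>k\<close>, because
  \<open>k_(2) S(k_(1))\<close> is the counit. So the action of the Heisenberg double can be
  inverted explicitly.\<close>

lemma dual_hr: "dual_family hr"
proof -
  define N where "N M k = DD k (\<lambda>k1 k2. \<Sum>f\<in>UNIV. ent M f k2 \<bullet> (Lm f * ap Lm k1))" for M :: "('i, 'k) mat" and k
  have N: "N (hr (a, b)) k = kd k b \<bullet> Lm a" for a b k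
  proof -
    have 1: "(\<Sum>f\<in>UNIV. ent (Lm a * Tm b) f k2 \<bullet> Lm f) = (\<Sum>p\<in>UNIV. hdel H k2 p b \<bullet> (Lm a * Lm p))" for k2
    proof -
      have "(\<Sum>f\<in>UNIV. ent (Lm a * Tm b) f k2 \<bullet> Lm f) = (\<Sum>f\<in>UNIV. \<Sum>p\<in>UNIV. (hmu H a p f * hdel H k2 p b) \<bullet> Lm f)"
        by (simp add: ent_times Lm_def[of a] Tm_def sum_scl)
      also have "\<dots> = (\<Sum>p\<in>UNIV. hdel H k2 p b \<bullet> lc (hmu H a p) Lm)"
        by (subst sum.swap) (simp add: lc_def scl_sum mult.commute)
      finally show ?thesis by (simp add: hom_mult hom_Lm)
    qed
    have 2: "(\<Sum>p\<in>UNIV. hdel H k2 p b \<bullet> (Lm a * Lm p * ap Lm k1)) =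
        DD k2 (\<lambda>p c. kd c b \<bullet> (Lm a * (Lm p * ap Lm k1)))" for k1 k2
      unfolding DD_def by (simp only: scl_simps(4) mult.commute[of _ "kd _ _"]) (simp only: scl_simps(4)[symmetric] sum_kd_scl mult.assoc)
    have "N (hr (a, b)) k = DD k (\<lambda>k1 k2. (\<Sum>f\<in>UNIV. ent (Lm a * Tm b) f k2 \<bullet> Lm f) * ap Lm k1)"
      by (simp add: N_def hr_def sum_distrib_right)
    also have "\<dots> = DD k (\<lambda>k1 k2. DD k2 (\<lambda>p c. kd c b \<bullet> (Lm a * (Lm p * ap Lm k1))))"
      by (simp only: 1 sum_distrib_right scl_simps 2)
    also have "\<dots> = DD k (\<lambda>d c. kd c b \<bullet> (Lm a * DD d (\<lambda>k1 p. Lm p * ap Lm k1)))"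
      by (simp only: DD_coassoc[symmetric] DD_scl DD_mult_right)
    also have "\<dots> = DD k (\<lambda>d c. hceps H d \<bullet> kd c b \<bullet> Lm a)"
      by (simp add: hom_flip hom_Lm mult.commute)
    also have "\<dots> = kd k b \<bullet> Lm a"
      by (rule DD_counit_left)
    finally show ?thesis .
  qed
  \<comment> \<open>The coordinate \<open>fst s\<close> of the element by which
    \<open>N M (snd s)\<close> multiplies, obtained by applying that operator to the unit.\<close>
  define l where "l s f g = (\<Sum>k1\<in>UNIV. \<Sum>x\<in>UNIV. hdel H (snd s) k1 g * (ent (Lm f * ap Lm k1) (fst s) x * heta H x))" for s f g
  have l: "(\<Sum>f\<in>UNIV. \<Sum>g\<in>UNIV. l s f g * ent M f g) = (\<Sum>x\<in>UNIV. ent (N M (snd s)) (fst s) x * heta H x)" for s M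
  proof -
    have "(\<Sum>f\<in>UNIV. \<Sum>g\<in>UNIV. l s f g * ent M f g) = (\<Sum>f\<in>UNIV. \<Sum>g\<in>UNIV. \<Sum>k1\<in>UNIV. \<Sum>x\<in>UNIV.
       hdel H (snd s) k1 g * (ent M f g * (ent (Lm f * ap Lm k1) (fst s) x * heta H x)))"
      by (simp add: l_def sum_distrib_right sum_distrib_left ac_simps)
    also have "\<dots> = (\<Sum>x\<in>UNIV. \<Sum>k1\<in>UNIV. \<Sum>g\<in>UNIV. \<Sum>f\<in>UNIV.
       hdel H (snd s) k1 g * (ent M f g * (ent (Lm f * ap Lm k1) (fst s) x * heta H x)))"
      unfolding sum.cartesian_product
      by (rule sum.reindex_bij_witness[of _ "\<lambda>(x,k1,g,f). (f,g,k1,x)" "\<lambda>(f,g,k1,x). (x,k1,g,f)"]) auto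
    also have "\<dots> = (\<Sum>x\<in>UNIV. ent (N M (snd s)) (fst s) x * heta H x)"
      by (simp add: N_def DD_def sum_distrib_right sum_distrib_left mult.assoc)
    finally show ?thesis .
  qed
  have "(\<Sum>f\<in>UNIV. \<Sum>g\<in>UNIV. l s f g * ent (hr s') f g) = kd s s'" for s s'
  proof -
    obtain a b a' b' where s: "s = (a, b)" "s' = (a', b')" by fastforce
    have "(\<Sum>f\<in>UNIV. \<Sum>g\<in>UNIV. l s f g * ent (hr s') f g) = kd b b' * (\<Sum>x\<in>UNIV. heta H x * hmu H a' x a)"
      unfolding l by (simp add: s N Lm_def sum_distrib_left ac_simps)
    then show ?thesis by (simp add: mu_eta_right s kd_def)
  qed
  then show ?thesis by (rule dual_familyI)
qed

text \<open>Makes every identity in the target algebra provable as an identity of matrices.\<close>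

lemma rhoE_inj: "rhoE X = rhoE Y \<Longrightarrow> X = Y"
  unfolding rhoE_def by (rule tp_faithful[of "\<lambda>_. hr" "\<lambda>h. h"]) (simp_all add: dual_hr inj_def)

subsection \<open>Elements that are trivial on one tensor factor\<close>

text \<open>The span of the pure tensors with unit in the factor \<open>e\<close>. As an inductive
  set it reduces statements that are linear in the element to pure tensors.\<close>

inductive_set off :: "'e::finite \<Rightarrow> (('e \<Rightarrow> 'i \<times> 'i) \<Rightarrow> 'k) set" for e where
  off_pt: "u e = unitD H \<Longrightarrow> pt u \<in> off e"
| off_zero: "(\<lambda>h. 0) \<in> off e"
| off_add: "X \<in> off e \<Longrightarrow> Y \<in> off e \<Longrightarrow> (\<lambda>h. X h + Y h) \<in> off e"
| off_scale: "X \<in> off e \<Longrightarrow> (\<lambda>h. c * X h) \<in> off e"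

lemma off_tone: "tone H \<in> off e"
  by (simp add: tone_pt off_pt)

lemma off_sum: "(\<And>s. s \<in> A \<Longrightarrow> X s \<in> off e) \<Longrightarrow> (\<lambda>h. \<Sum>s\<in>A. c s * X s h) \<in> off e"
proof (induction A rule: infinite_finite_induct)
  case (insert x F)
  have "(\<lambda>h. c x * X x h + (\<Sum>s\<in>F. c s * X s h)) \<in> off e"
    using insert by (intro off_add off_scale) auto
  then show ?case using insert by simp
qed (auto intro: off_zero)

lemma off_tmul: "X \<in> off e \<Longrightarrow> e' \<noteq> e \<Longrightarrow> tmul (dmul H) (pure H e' u) X \<in> off e"
proof (induction rule: off.induct)
  case (off_pt v)
  then show ?case by (auto simp: pure_pt tmul_pt bil_dmul dmul_unit intro!: off.off_pt)
qed (auto simp: tmul_add_right tmul_scale_right tmul_zero_right intro: off_zero off_add off_scale)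

lemma rhoE_add: "rhoE (\<lambda>h. X h + Y h) = rhoE X + rhoE Y"
  by (simp add: rhoE_def lc_add)

lemma rhoE_scale: "rhoE (\<lambda>h. c * X h) = c \<bullet> rhoE X"
  by (simp add: rhoE_def lc_smult)

lemma rhoE_zero: "rhoE (\<lambda>h. 0) = 0"
  by (simp add: rhoE_def lc_def)

lemma rhoE_sum: "rhoE (\<lambda>h. \<Sum>s\<in>A. X s h) = (\<Sum>s\<in>A. rhoE (X s))"
  by (simp add: rhoE_def lc_sum_vec)

text \<open>The bridge between the two multiplications: in the factor \<open>e\<close> the right
  argument is the unit, in every other factor the left one is, and products with the shared unit are
  the same in \<open>D(H)^*\<close> and in the Heisenberg double.\<close>

lemma rhoE_dmul_off: "X \<in> off e \<Longrightarrow> rhoE (tmul (dmul H) (pure H e u) X) = emb e (lc u hr) * rhoE X"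
proof (induction rule: off.induct)
  case (off_pt v)
  have "rhoE (tmul (dmul H) (pure H e u) (pt v)) = tp (\<lambda>e'. lc (dmul H (((\<lambda>_. unitD H)(e := u)) e') (v e')) hr)"
    by (simp add: pure_pt tmul_pt bil_dmul rhoE_pt)
  also have "\<dots> = emb e (lc u hr) * rhoE (pt v)"
    unfolding emb_def rhoE_pt tp_mult
    by (intro arg_cong[of _ _ tp] ext) (auto simp: off_pt dmul_unit lc_unitD_hr)
  finally show ?case .
qed (auto simp: tmul_add_right tmul_scale_right tmul_zero_right rhoE_add rhoE_scale rhoE_zero distrib_left)

lemma dmul_off_assoc: "X \<in> off e \<Longrightarrow>
   tmul (dmul H) (pure H e u) (tmul (dmul H) (pure H e v) X) = tmul (dmul H) (pure H e (dmul H u v)) X"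
proof (induction rule: off.induct)
  case (off_pt w)
  then show ?case
    by (simp add: pure_pt tmul_pt bil_dmul) (intro arg_cong[of _ _ pt] ext, auto simp: dmul_unit)
qed (auto simp: tmul_add_right tmul_scale_right tmul_zero_right)

section \<open>Contractions of the comultiplication of the dual of the double\<close>

lemma Dmu_counit_left: "Dmu g (\<lambda>b c. heta H b \<bullet> F c) = F g"
proof -
  have "Dmu g (\<lambda>b c. heta H b \<bullet> F c) = (\<Sum>c\<in>UNIV. (\<Sum>b\<in>UNIV. heta H b * hmu H b c g) \<bullet> F c)"
    unfolding Dmu_def by (subst sum.swap) (simp add: sum_scl mult.commute)
  then show ?thesis by (simp add: mu_eta_left)
qed

lemma Dmu_counit_right: "Dmu g (\<lambda>b c. heta H c \<bullet> F b) = F g"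
proof -
  have "Dmu g (\<lambda>b c. heta H c \<bullet> F b) = (\<Sum>b\<in>UNIV. (\<Sum>c\<in>UNIV. heta H c * hmu H b c g) \<bullet> F b)"
    unfolding Dmu_def by (simp add: sum_scl mult.commute)
  then show ?thesis by (simp add: mu_eta_right)
qed

lemma lc_dm_eta: "lc (dm H x y) (\<lambda>q. heta H q \<bullet> X) = lc x (\<lambda>b. lc y (\<lambda>c. heta H b \<bullet> heta H c \<bullet> X))"
proof -
  have "lc (\<lambda>q. hdel H q b c) (\<lambda>q. heta H q \<bullet> X) = (\<Sum>q\<in>UNIV. heta H q * hdel H q b c) \<bullet> X" for b c
    by (simp add: lc_def sum_scl mult.commute)
  then show ?thesis by (simp add: lc_dm eta_del)
qed

lemma lc_dm3_eta: "lc (dm3 i b j) (\<lambda>q. heta H q \<bullet> X) = (heta H b * (heta H i * heta H j)) \<bullet> X"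
  by (simp only: lc_dm_eta lc_bv) (simp add: ac_simps)

lemma lc_DeltaD:
  "lc (DeltaD H u) F = lc u (\<lambda>s. \<Sum>i\<in>UNIV. \<Sum>j\<in>UNIV. DD (fst s) (\<lambda>a1 a2. Dmu (snd s) (\<lambda>b1 b2.
     lc (dm3 i b1 j) (\<lambda>q.
     lc (conj_vec j a2 i) (\<lambda>r. F ((a1, q), (r, b2)))))))"
  by (simp add: DeltaD_def lc_lin lc_vsum lc_sc lc_ttens lc_tens split_def sum_UNIV_pair DD_def Dmu_def scl_sum)

lemma lc_DeltaD_bv: "lc (DeltaD H u) F = lc u (\<lambda>s. lc (DeltaD H (bv s)) F)"
  by (simp add: lc_DeltaD)

text \<open>Pairing the dual part of the first tensor factor with the unit removes both basis sums
  of \<open>Delta_D\<close> and leaves the comultiplication of \<open>H\<close>. Letters crossing an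
  edge therefore split off a convolution factor over \<open>H\<close> from the path.\<close>

lemma DeltaD_eta_left:
  "lc (DeltaD H (bv (a, b))) (\<lambda>x. heta H (snd (fst x)) \<bullet> G (fst (fst x)) (snd x)) = DD a (\<lambda>a1 a2. G a1 (a2, b))"
proof -
  have 1: "(\<Sum>i\<in>UNIV. \<Sum>j\<in>UNIV. (heta H i * heta H j) \<bullet> lc (conj_vec j c i) F) = F c"
    for F :: "'i \<Rightarrow> ('t::finite, 'k) mat" and c
  proof -
    have "(\<Sum>i\<in>UNIV. \<Sum>j\<in>UNIV. (heta H i * heta H j) \<bullet> lc (conj_vec j c i) F)
       = lc (heta H) (\<lambda>i. lc (heta H) (\<lambda>j. lc (conj_vec j c i) F))"
      by (simp add: lc_def[of "heta H"] scl_sum)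
    also have "\<dots> = F c"
      by (simp add: lc_hm_right lc_hm_mid_hS hS_eta lc_eta_hm)
    finally show ?thesis .
  qed
  have "lc (DeltaD H (bv (a, b))) (\<lambda>x. heta H (snd (fst x)) \<bullet> G (fst (fst x)) (snd x))
    = (\<Sum>i\<in>UNIV. \<Sum>j\<in>UNIV. DD a (\<lambda>a1 a2. Dmu b (\<lambda>b1 b2. heta H b1 \<bullet> (heta H i * heta H j) \<bullet>
        lc (conj_vec j a2 i) (\<lambda>r. G a1 (r, b2)))))"
    by (simp add: lc_DeltaD lc_scl lc_dm3_eta)
  also have "\<dots> = DD a (\<lambda>a1 a2. G a1 (a2, b))"
    by (simp only: Dmu_counit_left flip: DD_sum) (simp add: 1)
  finally show ?thesis .
qed

lemma DeltaD_eps_left: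
  "lc (DeltaD H (bv (a, b))) (\<lambda>x. hceps H (fst (fst x)) \<bullet> G (snd (fst x)) (snd x)) =
   (\<Sum>i\<in>UNIV. \<Sum>j\<in>UNIV. Dmu b (\<lambda>b1 b2. lc (dm3 i b1 j) (\<lambda>q.
     lc (conj_vec j a i) (\<lambda>r. G q (r, b2)))))"
  by (simp add: lc_DeltaD lc_scl Dmu_scl DD_counit_left)

lemma DeltaD_eta_right:
  "lc (DeltaD H (bv (a, b))) (\<lambda>x. heta H (snd (snd x)) \<bullet> G (fst x) (fst (snd x))) =
   (\<Sum>i\<in>UNIV. \<Sum>j\<in>UNIV. DD a (\<lambda>a1 a2. lc (dm3 i b j) (\<lambda>q.
     lc (conj_vec j a2 i) (\<lambda>r. G (a1, q) r))))"
  by (simp add: lc_DeltaD lc_scl Dmu_counit_right)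

lemma DeltaD_eps_right:
  "lc (DeltaD H (bv (a, b))) (\<lambda>x. hceps H (fst (snd x)) \<bullet> G (fst x) (snd (snd x))) = Dmu b (\<lambda>b1 b2. G (a, b1) b2)"
proof -
  have 0: "lc (hant H j) (\<lambda>c. hceps H c \<bullet> X) = hceps H j \<bullet> X" for j and X :: "('t::finite, 'k) mat"
    using ceps_ap[of X j] by (simp add: ap_def)
  have 1: "(\<Sum>i\<in>UNIV. \<Sum>j\<in>UNIV. (hceps H i * hceps H j) \<bullet> lc (dm3 i c j) F) = F c"
    for F :: "'i \<Rightarrow> ('t::finite, 'k) mat" and c
  proof -
    have "(\<Sum>i\<in>UNIV. \<Sum>j\<in>UNIV. (hceps H i * hceps H j) \<bullet> lc (dm3 i c j) F)
       = lc (hceps H) (\<lambda>i. lc (hceps H) (\<lambda>j. lc (dm3 i c j) F))"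
      by (simp add: lc_def[of "hceps H"] scl_sum)
    also have "\<dots> = F c"
      by (simp add: lc_dm_right lc_dm_mid lc_dm_left dm_eps)
    finally show ?thesis .
  qed
  have 2: "lc (conj_vec j c i) (\<lambda>r. hceps H r \<bullet> X) = (hceps H i * hceps H j) \<bullet> hceps H c \<bullet> X"
    for i j c and X :: "('t::finite, 'k) mat"
  proof -
    have "lc (conj_vec j c i) (\<lambda>r. hceps H r \<bullet> X)
      = lc (hant H j) (\<lambda>x. hceps H x \<bullet> (hceps H c * hceps H i) \<bullet> X)"
      by (simp only: lc_hm lc_bv lc_mu_ceps lc_hS) (simp only: lc_mu_ceps scl_simps(4)[symmetric] mult.assoc)
    then show ?thesis by (simp only: 0) (simp add: ac_simps)
  qed
  have "lc (DeltaD H (bv (a, b))) (\<lambda>x. hceps H (fst (snd x)) \<bullet> G (fst x) (snd (snd x)))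
    = (\<Sum>i\<in>UNIV. \<Sum>j\<in>UNIV. DD a (\<lambda>a1 a2. hceps H a2 \<bullet> Dmu b (\<lambda>b1 b2. (hceps H i * hceps H j) \<bullet>
        lc (dm3 i b1 j) (\<lambda>q. G (a1, q) b2))))"
    by (simp only: lc_DeltaD lc_bv fst_conv snd_conv 2 lc_scl Dmu_scl) (simp add: mult.commute)
  also have "\<dots> = (\<Sum>i\<in>UNIV. \<Sum>j\<in>UNIV. Dmu b (\<lambda>b1 b2. (hceps H i * hceps H j) \<bullet>
        lc (dm3 i b1 j) (\<lambda>q. G (a, q) b2)))"
    by (simp only: DD_counit_right)
  also have "\<dots> = Dmu b (\<lambda>b1 b2. G (a, b1) b2)"
    by (simp only: flip: Dmu_sum) (simp only: 1)
  finally show ?thesis .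
qed

end

fun tedge_of :: "'e tedge \<Rightarrow> 'e" where
  "tedge_of (TR e) = e" | "tedge_of (TL e) = e" | "tedge_of (TRB e) = e" | "tedge_of (TLB e) = e"

section \<open>Commuting matrices\<close>

definition cm :: "('s::finite, 'k::field) mat \<Rightarrow> ('s, 'k) mat \<Rightarrow> bool" where
  "cm X Y \<longleftrightarrow> X * Y = Y * X"

lemma cm_sym: "cm X Y \<Longrightarrow> cm Y X"
  by (simp add: cm_def)

lemma cm_mult: "cm X Z \<Longrightarrow> cm Y Z \<Longrightarrow> cm (X * Y) Z"
  unfolding cm_def by (metis mult.assoc)

lemma cm_scl: "cm X Z \<Longrightarrow> cm (c \<bullet> X) Z"
  by (simp add: cm_def)

lemma cm_one: "cm 1 Z"
  by (simp add: cm_def)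

lemma cm_sum: "(\<And>s. s \<in> A \<Longrightarrow> cm (F s) Z) \<Longrightarrow> cm (sum F A) Z"
  by (simp add: cm_def sum_distrib_left sum_distrib_right)

lemma cm_lc: "(\<And>s. cm (F s) Z) \<Longrightarrow> cm (lc u F) Z"
  unfolding lc_def by (intro cm_sum cm_scl)

lemma cm_emb: "e \<noteq> f \<Longrightarrow> cm (emb e A) (emb f B)"
  by (simp add: cm_def emb_comm)

context hopf_coords
begin

lemma cm_DD: "(\<And>b c. cm (F b c) Z) \<Longrightarrow> cm (DD a F) Z"
  unfolding DD_def by (intro cm_sum cm_scl)

lemma cm_ap: "(\<And>b. cm (F b) Z) \<Longrightarrow> cm (ap F a) Z"
  unfolding ap_def by (rule cm_lc)

lemma cm_convm: "(\<And>b. cm (F b) Z) \<Longrightarrow> (\<And>b. cm (G b) Z) \<Longrightarrow> cm ((F \<star> G) a) Z"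
  unfolding convm_def by (intro cm_DD cm_mult)

lemma cm_can: "(\<And>b. cm (t b) Z) \<Longrightarrow> (\<And>b. cm (F b) Z) \<Longrightarrow> cm (can t F) Z"
  unfolding can_def by (intro cm_sum cm_mult)

section \<open>Conjugation by canonical elements\<close>

lemma can_inverse:
  assumes "dhom t" "\<And>a b. cm (F a) (t b)" "F \<star> G = cone"
  shows "can t F * can t G = 1"
  using can_convm[of t F G] can_cone[of t] assms by (simp add: cm_def)

text \<open>The basis sums of \<open>Delta_D\<close>: an anti-multiplicative \<open>F\<close> turns
  \<open>S(x_j) a x_i\<close> into \<open>F(x_i) F(a) F(S(x_j))\<close>, the order in which the
  factors of \<open>T\<close> occur, so the double sum factors into a conjugation.\<close>

lemma sum_can_conj:
  assumes T: "dhom T" and F: "antihom F" and c: "\<And>a b. cm (F a) (T b)"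
  shows "(\<Sum>i\<in>UNIV. \<Sum>j\<in>UNIV. lc (dm3 i b j) T * lc (conj_vec j a i) F)
    = can T F * (T b * F a) * can T (ap F)"
proof -
  have c': "F x * T y = T y * F x" for x y
    using c by (simp add: cm_def)
  then have c'': "F x * (T y * Z) = T y * (F x * Z)" for x y Z
    by (metis mult.assoc)
  have "T i * T b * T j * (F i * (F a * ap F j)) = T i * F i * (T b * F a) * (T j * ap F j)" for i j
    by (simp add: mult.assoc c' c'')
  then have "(\<Sum>i\<in>UNIV. \<Sum>j\<in>UNIV. lc (dm3 i b j) T * lc (conj_vec j a i) F)
    = (\<Sum>i\<in>UNIV. \<Sum>j\<in>UNIV. T i * F i * (T b * F a) * (T j * ap F j))"
    by (simp add: dhom_dm T antihom_hm F lc_hS_ap)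
  also have "\<dots> = can T F * (T b * F a) * can T (ap F)"
    unfolding can_def sum_distrib_right by (simp only: sum_distrib_left)
  finally show ?thesis .
qed

text \<open>Moving \<open>T g\<close> past \<open>L a\<close> multiplies the index of the canonical
  sum by \<open>a_(2)\<close> from the left; multiplicativity of \<open>F\<close> pulls this out as
  a factor \<open>F\<close> to the left of the canonical element.\<close>

lemma can_L:
  assumes F: "hom F" and c: "\<And>a b. cm (F a) (L b)"
    and TL: "\<And>g a. T g * L a = DD a (\<lambda>a1 a2. \<Sum>g2\<in>UNIV. hmu H a2 g2 g \<bullet> (L a1 * T g2))"
    and cT: "\<And>a b. cm (F a) (T b)"
  shows "can T F * L a = (L \<star> F) a * can T F"
proof -
  have "can T F * L a = (\<Sum>g\<in>UNIV. T g * L a * F g)"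
    using c by (simp add: can_def sum_distrib_right mult.assoc cm_def)
  also have "\<dots> = DD a (\<lambda>a1 a2. \<Sum>g\<in>UNIV. \<Sum>g2\<in>UNIV. hmu H a2 g2 g \<bullet> (L a1 * T g2 * F g))"
    by (simp add: TL DD_mult_left sum_distrib_right flip: DD_sum)
  also have "\<dots> = DD a (\<lambda>a1 a2. \<Sum>g2\<in>UNIV. L a1 * T g2 * lc (hmu H a2 g2) F)"
    by (subst sum.swap) (simp add: lc_def sum_distrib_left)
  also have "\<dots> = DD a (\<lambda>a1 a2. \<Sum>g2\<in>UNIV. L a1 * (F a2 * (T g2 * F g2)))"
    using cT by (simp add: hom_mult[OF F, symmetric] mult.assoc cm_def) (simp add: mult.assoc[symmetric] cm_def)
  also have "\<dots> = (L \<star> F) a * can T F"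
    by (simp add: convm_def DD_mult_left) (simp add: can_def sum_distrib_left mult.assoc)
  finally show ?thesis .
qed

text \<open>In contrast to \<open>can_L\<close>, the index is multiplied by \<open>a_(2)\<close>
  from the right, so the extra factor stays to the right of the canonical element.\<close>

lemma can_R:
  assumes F: "hom F" and c: "\<And>a b. cm (F a) (R b)"
    and TR: "\<And>g a. T g * R a = DD a (\<lambda>a1 a2. \<Sum>g1\<in>UNIV. hmu H g1 a2 g \<bullet> (R a1 * T g1))"
  shows "can T F * R a = DD a (\<lambda>a1 a2. R a1 * can T F * F a2)"
proof -
  have "can T F * R a = (\<Sum>g\<in>UNIV. T g * R a * F g)"
    using c by (simp add: can_def sum_distrib_right mult.assoc cm_def)
  also have "\<dots> = DD a (\<lambda>a1 a2. \<Sum>g\<in>UNIV. \<Sum>g1\<in>UNIV. hmu H g1 a2 g \<bullet> (R a1 * T g1 * F g))"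
    by (simp add: TR DD_mult_left sum_distrib_right flip: DD_sum)
  also have "\<dots> = DD a (\<lambda>a1 a2. \<Sum>g1\<in>UNIV. R a1 * T g1 * lc (hmu H g1 a2) F)"
    by (subst sum.swap) (simp add: lc_def sum_distrib_left)
  also have "\<dots> = DD a (\<lambda>a1 a2. R a1 * can T F * F a2)"
    by (simp add: hom_mult[OF F, symmetric] can_def sum_distrib_left sum_distrib_right mult.assoc)
  finally show ?thesis .
qed

section \<open>Holonomies of edges of the thickening\<close>

lemma DeltaD_eps_eta:
  "lc (DeltaD H (bv (a, b))) (\<lambda>x. hceps H (fst (fst x)) \<bullet> heta H (snd (snd x)) \<bullet> G (snd (fst x)) (fst (snd x))) =
   (\<Sum>i\<in>UNIV. \<Sum>j\<in>UNIV. lc (dm3 i b j) (\<lambda>q.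
     lc (conj_vec j a i) (\<lambda>r. G q r)))"
  unfolding DeltaD_eps_left[where G = "\<lambda>q t. heta H (snd t) \<bullet> G q (fst t)"]
  by (simp add: lc_scl Dmu_counit_right)

lemma lc_eta_dS: "lc (dS H x) (\<lambda>q. heta H q \<bullet> X) = lc x (\<lambda>q. heta H q \<bullet> X)"
proof -
  have "(\<Sum>b\<in>UNIV. heta H b * hant H b a) = heta H a" for a
    using fun_cong[OF hS_eta, of a] by (simp add: hS_def)
  then have "lc (\<lambda>b. hant H b a) (\<lambda>q. heta H q \<bullet> X) = heta H a \<bullet> X" for a
    by (simp add: lc_def mult.commute flip: sum_scl)
  then show ?thesis by (simp add: lc_dS)
qed

text \<open>Once the dual part is paired with the unit, \<open>S_D\<close> is the antipode of
  \<open>H\<close>; reversing a letter that crosses an edge thus only composes its action with the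
  antipode.\<close>

lemma SD_eta: "lc (SD H u) (\<lambda>s. heta H (snd s) \<bullet> F (fst s)) = lc u (\<lambda>s. heta H (snd s) \<bullet> ap F (fst s))"
proof -
  have 1: "lc (dm H (dm H (dS H (bv j)) (dS H (bv b))) (bv i)) (\<lambda>q. heta H q \<bullet> X) = heta H i \<bullet> heta H j \<bullet> heta H b \<bullet> X"
    for i j b and X :: "('a, 'k) mat"
    by (simp only: lc_dm_eta lc_bv lc_scl lc_eta_dS) (simp add: ac_simps)
  have 2: "(\<Sum>i\<in>UNIV. \<Sum>j\<in>UNIV. heta H i \<bullet> heta H j \<bullet> heta H b \<bullet> lc (hm H (hm H (bv i) (hS H (bv a))) (bv j)) F)
     = heta H b \<bullet> ap F a" for a b
  proof -
    have "(\<Sum>i\<in>UNIV. \<Sum>j\<in>UNIV. heta H i \<bullet> heta H j \<bullet> heta H b \<bullet> lc (hm H (hm H (bv i) (hS H (bv a))) (bv j)) F)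
      = heta H b \<bullet> lc (heta H) (\<lambda>i. lc (heta H) (\<lambda>j. lc (hm H (hm H (bv i) (hS H (bv a))) (bv j)) F))"
      by (simp add: lc_def[of "heta H"] scl_sum ac_simps)
    also have "\<dots> = heta H b \<bullet> ap F a"
      by (simp add: lc_hm_right lc_hm_mid lc_hm_left lc_eta_hm lc_hS_ap)
    finally show ?thesis .
  qed
  have "lc (SD H u) (\<lambda>s. heta H (snd s) \<bullet> F (fst s)) = lc u (\<lambda>s. \<Sum>i\<in>UNIV. \<Sum>j\<in>UNIV.
      heta H i \<bullet> heta H j \<bullet> heta H (snd s) \<bullet> lc (hm H (hm H (bv i) (hS H (bv (fst s)))) (bv j)) F)"
    unfolding SD_def lc_lin lc_vsum split_def sum_UNIV_pair fst_conv snd_conv lc_tens 1 lc_scl ..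
  then show ?thesis by (simp only: 2)
qed

text \<open>The element that \<open>hol_edge\<close> places in the factor of its edge, kept separate
  so that it can be evaluated in representations other than \<open>rhoE\<close>.\<close>

fun hvec :: "'e tedge \<Rightarrow> ('i \<times> 'i \<Rightarrow> 'k) \<Rightarrow> 'i \<times> 'i \<Rightarrow> 'k" where
  "hvec (TR e) u = (\<lambda>(p, q). heta H p * (\<Sum>a\<in>UNIV. u (a, q) * hceps H a))"
| "hvec (TRB e) u = (\<lambda>(p, q). (\<Sum>b\<in>UNIV. u (p, b) * heta H b) * hceps H q)"
| "hvec (TL e) u = lin (\<lambda>(a, b). sc (hceps H a) (vsum (\<lambda>(i, j).
       tens (hm H (bv i) (hS H (bv j))) (dm3 j b i)) UNIV)) u"
| "hvec (TLB e) u = lin (\<lambda>(a, b). sc (heta H b) (vsum (\<lambda>(i, j).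
       tens (hm H (hm H (bv i) (bv a)) (hS H (bv j))) (dm H (bv j) (bv i))) UNIV)) u"

lemma hol_edge_hvec: "hol_edge H x u = pure H (tedge_of x) (hvec x u)"
  by (cases x) auto

definition lvec :: "'e tedge \<times> bool \<Rightarrow> ('i \<times> 'i \<Rightarrow> 'k) \<Rightarrow> 'i \<times> 'i \<Rightarrow> 'k" where
  "lvec l u = hvec (fst l) (if snd l then SD H u else u)"

lemma hol_letter_lvec: "hol_letter H l u = pure H (tedge_of (fst l)) (lvec l u)"
  by (simp add: hol_letter_def lvec_def hol_edge_hvec)

lemma lc_hvec_TR: "lc (hvec (TR e) u) F = lc u (\<lambda>s. hceps H (fst s) \<bullet> lc (heta H) (\<lambda>p. F (p, snd s)))"
proof -
  have "hvec (TR e) u = tens (heta H) (\<lambda>q. \<Sum>a\<in>UNIV. u (a, q) * hceps H a)"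
    by (simp add: tens_def)
  then have "lc (hvec (TR e) u) F = (\<Sum>q\<in>UNIV. \<Sum>a\<in>UNIV. (u (a, q) * hceps H a) \<bullet> lc (heta H) (\<lambda>p. F (p, q)))"
    by (simp add: lc_tens lc_swap[of "heta H"]) (simp add: lc_def[of "\<lambda>q. \<Sum>a\<in>UNIV. u (a, q) * hceps H a"] sum_scl)
  then show ?thesis by (subst (asm) sum.swap) (simp add: lc_pair[of u])
qed

lemma lc_hvec_TRB: "lc (hvec (TRB e) u) F = lc u (\<lambda>s. heta H (snd s) \<bullet> lc (hceps H) (\<lambda>q. F (fst s, q)))"
proof -
  have "hvec (TRB e) u = tens (\<lambda>p. \<Sum>b\<in>UNIV. u (p, b) * heta H b) (hceps H)"
    by (simp add: tens_def)
  then have "lc (hvec (TRB e) u) F = (\<Sum>p\<in>UNIV. \<Sum>b\<in>UNIV. (u (p, b) * heta H b) \<bullet> lc (hceps H) (\<lambda>q. F (p, q)))"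
    by (simp add: lc_tens) (simp add: lc_def[of "\<lambda>p. \<Sum>b\<in>UNIV. u (p, b) * heta H b"] sum_scl)
  then show ?thesis by (simp add: lc_pair[of u])
qed

lemma lc_hvec_TL: "lc (hvec (TL e) u) F = lc u (\<lambda>s. hceps H (fst s) \<bullet> (\<Sum>i\<in>UNIV. \<Sum>j\<in>UNIV.
    lc (hm H (bv i) (hS H (bv j))) (\<lambda>p. lc (dm H (dm H (bv j) (bv (snd s))) (bv i)) (\<lambda>q. F (p, q)))))"
  by (simp add: lc_lin lc_sc lc_vsum lc_tens split_def sum_UNIV_pair)

lemma lc_hvec_TLB: "lc (hvec (TLB e) u) F = lc u (\<lambda>s. heta H (snd s) \<bullet> (\<Sum>i\<in>UNIV. \<Sum>j\<in>UNIV.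
    lc (hm H (hm H (bv i) (bv (fst s))) (hS H (bv j))) (\<lambda>p. lc (dm H (bv j) (bv i)) (\<lambda>q. F (p, q)))))"
  by (simp add: lc_lin lc_sc lc_vsum lc_tens split_def sum_UNIV_pair)

declare hvec.simps [simp del]

lemma lc_hvec_TRB_hr: "lc (hvec (TRB e) u) hr = lc u (\<lambda>s. heta H (snd s) \<bullet> Lm (fst s))"
proof -
  have "lc (hceps H) Tm = 1" using dhom_Tm by (simp add: dhom_def)
  then show ?thesis
    by (simp add: lc_hvec_TRB hr_def flip: lc_mult_right)
qed

lemma lc_hvec_TLB_hr: "lc (hvec (TLB e) u) hr = lc u (\<lambda>s. heta H (snd s) \<bullet> Rm (fst s))"
proof -
  have "(\<Sum>i\<in>UNIV. \<Sum>j\<in>UNIV. lc (hm H (hm H (bv i) (bv a)) (hS H (bv j))) (\<lambda>p. lc (dm H (bv j) (bv i)) (\<lambda>q. hr (p, q)))) = Rm a" for a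
    by (simp add: hr_def lc_mult[symmetric] hom_hm hom_Lm dhom_dm dhom_Tm lc_hS_ap Rm_eq)
  then show ?thesis by (simp only: lc_hvec_TLB)
qed

text \<open>The action of the letter \<open>inc_letter x\<close>. For an outgoing end it is the
  inverse of \<open>l(bar e)\<close>, hence right multiplication composed with the antipode; either
  way it is an algebra map.\<close>

definition phi :: "'e::finite \<times> bool \<Rightarrow> 'i \<Rightarrow> ('e \<Rightarrow> 'i, 'k) mat" where
  "phi x a = emb (fst x) (if snd x then Lm a else ap Rm a)"

lemma hom_phi: "hom (phi x)"
  by (cases "snd x") (simp_all add: phi_def[abs_def] hom_emb hom_Lm hom_ap antihom_Rm)

lemma ap_emb: "ap (\<lambda>a. emb e (F a)) = (\<lambda>a. emb e (ap F a))"
  by (simp add: ap_def[abs_def] emb_lc)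

lemma ap_phi: "ap (phi x) a = emb (fst x) (if snd x then ap Lm a else Rm a)"
  by (cases "snd x") (simp_all add: phi_def[abs_def] ap_emb)

lemma cm_Lm_apRm: "cm (Lm a) (ap Rm b)"
  by (rule cm_sym, rule cm_ap) (simp add: cm_def Lm_Rm)

lemma cm_phi: fixes x :: "'e::finite \<times> bool" assumes "x \<noteq> y" shows "cm (phi x a) (phi y b)"
proof (cases "fst x = fst y")
  case True
  have "cm (emb e A) (emb e B)" if "cm A B" for e :: 'e and A B :: "('i, 'k) mat"
    using that by (simp add: cm_def emb_mult)
  moreover have "snd x \<noteq> snd y" using assms True by (simp add: prod_eq_iff)
  ultimately show ?thesis using True cm_Lm_apRm cm_sym[OF cm_Lm_apRm] by (auto simp: phi_def)
next
  case False
  then show ?thesis by (simp add: phi_def cm_emb)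
qed

lemma emb_lvec_inc: "emb (fst x) (lc (lvec (inc_letter x) u) hr) = lc u (\<lambda>s. heta H (snd s) \<bullet> phi x (fst s))"
  by (cases "snd x") (simp_all add: inc_letter_def lvec_def lc_hvec_TRB_hr lc_hvec_TLB_hr SD_eta phi_def emb_lc emb_scl)

definition inv_letter :: "'e \<times> bool \<Rightarrow> 'e tedge \<times> bool" where
  "inv_letter x = (fst (inc_letter x), \<not> snd (inc_letter x))"

lemma emb_lvec_inv: "emb (fst x) (lc (lvec (inv_letter x) u) hr) = lc u (\<lambda>s. heta H (snd s) \<bullet> ap (phi x) (fst s))"
  by (cases "snd x") (simp_all add: inv_letter_def inc_letter_def lvec_def lc_hvec_TRB_hr lc_hvec_TLB_hr SD_eta ap_phi emb_lc emb_scl)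

lemma tedge_of_letter [simp]: "tedge_of (fst (inc_letter x)) = fst x" "tedge_of (fst (inv_letter x)) = fst x"
  by (simp_all add: inv_letter_def inc_letter_def)

lemma hol_path_Cons: "hol_path H (l # w) u = conv H (hol_letter H l) (hol_path H w) u"
  by (simp add: hol_path_def)

lemma hol_path_off: "e \<notin> tedge_of ` fst ` set w \<Longrightarrow> hol_path H w u \<in> off e"
proof (induction w arbitrary: u)
  case Nil
  then show ?case by (simp add: hol_path_def hol_unit_def sc_def off_scale off_tone)
next
  case (Cons l w)
  have "(\<lambda>h. \<Sum>x\<in>UNIV. DeltaD H u x * tmul (dmul H) (hol_letter H l (bv (fst x))) (hol_path H w (bv (snd x))) h) \<in> off e"
    unfolding hol_letter_lvec using Cons by (intro off_sum off_tmul) auto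
  then show ?case unfolding hol_path_Cons conv_def split_def prod.collapse .
qed

definition rhol :: "('e::finite tedge \<times> bool) list \<Rightarrow> 'i \<times> 'i \<Rightarrow> ('e \<Rightarrow> 'i, 'k) mat" where
  "rhol w s = rhoE (hol_path H w (bv s))"

lemma rhoE_conv: "rhoE (conv H F G u) = lc (DeltaD H u) (\<lambda>x. rhoE (tmul (dmul H) (F (bv (fst x))) (G (bv (snd x)))))"
  unfolding conv_def split_def prod.collapse by (simp add: rhoE_sum rhoE_scale lc_def)

lemma depsD_bv: "depsD H (bv s) = hceps H (fst s) * heta H (snd s)"
  by (simp add: depsD_def split_def mult.assoc sum_bv(1)[of _ "\<lambda>s. hceps H (fst s) * heta H (snd s)"])

lemma rhoE_hol_unit: "rhoE (hol_path H [] u) = depsD H u \<bullet> 1"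
  by (simp add: hol_path_def hol_unit_def sc_def rhoE_scale rhoE_tone)

text \<open>Convolution depends on its argument only through the linear map \<open>DeltaD\<close>,
  so a case distinction on the first letter suffices.\<close>

lemma rhoE_hol_path: "rhoE (hol_path H w u) = lc u (rhol w)"
proof (cases w)
  case Nil
  have "lc u (rhol w) = (\<Sum>s\<in>UNIV. u s * (hceps H (fst s) * heta H (snd s))) \<bullet> 1"
    unfolding Nil rhol_def[abs_def] rhoE_hol_unit depsD_bv by (simp add: lc_def sum_scl)
  then show ?thesis
    unfolding Nil rhoE_hol_unit by (simp add: depsD_def split_def mult.assoc)
next
  case (Cons l w')
  then show ?thesis
    unfolding rhol_def[abs_def] by (simp add: hol_path_Cons rhoE_conv) (rule lc_DeltaD_bv)
qed

lemma rhol_Nil: "rhol [] (a, b) = heta H b \<bullet> cone a"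
  by (simp add: rhol_def rhoE_hol_unit depsD_bv cone_def mult.commute)

lemma rhol_Cons:
  assumes "tedge_of (fst l) \<notin> tedge_of ` fst ` set w"
  shows "rhol (l # w) s = lc (DeltaD H (bv s)) (\<lambda>x. emb (tedge_of (fst l)) (lc (lvec l (bv (fst x))) hr) * rhol w (snd x))"
  by (simp add: rhol_def hol_path_Cons rhoE_conv hol_letter_lvec rhoE_dmul_off hol_path_off assms)

lemma rhol_Cons_inc:
  assumes "fst x \<notin> tedge_of ` fst ` set w"
  shows "rhol (inc_letter x # w) (a, b) = DD a (\<lambda>c d. phi x c * rhol w (d, b))"
  using assms DeltaD_eta_left[of a b "\<lambda>c t. phi x c * rhol w t"] by (simp add: rhol_Cons emb_lvec_inc)

lemma rhol_Cons_inv: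
  assumes "fst x \<notin> tedge_of ` fst ` set w"
  shows "rhol (inv_letter x # w) (a, b) = DD a (\<lambda>c d. ap (phi x) c * rhol w (d, b))"
  using assms DeltaD_eta_left[of a b "\<lambda>c t. ap (phi x) c * rhol w t"] by (simp add: rhol_Cons emb_lvec_inv)

definition Phi :: "('e::finite \<times> bool) list \<Rightarrow> 'i \<Rightarrow> ('e \<Rightarrow> 'i, 'k) mat" where
  "Phi xs = foldr convm (map phi xs) cone"

lemma Phi_simps: "Phi [] = cone" "Phi (x # xs) = phi x \<star> Phi xs"
  by (simp_all add: Phi_def)

lemma Phi_append: "Phi (xs @ ys) = Phi xs \<star> Phi ys"
  by (induction xs) (simp_all add: Phi_simps convm_assoc)

lemma cm_cone: "cm (cone a) Z"
  by (simp add: cone_def cm_scl cm_one)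

lemma cm_Phi: "(\<And>x b. x \<in> set xs \<Longrightarrow> cm (phi x b) Z) \<Longrightarrow> cm (Phi xs a) Z"
  by (induction xs arbitrary: a) (auto simp: Phi_simps cm_cone intro!: cm_convm)

lemma hom_Phi: "distinct xs \<Longrightarrow> hom (Phi xs)"
proof (induction xs)
  case (Cons x xs)
  then have "cm (phi x a) (Phi xs b)" for a b
    by (intro cm_sym[OF cm_Phi] cm_phi) auto
  then show ?case
    using Cons unfolding Phi_simps by (intro hom_convm hom_phi) (auto simp: cm_def)
qed (simp add: Phi_simps hom_cone)

text \<open>The reversed product of the inverses is a left convolution inverse of
  \<open>Phi xs\<close>, and \<open>ap (Phi xs)\<close> is a right one because \<open>Phi xs\<close>
  is an algebra map.\<close>

lemma Phi_inverse: "distinct xs \<Longrightarrow> foldr convm (map (\<lambda>x. ap (phi x)) (rev xs)) cone = ap (Phi xs)"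
proof -
  assume d: "distinct xs"
  have fold: "foldr convm (map F ys) G = foldr convm (map F ys) cone \<star> G" for F and ys :: "('a \<times> bool) list" and G
    by (induction ys) (simp_all add: convm_assoc)
  have "foldr convm (map (\<lambda>x. ap (phi x)) (rev xs)) cone \<star> Phi xs = cone"
  proof (induction xs)
    case (Cons x xs)
    have "ap (phi x) \<star> (phi x \<star> Phi xs) = Phi xs"
      by (simp add: hom_convm_ap hom_phi flip: convm_assoc)
    then show ?case using Cons by (simp add: Phi_simps fold[of _ _ "ap (phi x)"] convm_assoc)
  qed (simp add: Phi_simps)
  then show ?thesis
    by (rule convm_inverse_unique) (simp add: hom_convm_ap hom_Phi d)
qed

lemma rhol_inv:
  assumes "distinct (map fst ys)"
  shows "rhol (map inv_letter ys) (a, b) = heta H b \<bullet> foldr convm (map (\<lambda>x. ap (phi x)) ys) cone a"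
  using assms
proof (induction ys arbitrary: a)
  case (Cons y ys)
  have "fst y \<notin> tedge_of ` fst ` set (map inv_letter ys)"
    using Cons.prems by (auto simp: image_iff)
  then show ?case using Cons by (simp add: rhol_Cons_inv convm_def DD_scl)
qed (simp add: rhol_Nil)

lemma rhol_inv_path:
  assumes "distinct (map fst xs)"
  shows "rhol (inv_path (map inc_letter xs)) (a, b) = heta H b \<bullet> ap (Phi xs) a"
proof -
  have "inv_path (map inc_letter xs) = map inv_letter (rev xs)"
    by (simp add: inv_path_def rev_map inv_letter_def split_def)
  moreover have "distinct (map fst (rev xs))" using assms by (simp flip: rev_map)
  moreover have "distinct xs" using assms by (simp add: distinct_map)
  ultimately show ?thesis by (simp only: rhol_inv Phi_inverse)
qed

lemma rhol_inc:
  assumes "distinct (map fst xs)" "fst ` set xs \<inter> tedge_of ` fst ` set w = {}"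
  shows "rhol (map inc_letter xs @ w) (a, b) = DD a (\<lambda>c d. Phi xs c * rhol w (d, b))"
  using assms
proof (induction xs arbitrary: a)
  case Nil
  then show ?case by (simp add: Phi_simps cone_def DD_counit_left)
next
  case (Cons x xs)
  have "fst x \<notin> tedge_of ` fst ` set (map inc_letter xs @ w)"
    using Cons.prems by (auto simp: image_iff)
  then have "rhol (map inc_letter (x # xs) @ w) (a, b) = DD a (\<lambda>c d. phi x c * DD d (\<lambda>c d. Phi xs c * rhol w (d, b)))"
    using Cons by (simp add: rhol_Cons_inc)
  also have "\<dots> = DD a (\<lambda>c d. Phi (x # xs) c * rhol w (d, b))"
    unfolding Phi_simps convm_def DD_mult_left DD_mult_right mult.assoc by (rule DD_coassoc[symmetric])
  finally show ?case .
qed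

end

lemma tmul_sum_right: "tmul M U (\<lambda>h. \<Sum>s\<in>A. c s * X s h) = (\<lambda>h. \<Sum>s\<in>A. c s * tmul M U (X s) h)"
proof (induction A rule: infinite_finite_induct)
  case (insert x A)
  then show ?case
    by (simp add: tmul_add_right[of M U "\<lambda>h. c x * X x h"] tmul_scale_right)
qed (simp_all add: tmul_zero_right)

context hopf_coords
begin

section \<open>The two paths along an edge\<close>

text \<open>\<open>W l1 l2 u\<close> is the part of the holonomy along \<open>l1 \<circ> l2 \<circ> w\<close> that does not depend on \<open>w\<close>, for letters
  \<open>l1, l2\<close> of the same edge; the last tensor factor is fed into the holonomy of \<open>w\<close>.\<close>

definition W :: "'e tedge \<times> bool \<Rightarrow> 'e tedge \<times> bool \<Rightarrow> ('i \<times> 'i \<Rightarrow> 'k) \<Rightarrow> ('i \<times> 'i) \<times> 'i \<Rightarrow> 'k" where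
  "W l1 l2 u = lin (\<lambda>x. lin (\<lambda>y. sc (heta H (snd (snd y)))
      (ttens (dmul H (lvec l1 (bv (fst x))) (lvec l2 (bv (fst y)))) (bv (fst (snd y))))) (DeltaD H (bv (snd x)))) (DeltaD H u)"

lemma lc_W: "lc (W l1 l2 u) F = lc (DeltaD H u) (\<lambda>x. lc (DeltaD H (bv (snd x))) (\<lambda>y. heta H (snd (snd y)) \<bullet>
    lc (dmul H (lvec l1 (bv (fst x))) (lvec l2 (bv (fst y)))) (\<lambda>v. F (v, fst (snd y)))))"
  by (simp add: W_def lc_lin lc_sc lc_ttens)

text \<open>The only place where two letters meet in one tensor factor. They are first merged by the
  multiplication of \<open>D(H)^*\<close>; afterwards the rest of the path is trivial on
  \<open>e\<close> and the bridge to matrix products applies.\<close>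

lemma rhol_Cons_Cons:
  assumes e: "tedge_of (fst l1) = e" "tedge_of (fst l2) = e" "e \<notin> tedge_of ` fst ` set w"
    and Z: "\<And>r b. rhol w (r, b) = heta H b \<bullet> Z r"
  shows "rhol (l1 # l2 # w) s = lc (W l1 l2 (bv s)) (\<lambda>x. emb e (hr (fst x)) * Z (snd x))"
proof -
  have Z': "rhol w t = heta H (snd t) \<bullet> Z (fst t)" for t
    using Z[of "fst t" "snd t"] by simp
  have hp: "hol_path H (l2 # w) = conv H (hol_letter H l2) (hol_path H w)"
    by (rule ext) (rule hol_path_Cons)
  have conv: "conv H (hol_letter H l2) (hol_path H w) u =
     (\<lambda>h. \<Sum>y\<in>UNIV. DeltaD H u y * tmul (dmul H) (pure H e (lvec l2 (bv (fst y)))) (hol_path H w (bv (snd y))) h)" for u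
    by (simp add: conv_def[abs_def] split_def hol_letter_lvec e)
  have "rhol (l1 # l2 # w) s = lc (DeltaD H (bv s)) (\<lambda>x. rhoE (tmul (dmul H) (pure H e (lvec l1 (bv (fst x))))
      (conv H (hol_letter H l2) (hol_path H w) (bv (snd x)))))"
    by (simp only: rhol_def hol_path_Cons[of l1] hp rhoE_conv[of "hol_letter H l1"] hol_letter_lvec[of l1] e)
  also have "\<dots> = lc (DeltaD H (bv s)) (\<lambda>x. lc (DeltaD H (bv (snd x))) (\<lambda>y. rhoE (tmul (dmul H) (pure H e (lvec l1 (bv (fst x))))
      (tmul (dmul H) (pure H e (lvec l2 (bv (fst y)))) (hol_path H w (bv (snd y)))))))"
    by (simp add: conv tmul_sum_right rhoE_sum rhoE_scale) (simp add: lc_def)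
  also have "\<dots> = lc (DeltaD H (bv s)) (\<lambda>x. lc (DeltaD H (bv (snd x))) (\<lambda>y.
       emb e (lc (dmul H (lvec l1 (bv (fst x))) (lvec l2 (bv (fst y)))) hr) * rhol w (snd y)))"
    by (simp add: dmul_off_assoc hol_path_off e rhoE_dmul_off rhol_def)
  finally show ?thesis
    by (simp add: lc_W Z' emb_lc lc_mult_left)
qed

lemma lc_W_plus:
  "lc (W (TRB e, False) (TR e, False) (bv (a, g))) F =
   DD a (\<lambda>a1 a2. \<Sum>i\<in>UNIV. \<Sum>j\<in>UNIV. lc (dm3 i g j) (\<lambda>q.
     lc (conj_vec j a2 i) (\<lambda>r. F ((a1, q), r))))"
proof -
  have 1: "lc (dmul H (lvec (TRB e, False) (bv s)) (lvec (TR e, False) (bv t))) F = heta H (snd s) \<bullet> hceps H (fst t) \<bullet> F (fst s, snd t)"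
    for s t and F :: "'i \<times> 'i \<Rightarrow> ('t::finite, 'k) mat"
    by (simp add: lvec_def lc_dmul lc_hvec_TR lc_hvec_TRB lc_hm_left lc_eta_hm lc_dm_left dm_eps lc_scl mult.commute)
  have "lc (W (TRB e, False) (TR e, False) (bv (a, g))) F = lc (DeltaD H (bv (a, g))) (\<lambda>x. heta H (snd (fst x)) \<bullet>
      lc (DeltaD H (bv (snd x))) (\<lambda>y. hceps H (fst (fst y)) \<bullet> heta H (snd (snd y)) \<bullet> F ((fst (fst x), snd (fst y)), fst (snd y))))"
    unfolding lc_W 1 lc_scl[symmetric] by (simp add: ac_simps)
  also have "\<dots> = DD a (\<lambda>a1 a2. lc (DeltaD H (bv (a2, g))) (\<lambda>y. hceps H (fst (fst y)) \<bullet> heta H (snd (snd y)) \<bullet> F ((a1, snd (fst y)), fst (snd y))))"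
    by (rule DeltaD_eta_left)
  also have "\<dots> = DD a (\<lambda>a1 a2. \<Sum>i\<in>UNIV. \<Sum>j\<in>UNIV. lc (dm3 i g j) (\<lambda>q.
     lc (conj_vec j a2 i) (\<lambda>r. F ((a1, q), r))))"
    by (simp only: DeltaD_eps_eta[where G = "\<lambda>q r. F ((_, q), r)"])
  finally show ?thesis .
qed

text \<open>A test representation on three independent factors: for the two parts of the element in
  the factor \<open>e\<close>, and for the element of \<open>H\<close> passed on to the rest of the
  path. \<open>D(H)^*\<close> multiplies its \<open>H\<close>-parts in the opposite order, so the
  anti-representation \<open>Rm\<close> makes the first two slots jointly represent
  \<open>dmul\<close>.\<close>

definition slot1 :: "'i \<Rightarrow> (bool option \<Rightarrow> 'i, 'k) mat" where "slot1 a = emb None (Rm a)"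
definition slot2 :: "'i \<Rightarrow> (bool option \<Rightarrow> 'i, 'k) mat" where "slot2 a = emb (Some True) (Tm a)"
definition slot3 :: "'i \<Rightarrow> (bool option \<Rightarrow> 'i, 'k) mat" where "slot3 a = emb (Some False) (Rm a)"

lemma slots_faithful:
  assumes "lc u (\<lambda>x. slot1 (fst (fst x)) * slot2 (snd (fst x)) * slot3 (snd x)) =
           lc v (\<lambda>x. slot1 (fst (fst x)) * slot2 (snd (fst x)) * slot3 (snd x))"
  shows "u = v"
proof (rule tp_faithful[of "\<lambda>z. if z = Some True then Tm else Rm"
    "\<lambda>x z. case z of None \<Rightarrow> fst (fst x) | Some True \<Rightarrow> snd (fst x) | Some False \<Rightarrow> snd x"])
  let ?enc = "\<lambda>(x :: ('i \<times> 'i) \<times> 'i) z. case z of None \<Rightarrow> fst (fst x) | Some True \<Rightarrow> snd (fst x) | Some False \<Rightarrow> snd x"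
  show "dual_family (if z = Some True then Tm else Rm)" for z :: "bool option"
    by (simp add: dual_Tm dual_Rm)
  show "inj ?enc"
  proof (rule injI)
    fix x y assume "?enc x = ?enc y"
    from fun_cong[OF this, of None] fun_cong[OF this, of "Some True"] fun_cong[OF this, of "Some False"]
    show "x = y" by (simp add: prod_eq_iff)
  qed
  have "slot1 (fst (fst x)) * slot2 (snd (fst x)) * slot3 (snd x)
     = tp (\<lambda>z. (if z = Some True then Tm else Rm) (?enc x z))" for x
    unfolding slot1_def slot2_def slot3_def emb_def tp_mult
    by (intro arg_cong[of _ _ tp] ext) (auto split: option.splits bool.splits)
  then show "lc u (\<lambda>x. tp (\<lambda>z. (if z = Some True then Tm else Rm) (?enc x z))) = lc v (\<lambda>x. tp (\<lambda>z. (if z = Some True then Tm else Rm) (?enc x z)))"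
    using assms by simp
qed

lemma cm_slots: "cm (slot1 a) (slot2 b)" "cm (slot1 a) (slot3 b)" "cm (slot2 a) (slot3 b)"
  by (simp_all add: slot1_def slot2_def slot3_def cm_emb)

lemma slot_homs: "antihom slot1" "dhom slot2" "antihom slot3"
  by (simp_all add: slot1_def[abs_def] slot2_def[abs_def] slot3_def[abs_def] antihom_emb dhom_emb antihom_Rm dhom_Tm)

text \<open>In the test representation, the letters along the left of \<open>e\<close> are the
  elementary actions \<open>slot2\<close> and \<open>slot1\<close> conjugated by the canonical
  element \<open>V\<close>. The comultiplication contributes a conjugation by \<open>V * Y\<close>;
  the two occurrences of \<open>V\<close> cancel, and the remaining conjugation by \<open>Y\<close>
  is the one belonging to the path on the right.\<close>

lemma W_minus_plus: "W (TL e, False) (TLB e, False) (bv (a, g)) = W (TRB e, False) (TR e, False) (bv (a, g))"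
proof (rule slots_faithful)
  define sg where "sg s = slot1 (fst s) * slot2 (snd s)" for s
  define V where "V = can slot2 slot1"
  define V' where "V' = can slot2 (ap slot1)"
  define Y where "Y = can slot2 slot3"
  define Y' where "Y' = can slot2 (ap slot3)"
  define G where "G = slot1 \<star> slot3"
  have c12: "slot1 x * slot2 y = slot2 y * slot1 x" for x y
    using cm_slots(1) by (simp add: cm_def)
  have c12': "slot1 x * (slot2 y * Z) = slot2 y * (slot1 x * Z)" for x y Z
    by (simp add: c12 flip: mult.assoc)
  have ca12: "ap slot1 x * slot2 y = slot2 y * ap slot1 x" for x y
    using cm_ap[of slot1 "slot2 y"] cm_slots by (simp add: cm_def)
  have ca12': "ap slot1 x * (slot2 y * Z) = slot2 y * (ap slot1 x * Z)" for x y Z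
    by (simp add: ca12 flip: mult.assoc)
  have VV: "V * V' = 1" "V' * V = 1"
    unfolding V_def V'_def
    by (auto intro!: can_inverse slot_homs cm_slots cm_ap antihom_convm_ap)
  have YY: "Y * Y' = 1" "Y' * Y = 1"
    unfolding Y_def Y'_def
    by (auto intro!: can_inverse slot_homs cm_sym[OF cm_slots(3)] cm_ap antihom_convm_ap)
  have VVZ: "V * (V' * Z) = Z" "V' * (V * Z) = Z" and YYZ: "Y * (Y' * Z) = Z" for Z
    using VV YY by (simp_all flip: mult.assoc)
  have sg_dmul: "lc (dmul H u v) sg = lc u sg * lc v sg" for u v
  proof -
    have "lc (dmul H u v) sg = lc u (\<lambda>s. lc v (\<lambda>t. slot1 (fst s) * slot1 (fst t) * (slot2 (snd s) * slot2 (snd t))))"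
      by (simp add: lc_dmul sg_def lc_mult[symmetric] antihom_hm slot_homs dhom_dm)
    also have "\<dots> = lc u sg * lc v sg"
      by (simp add: sg_def lc_mult mult.assoc c12 c12')
    finally show ?thesis .
  qed
  have sTL: "lc (lvec (TL e, False) (bv s)) sg = hceps H (fst s) \<bullet> (V' * slot2 (snd s) * V)" for s
  proof -
    have "lc (lvec (TL e, False) (bv s)) sg = hceps H (fst s) \<bullet> (\<Sum>i\<in>UNIV. \<Sum>j\<in>UNIV.
       ap slot1 j * slot1 i * (slot2 j * slot2 (snd s) * slot2 i))"
      by (simp add: lvec_def lc_hvec_TL sg_def lc_mult[symmetric] antihom_hm slot_homs dhom_dm lc_hS_ap)
    also have "\<dots> = hceps H (fst s) \<bullet> (\<Sum>i\<in>UNIV. \<Sum>j\<in>UNIV. slot2 j * ap slot1 j * slot2 (snd s) * (slot2 i * slot1 i))"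
      by (simp add: mult.assoc c12 c12' ca12 ca12')
    also have "(\<Sum>i\<in>UNIV. \<Sum>j\<in>UNIV. slot2 j * ap slot1 j * slot2 (snd s) * (slot2 i * slot1 i)) = V' * slot2 (snd s) * V"
      unfolding V_def V'_def can_def sum_distrib_right by (subst sum.swap) (simp only: sum_distrib_left)
    finally show ?thesis .
  qed
  have sTLB: "lc (lvec (TLB e, False) (bv s)) sg = heta H (snd s) \<bullet> (V' * slot1 (fst s) * V)" for s
  proof -
    have "lc (lvec (TLB e, False) (bv s)) sg = heta H (snd s) \<bullet> (\<Sum>i\<in>UNIV. \<Sum>j\<in>UNIV.
       ap slot1 j * (slot1 (fst s) * slot1 i) * (slot2 j * slot2 i))"
      by (simp add: lvec_def lc_hvec_TLB sg_def lc_mult[symmetric] antihom_hm slot_homs dhom_dm lc_hS_ap)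
    also have "\<dots> = heta H (snd s) \<bullet> (\<Sum>i\<in>UNIV. \<Sum>j\<in>UNIV. slot2 j * ap slot1 j * slot1 (fst s) * (slot2 i * slot1 i))"
      by (simp add: mult.assoc c12 c12' ca12 ca12')
    also have "(\<Sum>i\<in>UNIV. \<Sum>j\<in>UNIV. slot2 j * ap slot1 j * slot1 (fst s) * (slot2 i * slot1 i)) = V' * slot1 (fst s) * V"
      unfolding V_def V'_def can_def sum_distrib_right by (subst sum.swap) (simp only: sum_distrib_left)
    finally show ?thesis .
  qed
  have aG: "antihom G"
    unfolding G_def using cm_slots(2) by (intro antihom_convm slot_homs) (auto simp: cm_def)
  have cG: "cm (G x) (slot2 y)" for x y
    unfolding G_def using cm_slots cm_sym[OF cm_slots(3)] by (intro cm_convm) auto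
  have canG: "can slot2 G = V * Y"
    unfolding G_def V_def Y_def by (intro can_convm slot_homs c12)
  \<comment> \<open>Uniqueness of the inverse of \<open>V * Y\<close> replaces a formula for the
    antipode of a convolution product.\<close>
  have canG': "can slot2 (ap G) = Y' * V'"
  proof -
    have 1: "can slot2 (ap G) * can slot2 G = 1"
      by (auto intro!: can_inverse slot_homs cm_ap cG antihom_convm_ap aG)
    have "(V * Y) * (Y' * V') = 1"
      by (simp add: mult.assoc YYZ VV)
    then have "can slot2 (ap G) * can slot2 G * (Y' * V') = can slot2 (ap G)"
      by (simp add: canG mult.assoc)
    then show ?thesis by (simp add: 1)
  qed
  have cV3: "cm V (slot3 y)" "cm V' (slot3 y)" for y
    unfolding V_def V'_def using cm_slots by (auto intro!: cm_can cm_ap)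
  have c1Y: "cm (slot1 x) Y" for x
    unfolding Y_def by (rule cm_sym, rule cm_can) (simp_all add: cm_sym[OF cm_slots(1)] cm_sym[OF cm_slots(2)])
  let ?om = "\<lambda>x. slot1 (fst (fst x)) * slot2 (snd (fst x)) * slot3 (snd x)"
  have dmul_om: "lc (dmul H u v) (\<lambda>w. ?om (w, r)) = lc u sg * lc v sg * slot3 r" for u v r
    unfolding sg_dmul[symmetric] unfolding lc_mult_left by (simp only: sg_def fst_conv snd_conv)
  have "lc (W (TL e, False) (TLB e, False) (bv (a, g))) ?om = lc (DeltaD H (bv (a, g))) (\<lambda>x. hceps H (fst (fst x)) \<bullet>
      lc (DeltaD H (bv (snd x))) (\<lambda>y. heta H (snd (fst y)) \<bullet> heta H (snd (snd y)) \<bullet>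
        (V' * slot2 (snd (fst x)) * slot1 (fst (fst y)) * slot3 (fst (snd y)) * V)))"
  proof -
    have "V' * slot2 q * V * (V' * slot1 p * V) * slot3 r = V' * slot2 q * slot1 p * slot3 r * V" for p q r
      using cV3(1)[of r] by (simp add: cm_def mult.assoc VVZ)
    then show ?thesis
      unfolding lc_W dmul_om sTL sTLB lc_scl[symmetric] by (simp add: ac_simps)
  qed
  also have "\<dots> = lc (DeltaD H (bv (a, g))) (\<lambda>x. hceps H (fst (fst x)) \<bullet> heta H (snd (snd x)) \<bullet>
        (V' * slot2 (snd (fst x)) * G (fst (snd x)) * V))"
  proof -
    have "lc (DeltaD H (bv t)) (\<lambda>y. heta H (snd (fst y)) \<bullet> heta H (snd (snd y)) \<bullet>
        (V' * slot2 q * slot1 (fst (fst y)) * slot3 (fst (snd y)) * V)) = heta H (snd t) \<bullet> (V' * slot2 q * G (fst t) * V)" for t q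
      using DeltaD_eta_left[of "fst t" "snd t" "\<lambda>p t. heta H (snd t) \<bullet> (V' * slot2 q * slot1 p * slot3 (fst t) * V)"]
      by (simp add: G_def convm_def DD_mult_left DD_mult_right DD_scl mult.assoc)
    then show ?thesis by simp
  qed
  also have "\<dots> = (\<Sum>i\<in>UNIV. \<Sum>j\<in>UNIV. lc (dm3 i g j) (\<lambda>q.
     lc (conj_vec j a i) (\<lambda>r. V' * (slot2 q * G r) * V)))"
    unfolding mult.assoc by (rule DeltaD_eps_eta)
  also have "\<dots> = V' * (\<Sum>i\<in>UNIV. \<Sum>j\<in>UNIV. lc (dm3 i g j) slot2 *
     lc (conj_vec j a i) G) * V"
    by (simp only: lc_mult sum_distrib_left sum_distrib_right lc_mult_left[of _ _ V] lc_mult_right[of V'])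
  also have "\<dots> = V' * (V * Y * (slot2 g * G a) * (Y' * V')) * V"
    by (simp only: sum_can_conj slot_homs aG cG canG canG')
  also have "\<dots> = Y * (slot2 g * G a) * Y'"
    by (simp add: mult.assoc VV VVZ)
  \<comment> \<open>Of the two legs of \<open>G\<close>, the one in \<open>slot1\<close> commutes
    with \<open>Y\<close> and leaves the conjugation.\<close>
  also have "\<dots> = DD a (\<lambda>a1 a2. slot1 a1 * (Y * (slot2 g * slot3 a2) * Y'))"
    unfolding G_def convm_def DD_mult_left DD_mult_right
    using c1Y by (intro arg_cong[of _ _ "DD a"] ext) (simp add: cm_def c12' mult.assoc[symmetric], simp add: mult.assoc c12')
  also have "\<dots> = DD a (\<lambda>a1 a2. \<Sum>i\<in>UNIV. \<Sum>j\<in>UNIV. lc (dm3 i g j) (\<lambda>q.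
     lc (conj_vec j a2 i) (\<lambda>r. ?om ((a1, q), r))))"
    unfolding Y_def Y'_def sum_can_conj[OF slot_homs(2,3) cm_sym[OF cm_slots(3)], symmetric]
    by (simp only: sum_distrib_left lc_mult lc_mult_right[of "slot1 _"] mult.assoc fst_conv snd_conv)
  also have "\<dots> = lc (W (TRB e, False) (TR e, False) (bv (a, g))) ?om"
    by (rule lc_W_plus[symmetric])
  finally show "lc (W (TL e, False) (TLB e, False) (bv (a, g))) ?om = lc (W (TRB e, False) (TR e, False) (bv (a, g))) ?om" .
qed


lemma emb_hr: "emb e (hr s) = emb e (Lm (fst s)) * emb e (Tm (snd s))"
  by (simp add: hr_def emb_mult)

lemma emb_Tm_Lm: "emb e (Tm g) * emb e (Lm a) = DD a (\<lambda>a1 a2. \<Sum>g2\<in>UNIV. hmu H a2 g2 g \<bullet> (emb e (Lm a1) * emb e (Tm g2)))"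
  by (simp add: emb_mult Tm_Lm emb_DD emb_sum emb_scl)

lemma emb_Tm_Rm: "emb e (Tm g) * emb e (Rm a) = DD a (\<lambda>a1 a2. \<Sum>g1\<in>UNIV. hmu H g1 a2 g \<bullet> (emb e (Rm a1) * emb e (Tm g1)))"
  by (simp add: emb_mult Tm_Rm emb_DD emb_sum emb_scl)

lemma cm_phi_emb: "fst x \<noteq> e \<Longrightarrow> cm (phi x a) (emb e B)"
  by (simp add: phi_def cm_emb)

lemma cm_Phi_emb: "e \<notin> fst ` set xs \<Longrightarrow> cm (Phi xs a) (emb e B)"
  by (intro cm_Phi cm_phi_emb) auto

end

text \<open>\<open>ts\<close> and \<open>ss\<close> are meant to be the edge ends of lower order at the target and the starting vertex of \<open>e\<close>.\<close>

locale edge_ends = hopf_coords H for H :: "('i::finite, 'k::field) hopf" +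
  fixes e :: "'e::finite" and ts ss :: "('e \<times> bool) list"
  assumes dts: "distinct (map fst ts)" and dss: "distinct (map fst ss)"
    and ets: "e \<notin> fst ` set ts" and ess: "e \<notin> fst ` set ss"
    and tss: "fst ` set ts \<inter> fst ` set ss = {}"
begin

section \<open>Normal form of an edge holonomy\<close>

definition "L a = emb e (Lm a)"
definition "T a = emb e (Tm a)"
definition "V = can T (Phi ss)"
definition "V' = can T (ap (Phi ss))"
definition "K = Phi ts \<star> L"
definition "Hol s = V' * K (fst s) * T (snd s) * V"

lemma dist: "distinct ts" "distinct ss"
  using dts dss by (simp_all add: distinct_map)

lemma dhom_T: "dhom T" and hom_L: "hom L"
  by (simp_all add: T_def[abs_def] L_def[abs_def] dhom_emb dhom_Tm hom_emb hom_Lm)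

lemma cm_ss: "cm (Phi ss a) (L b)" "cm (Phi ss a) (T b)"
  and cm_ts: "cm (Phi ts a) (L b)" "cm (Phi ts a) (T b)"
  by (simp_all add: L_def T_def cm_Phi_emb ets ess)

lemma cm_ts_ss: "cm (Phi ts a) (Phi ss b)"
  by (intro cm_Phi cm_sym[OF cm_Phi] cm_phi) (use tss in auto)

lemma V_inverse: "V * V' = 1" "V' * V = 1"
  unfolding V_def V'_def
  by (auto intro!: can_inverse dhom_T cm_ss cm_ap hom_convm_ap hom_Phi dist)

lemma V_cancel: "V * (V' * Z) = Z" "V' * (V * Z) = Z"
  using V_inverse by (simp_all flip: mult.assoc)

lemma cm_ts_V: "cm (Phi ts a) V" "cm (Phi ts a) V'"
  unfolding V_def V'_def
  by (auto intro!: cm_sym[OF cm_can] cm_sym[OF cm_ts(2)] cm_sym[OF cm_ts_ss] cm_ap)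

lemma V_L: "V * L a = (L \<star> Phi ss) a * V"
  unfolding V_def
  by (rule can_L[OF hom_Phi[OF dist(2)] cm_ss(1) _ cm_ss(2)]) (simp add: L_def T_def emb_Tm_Lm)

lemma L_V': "L a * V' = V' * (L \<star> Phi ss) a"
proof -
  have "L a * V' = V' * (V * L a) * V'"
    by (simp add: V_cancel mult.assoc)
  also have "\<dots> = V' * (L \<star> Phi ss) a"
    unfolding V_L by (simp add: V_inverse mult.assoc)
  finally show ?thesis .
qed

lemma V_K: "V * K a = (K \<star> Phi ss) a * V"
proof -
  have "V * K a = DD a (\<lambda>b c. Phi ts b * (V * L c))"
    using cm_ts_V(1) by (simp add: K_def convm_def DD_mult_right cm_def flip: mult.assoc)
  also have "\<dots> = (Phi ts \<star> (L \<star> Phi ss)) a * V"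
    unfolding V_L by (simp add: convm_def[of "Phi ts"] DD_mult_left mult.assoc)
  finally show ?thesis by (simp add: K_def convm_assoc)
qed

lemma K_V': "K a * V' = V' * (K \<star> Phi ss) a"
proof -
  have "K a * V' = V' * (V * K a) * V'"
    by (simp add: V_cancel mult.assoc)
  also have "\<dots> = V' * (K \<star> Phi ss) a"
    unfolding V_K by (simp add: V_inverse mult.assoc)
  finally show ?thesis .
qed

lemma hom_K: "hom K"
  unfolding K_def using cm_ts(1) by (intro hom_convm hom_Phi hom_L dist) (auto simp: cm_def)

lemma cm_K_ss: "cm (K a) (Phi ss b)"
  unfolding K_def by (intro cm_convm cm_ts_ss cm_sym[OF cm_ss(1)])

text \<open>\<open>Phi ts\<close> commutes with \<open>T\<close> and is only carried along. With
  \<open>hom_K\<close> and \<open>dhom_T\<close> this makes \<open>K\<close> and \<open>T\<close>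
  another representation of the Heisenberg double.\<close>

lemma T_K: "T g * K a = DD a (\<lambda>a1 a2. \<Sum>g2\<in>UNIV. hmu H a2 g2 g \<bullet> (K a1 * T g2))"
proof -
  have "T g * K a = DD a (\<lambda>b c. Phi ts b * (T g * L c))"
    using cm_ts(2) by (simp add: K_def convm_def DD_mult_right cm_def flip: mult.assoc)
  also have "\<dots> = DD a (\<lambda>b c. DD c (\<lambda>a1 a2. \<Sum>g2\<in>UNIV. hmu H a2 g2 g \<bullet> (Phi ts b * (L a1 * T g2))))"
    by (simp add: L_def T_def emb_Tm_Lm DD_mult_right sum_distrib_left)
  also have "\<dots> = DD a (\<lambda>a1 a2. \<Sum>g2\<in>UNIV. hmu H a2 g2 g \<bullet> (K a1 * T g2))"
    by (simp add: DD_coassoc[symmetric] K_def convm_def DD_mult_left DD_sum DD_scl mult.assoc)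
  finally show ?thesis .
qed

lemma inv_path_edges: "tedge_of ` fst ` set (inv_path (map inc_letter xs)) = fst ` set xs"
  by (force simp: inv_path_def image_iff split_def)

lemma rhol_edge:
  "rhol ((TRB e, False) # (TR e, False) # inv_path (map inc_letter ss)) (a, g) = V' * L a * T g * V"
proof -
  let ?Psi = "ap (Phi ss)"
  have aPsi: "antihom ?Psi"
    by (intro antihom_ap hom_Phi dist)
  have cT: "cm (?Psi x) (T y)" for x y
    by (intro cm_ap cm_ss)
  have "rhol ((TRB e, False) # (TR e, False) # inv_path (map inc_letter ss)) (a, g)
     = lc (W (TRB e, False) (TR e, False) (bv (a, g))) (\<lambda>x. emb e (hr (fst x)) * ?Psi (snd x))"
    by (rule rhol_Cons_Cons) (simp_all add: inv_path_edges ess rhol_inv_path dss)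
  also have "\<dots> = DD a (\<lambda>a1 a2. L a1 * (\<Sum>i\<in>UNIV. \<Sum>j\<in>UNIV. lc (dm3 i g j) T *
     lc (conj_vec j a2 i) ?Psi))"
    unfolding lc_W_plus emb_hr
    by (simp only: sum_distrib_left lc_mult lc_mult_right[of "emb e (Lm _)"] mult.assoc fst_conv snd_conv L_def T_def)
  also have "\<dots> = DD a (\<lambda>a1 a2. L a1 * (V' * (T g * ?Psi a2) * V))"
    by (simp only: sum_can_conj[OF dhom_T aPsi cT] V_def V'_def ap_ap)
  \<comment> \<open>Moving \<open>L\<close> past \<open>V'\<close> creates a convolution factor
    \<open>Phi ss\<close>, which then cancels against the \<open>ap (Phi ss)\<close> coming from the
    inverse path.\<close>
  also have "\<dots> = V' * ((L \<star> Phi ss) \<star> ?Psi) a * T g * V"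
  proof -
    have "L a1 * (V' * (T g * ?Psi a2) * V) = V' * ((L \<star> Phi ss) a1 * ?Psi a2 * T g * V)" for a1 a2
    proof -
      have "L a1 * (V' * (T g * ?Psi a2) * V) = (L a1 * V') * (?Psi a2 * T g) * V"
        using cT[of a2 g] by (simp add: cm_def mult.assoc)
      then show ?thesis by (simp only: L_V' mult.assoc)
    qed
    then show ?thesis
      by (simp add: convm_def[of _ ?Psi] DD_mult_left DD_mult_right mult.assoc)
  qed
  also have "\<dots> = V' * L a * T g * V"
    by (simp add: convm_assoc hom_convm_ap hom_Phi dist)
  finally show ?thesis .
qed

lemma rhol_minus_edge:
  "rhol ((TL e, False) # (TLB e, False) # inv_path (map inc_letter ss)) (a, g) =
   rhol ((TRB e, False) # (TR e, False) # inv_path (map inc_letter ss)) (a, g)"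
proof -
  have "rhol (l1 # l2 # inv_path (map inc_letter ss)) (a, g) = lc (W l1 l2 (bv (a, g))) (\<lambda>x. emb e (hr (fst x)) * ap (Phi ss) (snd x))"
    if "tedge_of (fst l1) = e" "tedge_of (fst l2) = e" for l1 l2
    using that by (rule rhol_Cons_Cons) (simp_all add: inv_path_edges ess rhol_inv_path dss)
  then show ?thesis by (simp add: W_minus_plus)
qed

lemma rhol_path:
  assumes "w = (TRB e, False) # (TR e, False) # inv_path (map inc_letter ss) \<or>
           w = (TL e, False) # (TLB e, False) # inv_path (map inc_letter ss)"
  shows "rhol (map inc_letter ts @ w) = Hol"
proof
  fix s :: "'i \<times> 'i"
  obtain a g where s: "s = (a, g)" by fastforce
  have "tedge_of ` fst ` set w \<subseteq> insert e (fst ` set ss)"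
    using assms by (elim disjE) (simp_all add: inv_path_edges)
  then have "rhol (map inc_letter ts @ w) (a, g) = DD a (\<lambda>c d. Phi ts c * rhol w (d, g))"
    using tss ets by (intro rhol_inc dts) blast
  also have "\<dots> = DD a (\<lambda>c d. Phi ts c * (V' * L d * T g * V))"
    using assms rhol_minus_edge rhol_edge by auto
  also have "\<dots> = DD a (\<lambda>c d. V' * (Phi ts c * L d * T g * V))"
    using cm_ts_V(2) by (simp add: cm_def flip: mult.assoc)
  also have "\<dots> = Hol (a, g)"
    by (simp add: Hol_def K_def convm_def DD_mult_left DD_mult_right mult.assoc)
  finally show "rhol (map inc_letter ts @ w) s = Hol s" by (simp add: s)
qed

end

context hopf_coords
begin

section \<open>The contractions with the R-matrix\<close>

text \<open>The antipode reverses the comultiplication. Evaluated in two commuting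
  anti-representations, both sides are convolution inverse to \<open>A \<star> B\<close>;
  independence of the test family then gives the identity for arbitrary \<open>F\<close>.\<close>

lemma lc_ant_DD: "lc (hant H a) (\<lambda>b. DD b F) = DD a (\<lambda>b c. lc (hant H c) (\<lambda>p. lc (hant H b) (\<lambda>q. F p q)))"
proof -
  define A :: "'i \<Rightarrow> (bool \<Rightarrow> 'i, 'k) mat" where "A = (\<lambda>p. emb True (Rm p))"
  define B :: "'i \<Rightarrow> (bool \<Rightarrow> 'i, 'k) mat" where "B = (\<lambda>p. emb False (Rm p))"
  define K where "K a = DD a (\<lambda>b c. ap A c * ap B b)" for a
  have aA: "antihom A" and aB: "antihom B"
    by (simp_all add: A_def B_def antihom_emb antihom_Rm)
  have cAB: "A x * B y = B y * A x" for x y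
    by (simp add: A_def B_def emb_comm)
  have cApB: "A x * ap B y = ap B y * A x" for x y
    using cm_ap[of B "A x"] cAB by (simp add: cm_def)
  have "K \<star> (A \<star> B) = cone"
  proof
    fix a
    have "(K \<star> (A \<star> B)) a = DD a (\<lambda>u v. DD u (\<lambda>b c. DD v (\<lambda>x y. ap A c * A x * (ap B b * B y))))"
    proof -
      have "ap A c * ap B b * (A x * B y) = ap A c * A x * (ap B b * B y)" for b c x y
        by (simp only: mult.assoc) (simp only: mult.assoc[symmetric] cApB[symmetric])
      then show ?thesis
        by (simp add: convm_def[of K] convm_def[of A] K_def DD_mult_left) (simp add: DD_mult_right)
    qed
    also have "\<dots> = DD a (\<lambda>b m. DD m (\<lambda>n y. DD n (\<lambda>c x. ap A c * A x) * (ap B b * B y)))"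
      by (simp only: DD_coassoc[of a] DD_coassoc[symmetric, of _ "\<lambda>c x y. ap A c * A x * (ap B _ * B y)"] DD_mult_left)
    also have "\<dots> = DD a (\<lambda>b m. ap B b * B m)"
      using antihom_convm_ap(2)[OF aA] by (simp add: convm_def[abs_def] fun_eq_iff cone_def DD_counit_left)
    also have "\<dots> = cone a"
      using antihom_convm_ap(2)[OF aB] by (simp add: convm_def[abs_def] fun_eq_iff cone_def)
    finally show "(K \<star> (A \<star> B)) a = cone a" .
  qed
  then have K: "K = ap (A \<star> B)"
    by (rule convm_inverse_unique) (intro antihom_convm_ap antihom_convm aA aB cAB)
  \<comment> \<open>The coefficient tensors of the two sides; equality for all \<open>F\<close> is
    equality of these.\<close>
  define c1 where "c1 = lin (\<lambda>b x. hdel H b (fst x) (snd x)) (hant H a)"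
  define c2 where "c2 = lin (\<lambda>x. ttens (hant H (snd x)) (hant H (fst x))) (\<lambda>x. hdel H a (fst x) (snd x))"
  have c1: "lc c1 G = lc (hant H a) (\<lambda>b. DD b (\<lambda>p q. G (p, q)))" for G :: "_ \<Rightarrow> ('t::finite, 'k) mat"
    by (simp add: c1_def lc_lin) (simp add: lc_pair DD_def)
  have c2: "lc c2 G = DD a (\<lambda>b c. lc (hant H c) (\<lambda>p. lc (hant H b) (\<lambda>q. G (p, q))))" for G :: "_ \<Rightarrow> ('t::finite, 'k) mat"
    by (simp add: c2_def lc_lin lc_ttens) (simp add: lc_pair[of "\<lambda>x. hdel H a (fst x) (snd x)"] DD_def)
  have "c1 = c2"
  proof (rule tp_faithful[of "\<lambda>_. Rm" "\<lambda>(x :: 'i \<times> 'i) z. if z then fst x else snd x"])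
    have om: "tp (\<lambda>z. Rm (if z then fst x else snd x)) = A (fst x) * B (snd x)" for x
      unfolding A_def B_def emb_def tp_mult by (intro arg_cong[of _ _ tp] ext) auto
    have "lc c1 (\<lambda>x. A (fst x) * B (snd x)) = ap (A \<star> B) a"
      by (simp add: c1 ap_def convm_def[abs_def])
    also have "\<dots> = lc c2 (\<lambda>x. A (fst x) * B (snd x))"
      by (simp add: K[symmetric] K_def c2 ap_def lc_mult)
    finally show "lc c1 (\<lambda>x. tp (\<lambda>z. Rm (if z then fst x else snd x))) = lc c2 (\<lambda>x. tp (\<lambda>z. Rm (if z then fst x else snd x)))"
      by (simp only: om)
  qed (auto simp: dual_Rm inj_def fun_eq_iff prod_eq_iff split: if_splits)
  then show ?thesis
    using c1[of "\<lambda>x. F (fst x) (snd x)"] c2[of "\<lambda>x. F (fst x) (snd x)"] by simp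
qed

lemma ap_convm: "ap (A \<star> B) a = DD a (\<lambda>b c. ap A c * ap B b)"
  by (simp add: ap_def convm_def[abs_def] lc_ant_DD lc_mult)

text \<open>Since \<open><a (x) b, R>\<close> only sees the \<open>H*\<close>-part of \<open>a\<close> (\<open>kapV\<close>) and the \<open>H\<close>-part of \<open>b\<close> (\<open>pieV\<close>), the
  right-hand sides of (R1) and (R3) split into \<open>Pop\<close>, which extracts an element of \<open>H\<close> from the second argument,
  and \<open>Cop1\<close>, which pairs the first argument with that element.\<close>

definition pieV :: "('i \<times> 'i \<Rightarrow> 'k) \<Rightarrow> 'i \<Rightarrow> 'k" where
  "pieV v q = (\<Sum>d\<in>UNIV. v (q, d) * heta H d)"

definition kapV :: "('i \<times> 'i \<Rightarrow> 'k) \<Rightarrow> 'i \<Rightarrow> 'k" where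
  "kapV v q = (\<Sum>a\<in>UNIV. v (a, q) * hceps H a)"

definition selG :: "bool \<Rightarrow> ('i \<times> 'i) \<times> ('i \<times> 'i) \<Rightarrow> 'i \<times> 'i" where
  "selG inn x = (if inn then snd x else fst x)"

lemma lc_pieV: "lc (pieV v) F = lc v (\<lambda>s. heta H (snd s) \<bullet> F (fst s))"
  by (simp add: lc_pair[of v]) (simp add: lc_def pieV_def sum_scl)

lemma lc_kapV: "lc (kapV v) F = lc v (\<lambda>s. hceps H (fst s) \<bullet> F (snd s))"
  by (simp add: lc_pair[of v], subst sum.swap) (simp add: lc_def kapV_def sum_scl)

lemma Rpair_eq: "Rpair H u v = (\<Sum>q\<in>UNIV. kapV u q * pieV v q)"
proof -
  have "Rpair H u v = (\<Sum>a\<in>UNIV. \<Sum>b\<in>UNIV. \<Sum>c\<in>UNIV. \<Sum>d\<in>UNIV. u (a, b) * v (c, d) * hceps H a * heta H d * kd b c)"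
    by (simp add: Rpair_def sum_UNIV_pair)
  also have "\<dots> = (\<Sum>a\<in>UNIV. \<Sum>b\<in>UNIV. \<Sum>d\<in>UNIV. \<Sum>c\<in>UNIV. (u (a, b) * hceps H a * (v (c, d) * heta H d)) * kd b c)"
    unfolding sum.cartesian_product
    by (rule sum.reindex_bij_witness[of _ "\<lambda>(a,b,d,c). (a,b,c,d)" "\<lambda>(a,b,c,d). (a,b,d,c)"]) auto
  also have "\<dots> = (\<Sum>a\<in>UNIV. \<Sum>b\<in>UNIV. \<Sum>d\<in>UNIV. u (a, b) * hceps H a * (v (b, d) * heta H d))"
    by (simp only: sum_mult_kd)
  also have "\<dots> = (\<Sum>q\<in>UNIV. kapV u q * pieV v q)"
    by (subst sum.swap) (simp add: kapV_def pieV_def sum_product)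
  finally show ?thesis .
qed

definition popv :: "bool \<Rightarrow> 'i \<times> 'i \<Rightarrow> 'i \<times> ('i \<times> 'i) \<Rightarrow> 'k" where
  "popv inn s = lin (\<lambda>x. ttens (pieV (split_R H inn (fst x) (snd x))) (bv (selG inn x))) (DeltaD H (bv s))"

definition Pop :: "bool \<Rightarrow> 'i \<times> 'i \<Rightarrow> ('i \<Rightarrow> 'i \<times> 'i \<Rightarrow> ('s::finite, 'k) mat) \<Rightarrow> ('s, 'k) mat" where
  "Pop inn s F = lc (popv inn s) (\<lambda>y. F (fst y) (snd y))"

definition Cop1 :: "bool \<Rightarrow> 'i \<Rightarrow> 'i \<times> 'i \<Rightarrow> ('i \<times> 'i \<Rightarrow> ('s::finite, 'k) mat) \<Rightarrow> ('s, 'k) mat" where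
  "Cop1 inn q s G = lc (DeltaD H (bv s)) (\<lambda>x. kapV (split_R H inn (fst x) (snd x)) q \<bullet> G (selG inn x))"

lemma Pop_eq: "Pop inn s F = lc (DeltaD H (bv s)) (\<lambda>x. lc (pieV (split_R H inn (fst x) (snd x))) (\<lambda>q. F q (selG inn x)))"
  by (simp add: Pop_def popv_def lc_lin lc_ttens)

lemma Pop_True: "Pop True (z, d) F = DD z (\<lambda>z1 z2. F z1 (z2, d))"
  using DeltaD_eta_left[of z d F] by (simp add: Pop_eq lc_pieV split_R_def selG_def)

lemma lc_pieV_SD: "lc (pieV (SD H v)) F = lc v (\<lambda>s. heta H (snd s) \<bullet> ap F (fst s))"
  by (simp only: lc_pieV SD_eta)

lemma lc_kd_select: "lc x (\<lambda>q'. kd q' q \<bullet> X) = x q \<bullet> X"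
  unfolding lc_def by (simp only: scl_simps(4) mult.commute[of _ "kd _ _"]) (simp only: scl_simps(4)[symmetric] sum_kd_scl)

lemma Pop_False: "Pop False (z, d) F = (\<Sum>i\<in>UNIV. \<Sum>j\<in>UNIV. DD z (\<lambda>z1 z2. lc (dm3 i d j) (\<lambda>w.
     lc (conj_vec j z2 i) (ap (\<lambda>q. F q (z1, w))))))"
  using DeltaD_eta_right[of z d "\<lambda>t. ap (\<lambda>q. F q t)"]
  by (simp add: Pop_eq lc_pieV_SD split_R_def selG_def)

lemma lc_hant_ceps: "lc (hant H j) (\<lambda>c. hceps H c \<bullet> X) = hceps H j \<bullet> X"
  using ceps_ap[of X j] by (simp add: ap_def)

lemma lc_hm_ceps: "lc (hm H x y) (\<lambda>q. hceps H q \<bullet> X) = lc x (\<lambda>b. lc y (\<lambda>c. hceps H b \<bullet> hceps H c \<bullet> X))"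
  by (simp add: lc_hm lc_mu_ceps)

lemma dS_eps: "dS H (hceps H) = hceps H"
proof
  fix b
  have "lc (hant H b) (\<lambda>c. hceps H c \<bullet> (1 :: (unit, 'k) mat)) = hceps H b \<bullet> 1"
    by (rule lc_hant_ceps)
  then have "ent (lc (hant H b) (\<lambda>c. hceps H c \<bullet> (1 :: (unit, 'k) mat))) () () = hceps H b"
    by (simp add: kd_def)
  then show "dS H (hceps H) b = hceps H b"
    by (simp add: dS_def ent_lc kd_def mult.commute)
qed

lemma SD_eps: "lc (SD H u) (\<lambda>s. hceps H (fst s) \<bullet> F (snd s)) = lc u (\<lambda>s. hceps H (fst s) \<bullet> lc (dS H (bv (snd s))) F)"
proof -
  have 1: "lc (hm H (hm H (bv i) (hS H (bv a))) (bv j)) (\<lambda>q. hceps H q \<bullet> X) = hceps H i \<bullet> hceps H j \<bullet> hceps H a \<bullet> X"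
    for i j a and X :: "('s::finite, 'k) mat"
    by (simp only: lc_hm_ceps lc_bv lc_scl lc_hS lc_hant_ceps) (simp add: ac_simps)
  have 2: "(\<Sum>i\<in>UNIV. \<Sum>j\<in>UNIV. hceps H i \<bullet> hceps H j \<bullet> hceps H a \<bullet> lc (dm H (dm H (dS H (bv j)) (dS H (bv b))) (bv i)) F)
     = hceps H a \<bullet> lc (dS H (bv b)) F" for a b
  proof -
    have "(\<Sum>i\<in>UNIV. \<Sum>j\<in>UNIV. hceps H i \<bullet> hceps H j \<bullet> hceps H a \<bullet> lc (dm H (dm H (dS H (bv j)) (dS H (bv b))) (bv i)) F)
      = hceps H a \<bullet> lc (hceps H) (\<lambda>i. lc (hceps H) (\<lambda>j. lc (dm H (dm H (dS H (bv j)) (dS H (bv b))) (bv i)) F))"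
      by (simp add: lc_def[of "hceps H"] scl_sum ac_simps)
    also have "lc (hceps H) (\<lambda>i. lc (hceps H) (\<lambda>j. lc (dm H (dm H (dS H (bv j)) (dS H (bv b))) (bv i)) F))
       = lc (hceps H) (\<lambda>i. lc (dm H (dm H (dS H (hceps H)) (dS H (bv b))) (bv i)) F)"
      by (simp add: lc_dm lc_dS)
    also have "\<dots> = lc (dS H (bv b)) F"
      by (simp only: lc_dm_right dS_eps dm_eps)
    finally show ?thesis .
  qed
  have "lc (SD H u) (\<lambda>s. hceps H (fst s) \<bullet> F (snd s)) = lc u (\<lambda>s. \<Sum>i\<in>UNIV. \<Sum>j\<in>UNIV.
      hceps H i \<bullet> hceps H j \<bullet> hceps H (fst s) \<bullet> lc (dm H (dm H (dS H (bv j)) (dS H (bv (snd s)))) (bv i)) F)"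
    unfolding SD_def lc_lin lc_vsum split_def sum_UNIV_pair fst_conv snd_conv lc_tens
    unfolding lc_scl 1 ..
  then show ?thesis by (simp only: 2)
qed

lemma kapV_scl: "kapV v q \<bullet> X = lc v (\<lambda>s. hceps H (fst s) \<bullet> kd (snd s) q \<bullet> X)"
proof -
  have "kapV v q \<bullet> X = lc (kapV v) (\<lambda>q'. kd q' q \<bullet> X)"
    by (simp only: lc_kd_select)
  then show ?thesis by (simp only: lc_kapV)
qed

lemma Cop1_False:
  fixes G :: "'i \<times> 'i \<Rightarrow> ('s::finite, 'k) mat"
  shows "Cop1 False q (a, g) G = Dmu g (\<lambda>b1 b2. hant H q b2 \<bullet> G (a, b1))"
proof -
  have "lc (dS H (bv b)) (\<lambda>q'. kd q' q \<bullet> X) = hant H q b \<bullet> X" for b and X :: "('s, 'k) mat"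
    by (simp only: lc_kd_select) (simp add: dS_def)
  then have "Cop1 False q (a, g) G = lc (DeltaD H (bv (a, g))) (\<lambda>x. hceps H (fst (snd x)) \<bullet> hant H q (snd (snd x)) \<bullet> G (fst x))"
    by (simp only: Cop1_def kapV_scl split_R_def selG_def if_False SD_eps[where F = "\<lambda>q'. kd q' q \<bullet> _"] lc_bv)
  also have "\<dots> = Dmu g (\<lambda>b1 b2. hant H q b2 \<bullet> G (a, b1))"
    by (rule DeltaD_eps_right)
  finally show ?thesis .
qed

text \<open>Evaluating \<open>alpha^i beta alpha^j\<close> at \<open>w_(1)\<close> comultiplies
  \<open>w_(1)\<close> twice: the outer legs take the place of the basis elements x_i and x_j, and
  the middle leg is paired with \<open>beta\<close>, so both basis sums disappear.\<close>

lemma DD_Cop1_True: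
  fixes G :: "'i \<Rightarrow> 'i \<times> 'i \<Rightarrow> ('s::finite, 'k) mat"
  shows "DD w (\<lambda>q w2. Cop1 True q (a, g) (G w2)) = Dmu g (\<lambda>b1 b2. DD w (\<lambda>i d. DD d (\<lambda>c m. kd c b1 \<bullet>
     DD m (\<lambda>j w2. lc (conj_vec j a i) (\<lambda>r. G w2 (r, b2))))))"
proof -
  have 1: "Cop1 True q (a, g) K = (\<Sum>i\<in>UNIV. \<Sum>j\<in>UNIV. Dmu g (\<lambda>b1 b2. dm3 i b1 j q \<bullet>
       lc (conj_vec j a i) (\<lambda>r. K (r, b2))))" for q K
  proof -
    show ?thesis
      by (simp only: Cop1_def kapV_scl split_R_def selG_def if_True lc_bv DeltaD_eps_left[where G = "\<lambda>q' t. kd q' q \<bullet> K t"] lc_scl lc_kd_select)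
  qed
  have 2: "(\<Sum>i\<in>UNIV. \<Sum>j\<in>UNIV. dm3 i b j q \<bullet> Y i j) = DD q (\<lambda>r j. DD r (\<lambda>i c. kd c b \<bullet> Y i j))"
    for b q and Y :: "'i \<Rightarrow> 'i \<Rightarrow> ('s, 'k) mat"
  proof -
    have dm2: "dm H (bv i) (bv c) r = hdel H r i c" for i c r
      by (simp add: dm_def mult.assoc flip: sum_distrib_left)
    have "dm H x (bv j) q = (\<Sum>r\<in>UNIV. x r * hdel H q r j)" for x j
      by (simp add: dm_def mult.assoc flip: sum_distrib_left)
    then have dm3: "dm3 i b j q = (\<Sum>r\<in>UNIV. hdel H q r j * hdel H r i b)" for i j
      by (simp add: dm2 mult.commute)
    have "DD q (\<lambda>r j. DD r (\<lambda>i c. kd c b \<bullet> Y i j)) = (\<Sum>r\<in>UNIV. \<Sum>j\<in>UNIV. \<Sum>i\<in>UNIV. \<Sum>c\<in>UNIV. kd c b \<bullet> (hdel H q r j * hdel H r i c) \<bullet> Y i j)"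
      by (simp add: DD_def scl_sum ac_simps)
    also have "\<dots> = (\<Sum>r\<in>UNIV. \<Sum>j\<in>UNIV. \<Sum>i\<in>UNIV. (hdel H q r j * hdel H r i b) \<bullet> Y i j)"
      by (simp only: sum_kd_scl)
    also have "\<dots> = (\<Sum>i\<in>UNIV. \<Sum>j\<in>UNIV. \<Sum>r\<in>UNIV. (hdel H q r j * hdel H r i b) \<bullet> Y i j)"
      unfolding sum.cartesian_product
      by (rule sum.reindex_bij_witness[of _ "\<lambda>(i,j,r). (r,j,i)" "\<lambda>(r,j,i). (i,j,r)"]) auto
    finally show ?thesis by (simp add: dm3 sum_scl)
  qed
  have "DD w (\<lambda>q w2. Cop1 True q (a, g) (G w2)) = Dmu g (\<lambda>b1 b2. DD w (\<lambda>q w2. DD q (\<lambda>r j. DD r (\<lambda>i c. kd c b1 \<bullet>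
       lc (conj_vec j a i) (\<lambda>r. G w2 (r, b2))))))"
    by (simp only: 1 Dmu_sum[symmetric] 2) (simp only: Dmu_DD)
  also have "\<dots> = Dmu g (\<lambda>b1 b2. DD w (\<lambda>i d. DD d (\<lambda>c m. kd c b1 \<bullet>
     DD m (\<lambda>j w2. lc (conj_vec j a i) (\<lambda>r. G w2 (r, b2))))))"
  proof -
    have "DD w (\<lambda>q w2. DD q (\<lambda>r j. DD r (\<lambda>i c. X i c j w2))) = DD w (\<lambda>i d. DD d (\<lambda>c m. DD m (\<lambda>j w2. X i c j w2)))"
      for X :: "'i \<Rightarrow> 'i \<Rightarrow> 'i \<Rightarrow> 'i \<Rightarrow> ('s, 'k) mat"
    proof -
      have "DD w (\<lambda>q w2. DD q (\<lambda>r j. DD r (\<lambda>i c. X i c j w2))) = DD w (\<lambda>q w2. DD q (\<lambda>i n. DD n (\<lambda>c j. X i c j w2)))"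
        by (simp only: DD_coassoc[of _ "\<lambda>i c j. X i c j _"])
      also have "\<dots> = DD w (\<lambda>i d. DD d (\<lambda>n w2. DD n (\<lambda>c j. X i c j w2)))"
        by (rule DD_coassoc)
      also have "\<dots> = DD w (\<lambda>i d. DD d (\<lambda>c m. DD m (\<lambda>j w2. X i c j w2)))"
        by (simp only: DD_coassoc[of _ "\<lambda>c j w2. X _ c j w2"])
      finally show ?thesis .
    qed
    then show ?thesis by (simp only: DD_scl)
  qed
  finally show ?thesis .
qed

lemma Dmu_kd: "Dmu g (\<lambda>b1 b2. kd c b1 \<bullet> F b2) = (\<Sum>b2\<in>UNIV. hmu H c b2 g \<bullet> F b2)"
proof -
  have "Dmu g (\<lambda>b1 b2. kd c b1 \<bullet> F b2) = (\<Sum>b2\<in>UNIV. \<Sum>b1\<in>UNIV. kd c b1 \<bullet> hmu H b1 b2 g \<bullet> F b2)"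
    unfolding Dmu_def by (subst sum.swap) (simp add: mult.commute)
  then show ?thesis by (simp only: sum_kd_scl)
qed

text \<open>At an outgoing end the extraction contains the basis sums of \<open>Delta_D\<close>; on
  products of representations they become a conjugation. \<open>Pop_coassoc\<close> and
  \<open>Hol_X_out\<close> both rest on this.\<close>

lemma Pop_False_prod:
  assumes D: "dhom D" and X: "hom X" and XC: "\<And>x y. cm (X x) (C y)" and XD: "\<And>x y. cm (X x) (D y)"
  shows "Pop False (z, d) (\<lambda>q t. X q * (C (fst t) * D (snd t))) =
    DD z (\<lambda>z1 z2. C z1 * (can D (ap X) * (D d * ap X z2) * can D X))"
proof -
  have aX: "ap (\<lambda>q. X q * (C p * D w)) = (\<lambda>r. C p * (D w * ap X r))" for p w
  proof
    fix r
    have "X q * (C p * D w) = C p * (D w * X q)" for q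
      using XC[of q p] XD[of q w] unfolding cm_def by (simp flip: mult.assoc) (simp add: mult.assoc)
    then show "ap (\<lambda>q. X q * (C p * D w)) r = C p * (D w * ap X r)" by (simp add: ap_def lc_mult_right)
  qed
  have "Pop False (z, d) (\<lambda>q t. X q * (C (fst t) * D (snd t))) = DD z (\<lambda>z1 z2. C z1 * (\<Sum>i\<in>UNIV. \<Sum>j\<in>UNIV.
      lc (dm3 i d j) D * lc (conj_vec j z2 i) (ap X)))"
    unfolding Pop_False fst_conv snd_conv
    by (simp only: aX DD_sum[symmetric] lc_mult sum_distrib_left lc_mult_right[of "C _"])
  then show ?thesis
    by (simp only: sum_can_conj[OF D antihom_ap[OF X] cm_ap[OF XD]] ap_ap)
qed

text \<open>Both sides are linear combinations of values of \<open>F\<close>, so it suffices to compare them for the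
  universal family of products of commuting representations.\<close>

lemma Pop_coassoc:
  "Pop inn s (\<lambda>q t. Pop inn t (\<lambda>q' t'. F q q' t')) = Pop inn s (\<lambda>q t. DD q (\<lambda>q1 q2. F q1 q2 t))"
proof (cases inn)
  case True
  then show ?thesis
    by (cases s) (simp add: Pop_True DD_coassoc)
next
  case False
  define A :: "'i \<Rightarrow> (bool \<times> bool \<Rightarrow> 'i, 'k) mat" where "A = (\<lambda>p. emb (True, True) (Lm p))"
  define B :: "'i \<Rightarrow> (bool \<times> bool \<Rightarrow> 'i, 'k) mat" where "B = (\<lambda>p. emb (True, False) (Lm p))"
  define C :: "'i \<Rightarrow> (bool \<times> bool \<Rightarrow> 'i, 'k) mat" where "C = (\<lambda>p. emb (False, True) (Lm p))"
  define D :: "'i \<Rightarrow> (bool \<times> bool \<Rightarrow> 'i, 'k) mat" where "D = (\<lambda>p. emb (False, False) (Tm p))"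
  have hA: "hom A" and hB: "hom B" and dD: "dhom D"
    by (simp_all add: A_def B_def D_def hom_emb hom_Lm dhom_emb dhom_Tm)
  have cs: "cm (A x) (B y)" "cm (A x) (C y)" "cm (A x) (D y)" "cm (B x) (C y)" "cm (B x) (D y)" "cm (C x) (D y)"
    "cm (B x) (A y)" "cm (C x) (A y)" "cm (D x) (A y)" "cm (C x) (B y)" "cm (D x) (B y)" "cm (D x) (C y)" for x y
    by (simp_all add: A_def B_def C_def D_def cm_emb)
  define Pf where "Pf X z d = DD z (\<lambda>z1 z2. C z1 * (can D (ap X) * (D d * ap X z2) * can D X))" for X z d
  have Pf: "Pop False (z, d) (\<lambda>q t. X q * (C (fst t) * D (snd t))) = Pf X z d"
    if "hom X" "\<And>x y. cm (X x) (C y)" "\<And>x y. cm (X x) (D y)" for X z d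
    unfolding Pf_def by (rule Pop_False_prod[OF dD that])
  \<comment> \<open>The right-hand side of the claim, tested on \<open>A\<close> and
    \<open>B\<close>, is a single extraction evaluated in the algebra map
    \<open>A \<star> B\<close>.\<close>
  define X where "X = A \<star> B"
  have hX: "hom X" "\<And>x y. cm (X x) (C y)" "\<And>x y. cm (X x) (D y)"
    unfolding X_def by (rule hom_convm[OF hA hB], use cs(1) in \<open>simp add: cm_def\<close>) (intro cm_convm cs)+
  let ?om = "\<lambda>y. A (fst y) * (B (fst (snd y)) * (C (fst (snd (snd y))) * D (snd (snd (snd y)))))"
  define c1 where "c1 = lin (\<lambda>y. lin (\<lambda>y'. ttens (bv (fst y)) (ttens (bv (fst y')) (bv (snd y')))) (popv inn (snd y))) (popv inn s)"
  define c2 where "c2 = lin (\<lambda>y. lin (\<lambda>x. ttens (bv (fst x)) (ttens (bv (snd x)) (bv (snd y)))) (\<lambda>x. hdel H (fst y) (fst x) (snd x))) (popv inn s)"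
  have c1: "lc c1 G = Pop inn s (\<lambda>q t. Pop inn t (\<lambda>q' t'. G (q, q', t')))" for G :: "_ \<Rightarrow> ('t::finite, 'k) mat"
    by (simp add: c1_def Pop_def lc_lin lc_ttens)
  have c2: "lc c2 G = Pop inn s (\<lambda>q t. DD q (\<lambda>q1 q2. G (q1, q2, t)))" for G :: "_ \<Rightarrow> ('t::finite, 'k) mat"
    by (simp add: c2_def Pop_def lc_lin lc_ttens) (simp add: lc_pair[of "\<lambda>x. hdel H _ (fst x) (snd x)"] DD_def)
  have main: "lc c1 ?om = lc c2 ?om"
  proof -
    obtain z d where s: "s = (z, d)" by fastforce
    define UB where "UB = can D B"
    define UB' where "UB' = can D (ap B)"
    define UA where "UA = can D A"
    define UA' where "UA' = can D (ap A)"
    have UB: "UB * UB' = 1" unfolding UB_def UB'_def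
      by (auto intro!: can_inverse dD cs cm_ap hom_convm_ap hB)
    have UB': "UB' * UB = 1" unfolding UB_def UB'_def
      by (auto intro!: can_inverse dD cs cm_ap hom_convm_ap hB)
    have UB3: "UB * (UB' * Z) = Z" for Z
      using UB by (simp flip: mult.assoc)
    have cAB: "cm (A x) UB" "cm (A x) UB'" "cm (ap A x) UB" "cm (ap A x) UB'" for x
      unfolding UB_def UB'_def by (auto intro!: cm_sym[OF cm_can] cs cm_ap cm_sym[OF cm_ap])
    have cBA: "cm (ap B x) UA" for x
      unfolding UA_def by (auto intro!: cm_sym[OF cm_can] cm_sym[OF cm_ap] cs)
    \<comment> \<open>The inner extraction conjugates \<open>D\<close> by the canonical element of
      \<open>B\<close>. The conjugate is again a representation of the dual, so the outer extraction
      can be evaluated by \<open>sum_can_conj\<close> with \<open>D'\<close> in place of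
      \<open>D\<close>.\<close>
    define D' where "D' w = UB' * D w * UB" for w
    have dD': "dhom D'"
    proof -
      have "D' p * D' q = lc (\<lambda>r. hdel H r p q) D'" for p q
      proof -
        have "D' p * D' q = UB' * (D p * D q) * UB"
          by (simp add: D'_def mult.assoc UB3)
        then show ?thesis by (simp add: dhom_mult[OF dD] D'_def[abs_def] lc_mult_left lc_mult_right)
      qed
      moreover have "lc (hceps H) D' = 1"
      proof -
        have "lc (hceps H) D' = UB' * lc (hceps H) D * UB"
          by (simp add: D'_def[abs_def] lc_mult_left lc_mult_right)
        then show ?thesis using dD UB' by (simp add: dhom_def)
      qed
      ultimately show ?thesis by (simp add: dhom_def)
    qed
    have cAD': "cm (A x) (D' y)" "cm (ap A x) (D' y)" for x y
      unfolding D'_def by (intro cm_sym[OF cm_mult] cm_mult cm_sym[OF cAB(1)] cm_sym[OF cAB(2)] cm_sym[OF cAB(3)] cm_sym[OF cAB(4)] cs cm_sym[OF cm_ap])+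
    define B' where "B' y = UB' * ap B y * UB" for y
    have canD': "can D' A = UB' * UA * UB" "can D' (ap A) = UB' * UA' * UB"
    proof -
      have "D' i * A i = UB' * (D i * A i) * UB" "D' i * ap A i = UB' * (D i * ap A i) * UB" for i
        using cAB[of i] by (simp_all add: D'_def mult.assoc cm_def)
      then show "can D' A = UB' * UA * UB" "can D' (ap A) = UB' * UA' * UB"
        by (simp_all add: can_def UA_def UA'_def sum_distrib_left sum_distrib_right)
    qed
    have "lc c1 ?om = Pop False (z, d) (\<lambda>q t. A q * Pf B (fst t) (snd t))"
    proof -
      have "Pop False t (\<lambda>q' t'. A q * (B q' * (C (fst t') * D (snd t')))) = A q * Pf B (fst t) (snd t)" for q t
        unfolding Pf[OF hB cs(4) cs(5), symmetric] by (simp add: Pop_def lc_mult_right)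
      then show ?thesis using False by (simp add: c1 s)
    qed
    also have "\<dots> = DD z (\<lambda>z1 z2. DD z1 (\<lambda>y1 y2. C y1 * ((\<Sum>i\<in>UNIV. \<Sum>j\<in>UNIV.
        lc (dm3 i d j) D' * lc (conj_vec j z2 i) (ap A)) * B' y2)))"
    proof -
      have "A q * Pf B p w = DD p (\<lambda>y1 y2. C y1 * (D' w * A q * B' y2))" for q p w
      proof -
        have "A q * (C y1 * (UB' * (D w * ap B y2) * UB)) = C y1 * (D' w * A q * B' y2)" for y1 y2
        proof -
          have "A q * (C y1 * (UB' * (D w * ap B y2) * UB)) = C y1 * (A q * (D' w * B' y2))"
            using cs(2)[of q y1] by (simp add: D'_def B'_def mult.assoc UB3 cm_def) (simp add: cm_def flip: mult.assoc)
          moreover have "A q * (D' w * B' y2) = D' w * (A q * B' y2)"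
            using cAD'(1)[of q w] by (simp add: cm_def flip: mult.assoc)
          ultimately show ?thesis by (simp add: mult.assoc)
        qed
        then show ?thesis by (simp add: Pf_def UB_def[symmetric] UB'_def[symmetric] DD_mult_right)
      qed
      then have aP: "ap (\<lambda>q. A q * Pf B p w) = (\<lambda>r. DD p (\<lambda>y1 y2. C y1 * (D' w * ap A r * B' y2)))" for p w
        by (simp add: fun_eq_iff ap_def DD_lc[symmetric] lc_mult_left lc_mult_right)
      then show ?thesis
        unfolding Pop_False fst_conv snd_conv
        by (simp only: aP DD_sum[symmetric] DD_lc[symmetric] lc_mult sum_distrib_left sum_distrib_right
            lc_mult_right[of "C _"] lc_mult_left[of _ _ "B' _"])
    qed
    also have "\<dots> = DD z (\<lambda>z1 z2. DD z1 (\<lambda>y1 y2. C y1 * (UB' * UA' * (D d * ap A z2) * (UA * ap B y2) * UB)))"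
    proof -
      have UBA: "UB * (ap A a * Z) = ap A a * (UB * Z)" for a Z
        using cAB(3)[of a] by (simp add: cm_def flip: mult.assoc)
      have "can D' (ap A) * (D' d * ap A z2) * can D' A * B' y2 = UB' * UA' * (D d * ap A z2) * (UA * ap B y2) * UB" for z2 y2
        by (simp add: canD' B'_def D'_def mult.assoc UB3 UBA)
      then show ?thesis
        by (simp only: sum_can_conj[OF dD' antihom_ap[OF hA] cAD'(2)] ap_ap)
    qed
    also have "\<dots> = DD z (\<lambda>z1 m. DD m (\<lambda>y2 z2. C z1 * (UB' * UA' * (D d * (ap A z2 * ap B y2)) * (UA * UB))))"
    proof -
      have "UA * ap B y = ap B y * UA" for y using cBA[of y] by (simp add: cm_def)
      then show ?thesis by (simp add: DD_coassoc mult.assoc)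
    qed
    also have "\<dots> = Pf X z d"
    proof -
      have "can D X = UA * UB" unfolding X_def UA_def UB_def
        using cs(3) by (intro can_convm dD) (simp add: cm_def)
      \<comment> \<open>As in \<open>W_minus_plus\<close>, the value is forced by uniqueness of the
        inverse.\<close>
      moreover have "can D (ap X) = UB' * UA'"
      proof -
        have 1: "can D (ap X) * can D X = 1"
          by (auto intro!: can_inverse dD hX cm_ap hom_convm_ap)
        have "UA * UA' = 1" unfolding UA_def UA'_def
          by (auto intro!: can_inverse dD cs cm_ap hom_convm_ap hA)
        then have "UA * (UA' * Z) = Z" for Z by (simp flip: mult.assoc)
        then have 2: "can D X * (UB' * UA') = 1"
          using \<open>can D X = UA * UB\<close> \<open>UA * UA' = 1\<close> by (simp add: mult.assoc UB3)
        have "can D (ap X) = (can D (ap X) * can D X) * (UB' * UA')"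
          by (simp only: mult.assoc 2 mult_1_right)
        then show ?thesis by (simp only: 1 mult_1_left)
      qed
      ultimately show ?thesis
        by (simp add: Pf_def X_def ap_convm DD_mult_left DD_mult_right mult.assoc)
    qed
    also have "\<dots> = lc c2 ?om"
      using False unfolding c2 s Pf[OF hX, symmetric] by (simp add: X_def convm_def DD_mult_left mult.assoc)
    finally show ?thesis .
  qed
  have "c1 = c2"
  proof (rule tp_faithful[of "\<lambda>z. if z = (False, False) then Tm else Lm"
      "\<lambda>(y :: 'i \<times> 'i \<times> 'i \<times> 'i) z. if fst z then (if snd z then fst y else fst (snd y)) else (if snd z then fst (snd (snd y)) else snd (snd (snd y)))"])
    let ?enc = "\<lambda>(y :: 'i \<times> 'i \<times> 'i \<times> 'i) z. if fst z then (if snd z then fst y else fst (snd y)) else (if snd z then fst (snd (snd y)) else snd (snd (snd y)))"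
    show "dual_family (if z = (False, False) then Tm else Lm)" for z :: "bool \<times> bool"
      by (simp add: dual_Lm dual_Tm)
    show "inj ?enc"
    proof (rule injI)
      fix x y assume "?enc x = ?enc y"
      from fun_cong[OF this, of "(True, True)"] fun_cong[OF this, of "(True, False)"]
        fun_cong[OF this, of "(False, True)"] fun_cong[OF this, of "(False, False)"]
      show "x = y" by (simp add: prod_eq_iff)
    qed
    have "?om y = tp (\<lambda>z. (if z = (False, False) then Tm else Lm) (?enc y z))" for y
      unfolding A_def B_def C_def D_def emb_def tp_mult by (intro arg_cong[of _ _ tp] ext) auto
    then show "lc c1 (\<lambda>y. tp (\<lambda>z. (if z = (False, False) then Tm else Lm) (?enc y z))) = lc c2 (\<lambda>y. tp (\<lambda>z. (if z = (False, False) then Tm else Lm) (?enc y z)))"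
      using main by simp
  qed
  then show ?thesis
    using c1[of "\<lambda>y. F (fst y) (fst (snd y)) (snd (snd y))"] c2[of "\<lambda>y. F (fst y) (fst (snd y)) (snd (snd y))"] by simp
qed

end

context edge_ends
begin

section \<open>The relations for a single edge\<close>

text \<open>The reversed \<open>H\<close>-multiplication of \<open>D(H)^*\<close> puts
  \<open>K z2\<close> next to the antipode leg from the comultiplication, where the flipped antipode
  identity removes both. What remains is the commutation relation \<open>T_K\<close>, conjugated by
  \<open>V\<close>.\<close>

lemma rel1_basis: "Pop True t (\<lambda>q t'. Cop1 True q s (\<lambda>r. lc (dmul H (bv r) (bv t')) Hol)) = Hol s * Hol t"
proof -
  obtain a g z d where st: "s = (a, g)" "t = (z, d)" by fastforce
  have G: "lc (dmul H (bv (r, b2)) (bv (z2, d))) Hol = V' * (K z2 * K r) * (T b2 * T d) * V" for r b2 z2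
  proof -
    have "lc (dmul H (bv (r, b2)) (bv (z2, d))) Hol = V' * (lc (hm H (bv z2) (bv r)) K * lc (dm H (bv b2) (bv d)) T) * V"
      by (simp add: lc_dmul Hol_def lc_mult lc_mult_left[of _ _ V] lc_mult_right[of V'] mult.assoc)
    then show ?thesis by (simp add: hom_hm hom_K dhom_dm dhom_T mult.assoc)
  qed
  have K3: "lc (conj_vec j a i) (\<lambda>r. V' * (K z2 * K r) * (T b2 * T d) * V)
      = V' * (K z2 * ap K j) * (K a * K i * (T b2 * T d * V))" for i j z2 b2
  proof -
    have "lc (conj_vec j a i) (\<lambda>r. V' * (K z2 * K r) * (T b2 * T d) * V)
      = V' * (K z2 * lc (conj_vec j a i) K) * (T b2 * T d) * V"
      by (simp only: lc_mult_left lc_mult_right[of "K _"] lc_mult_right[of V'])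
    then show ?thesis by (simp add: hom_hm hom_K lc_hS_ap mult.assoc)
  qed
  have flip: "DD m (\<lambda>j z2. K z2 * ap K j) = hceps H m \<bullet> 1" for m
    by (rule hom_flip(1)[OF hom_K])
  have "Pop True t (\<lambda>q t'. Cop1 True q s (\<lambda>r. lc (dmul H (bv r) (bv t')) Hol))
     = DD z (\<lambda>q z2. Cop1 True q (a, g) (\<lambda>r. lc (dmul H (bv r) (bv (z2, d))) Hol))"
    by (simp only: st Pop_True)
  also have "\<dots> = Dmu g (\<lambda>b1 b2. DD z (\<lambda>i e. DD e (\<lambda>c m. kd c b1 \<bullet>
      DD m (\<lambda>j z2. V' * (K z2 * ap K j) * (K a * K i * (T b2 * T d * V))))))"
    by (simp only: DD_Cop1_True G K3)
  also have "\<dots> = Dmu g (\<lambda>b1 b2. DD z (\<lambda>i e. DD e (\<lambda>c m. kd c b1 \<bullet>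
      (V' * DD m (\<lambda>j z2. K z2 * ap K j) * (K a * K i * (T b2 * T d * V))))))"
    by (simp only: DD_mult_left DD_mult_right)
  also have "\<dots> = Dmu g (\<lambda>b1 b2. DD z (\<lambda>i e. DD e (\<lambda>c m. hceps H m \<bullet> kd c b1 \<bullet>
      (V' * (K a * K i * (T b2 * T d * V))))))"
    by (simp add: flip mult.commute)
  also have "\<dots> = Dmu g (\<lambda>b1 b2. DD z (\<lambda>i c. kd c b1 \<bullet> (V' * (K a * K i * (T b2 * T d * V)))))"
    by (simp only: DD_counit_right)
  also have "\<dots> = DD z (\<lambda>i c. Dmu g (\<lambda>b1 b2. kd c b1 \<bullet> (V' * (K a * K i * (T b2 * T d * V)))))"
    by (simp only: Dmu_DD)
  also have "\<dots> = DD z (\<lambda>i c. \<Sum>b2\<in>UNIV. hmu H c b2 g \<bullet> (V' * (K a * K i * (T b2 * T d * V))))"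
    by (simp only: Dmu_kd)
  also have "\<dots> = V' * K a * (T g * K z) * (T d * V)"
    unfolding T_K DD_mult_left DD_mult_right sum_distrib_left sum_distrib_right by (simp add: mult.assoc)
  also have "\<dots> = Hol s * Hol t"
    by (simp add: Hol_def st V_cancel mult.assoc)
  finally show ?thesis .
qed

lemma Hol_unit: "lc (unitD H) Hol = 1"
proof -
  have "lc (unitD H) Hol = V' * (lc (heta H) K * lc (hceps H) T) * V"
    by (simp only: lc_unitD Hol_def lc_mult lc_mult_left[of _ _ V] lc_mult_right[of V'] mult.assoc fst_conv snd_conv)
  then show ?thesis using dhom_T by (simp add: hom_eta hom_K dhom_def V_inverse)
qed

text \<open>The exchange rule at the target vertex. \<open>K\<close> collects the ends there up to
  and including \<open>e\<close>, as they occur in the path of a larger edge; moving the holonomy of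
  \<open>e\<close> past it costs exactly the first half of the R-matrix pairing.\<close>

lemma star_in: "Hol s * K w = DD w (\<lambda>q w2. Cop1 True q s (\<lambda>t. K w2 * Hol t))"
proof -
  obtain a g where s: "s = (a, g)" by fastforce
  have cK: "Phi ss x * K y = K y * Phi ss x" and cT: "Phi ss x * T y = T y * Phi ss x" for x y
    using cm_K_ss[of y x] cm_ss(2)[of x y] by (simp_all add: cm_def)
  have cK': "Phi ss x * (K y * Z) = K y * (Phi ss x * Z)" and cT': "Phi ss x * (T y * Z) = T y * (Phi ss x * Z)" for x y Z
    using cK cT by (simp_all flip: mult.assoc)
  have cKa: "Phi ss x * (ap K y * Z) = ap K y * (Phi ss x * Z)" for x y Z
    using cm_ap[of K "Phi ss x" y] cm_K_ss by (simp add: cm_def flip: mult.assoc)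
  have flip: "DD m (\<lambda>j x. K x * ap K j) = hceps H m \<bullet> 1" for m
    by (rule hom_flip(1)[OF hom_K])
  have K3: "lc (conj_vec j a i) (\<lambda>r. K w2 * Hol (r, b2))
      = V' * DD w2 (\<lambda>x y. (K x * ap K j) * (K a * K i * (T b2 * (Phi ss y * V))))" for i j w2 b2
  proof -
    have "lc (conj_vec j a i) (\<lambda>r. K w2 * Hol (r, b2))
      = K w2 * V' * lc (conj_vec j a i) K * (T b2 * V)"
      by (simp add: Hol_def lc_mult_left lc_mult_right mult.assoc)
    also have "\<dots> = V' * ((K \<star> Phi ss) w2 * (ap K j * (K a * (K i * (T b2 * V)))))"
      by (simp add: hom_hm hom_K lc_hS_ap mult.assoc) (simp only: K_V' flip: mult.assoc)
    also have "\<dots> = V' * DD w2 (\<lambda>x y. (K x * ap K j) * (K a * K i * (T b2 * (Phi ss y * V))))"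
      by (simp add: convm_def DD_mult_left mult.assoc cK' cKa cT')
    finally show ?thesis .
  qed
  have "DD w (\<lambda>q w2. Cop1 True q s (\<lambda>t. K w2 * Hol t))
     = Dmu g (\<lambda>b1 b2. DD w (\<lambda>i d. DD d (\<lambda>c m. kd c b1 \<bullet> (V' *
       DD m (\<lambda>j w2. DD w2 (\<lambda>x y. (K x * ap K j) * (K a * K i * (T b2 * (Phi ss y * V)))))))))"
    by (simp only: s DD_Cop1_True K3 DD_mult_right[symmetric])
  also have "\<dots> = Dmu g (\<lambda>b1 b2. DD w (\<lambda>i d. DD d (\<lambda>c m. kd c b1 \<bullet> (V' *
       DD m (\<lambda>n y. DD n (\<lambda>j x. K x * ap K j) * (K a * K i * (T b2 * (Phi ss y * V))))))))"
    by (simp only: DD_mult_left DD_coassoc[symmetric, of _ "\<lambda>j x y. (K x * ap K j) * (K a * K _ * (T _ * (Phi ss y * V)))"])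
  also have "\<dots> = Dmu g (\<lambda>b1 b2. DD w (\<lambda>i d. DD d (\<lambda>c m. kd c b1 \<bullet> (V' * (K a * K i * (T b2 * (Phi ss m * V)))))))"
    by (simp add: flip DD_counit_left[where F = "\<lambda>y. K a * (K _ * (T _ * (Phi ss y * V)))"] mult.assoc)
  also have "\<dots> = DD w (\<lambda>i d. DD d (\<lambda>c m. \<Sum>b2\<in>UNIV. hmu H c b2 g \<bullet> (V' * (K a * K i * (T b2 * (Phi ss m * V))))))"
    by (simp only: Dmu_DD Dmu_kd)
  also have "\<dots> = DD w (\<lambda>x m. DD x (\<lambda>i c. \<Sum>b2\<in>UNIV. hmu H c b2 g \<bullet> (V' * (K a * K i * (T b2 * (Phi ss m * V))))))"
    by (rule DD_coassoc[symmetric])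
  also have "\<dots> = DD w (\<lambda>x m. V' * K a * (T g * K x) * (Phi ss m * V))"
    unfolding T_K DD_mult_left DD_mult_right sum_distrib_left sum_distrib_right by (simp add: mult.assoc)
  also have "\<dots> = V' * K a * T g * ((K \<star> Phi ss) w * V)"
    by (simp add: convm_def DD_mult_left DD_mult_right mult.assoc)
  also have "\<dots> = Hol s * K w"
    by (simp only: V_K[symmetric]) (simp add: s Hol_def mult.assoc)
  finally show ?thesis by simp
qed

definition "R a = emb e (Rm a)"

lemma ap_R: "ap R a = emb e (ap Rm a)"
  by (simp add: R_def[abs_def] ap_emb)

lemma antihom_R: "antihom R"
  by (simp add: R_def[abs_def] antihom_emb antihom_Rm)

lemma cm_R: "cm (Phi ss a) (R b)" "cm (Phi ts a) (R b)" "cm (L a) (R b)"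
  by (simp_all add: R_def L_def cm_Phi_emb ets ess) (simp add: cm_def emb_mult Lm_Rm)

lemma V_R: "V * R a = DD a (\<lambda>a1 a2. R a1 * V * Phi ss a2)"
  unfolding V_def by (rule can_R[OF hom_Phi[OF dist(2)] cm_R(1)]) (simp add: R_def T_def emb_Tm_Rm)

text \<open>Conjugation by \<open>V\<close> turns \<open>R\<close> into the convolution product of \<open>R\<close> with the conjugate of
  \<open>Phi ss\<close>; the formula for \<open>ap R\<close> follows by inverting both sides in the convolution algebra.\<close>

lemma V_ap_R: "V * (Phi ss \<star> ap R) a = ap R a * V"
proof -
  define cj where "cj F a = V * F a * V'" for F :: "'i \<Rightarrow> ('e \<Rightarrow> 'i, 'k) mat" and a
  have cj_conv: "cj F \<star> cj G = cj (F \<star> G)" for F G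
    by (simp add: fun_eq_iff cj_def convm_def DD_mult_left DD_mult_right mult.assoc V_cancel)
  have cj_one: "cj cone = cone"
    by (simp add: fun_eq_iff cj_def cone_def V_inverse)
  have cjR: "cj R = R \<star> cj (Phi ss)"
    by (simp add: fun_eq_iff cj_def V_R convm_def DD_mult_left mult.assoc)
  have "cj (Phi ss \<star> ap R) = ap R \<star> R \<star> (cj (Phi ss) \<star> cj (ap R))"
    by (simp add: cj_conv antihom_convm_ap antihom_R flip: convm_assoc)
  also have "\<dots> = ap R \<star> cj (R \<star> ap R)"
    by (simp only: cjR cj_conv[symmetric] convm_assoc)
  also have "\<dots> = ap R"
    by (simp add: antihom_convm_ap antihom_R cj_one)
  finally have "V * (Phi ss \<star> ap R) a * V' = ap R a"
    by (simp add: cj_def fun_eq_iff)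
  then have "V * (Phi ss \<star> ap R) a * V' * V = ap R a * V" by simp
  then show ?thesis by (simp add: mult.assoc V_inverse)
qed

text \<open>The commutation of \<open>T\<close> with right multiplications, precomposed with the
  antipode, which interchanges the two legs of the comultiplication.\<close>

lemma T_ap_R: "T g * ap R w = DD w (\<lambda>q w2. Dmu g (\<lambda>b1 b2. hant H q b2 \<bullet> (ap R w2 * T b1)))"
proof -
  have "T g * ap R w = lc (hant H w) (\<lambda>a. DD a (\<lambda>a1 a2. \<Sum>g1\<in>UNIV. hmu H g1 a2 g \<bullet> (R a1 * T g1)))"
    by (simp add: ap_def lc_mult_right T_def R_def emb_Tm_Rm)
  also have "\<dots> = DD w (\<lambda>b c. lc (hant H c) (\<lambda>p. lc (hant H b) (\<lambda>q. \<Sum>g1\<in>UNIV. hmu H g1 q g \<bullet> (R p * T g1))))"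
    by (rule lc_ant_DD)
  also have "\<dots> = DD w (\<lambda>q w2. Dmu g (\<lambda>b1 b2. hant H q b2 \<bullet> (ap R w2 * T b1)))"
  proof -
    have "lc (hant H c) (\<lambda>p. lc (hant H b) (\<lambda>q. \<Sum>g1\<in>UNIV. hmu H g1 q g \<bullet> (R p * T g1)))
       = Dmu g (\<lambda>b1 b2. hant H b b2 \<bullet> (ap R c * T b1))" for b c
    proof -
      have "lc (hant H c) (\<lambda>p. lc (hant H b) (\<lambda>q. \<Sum>g1\<in>UNIV. hmu H g1 q g \<bullet> (R p * T g1)))
        = lc (hant H b) (\<lambda>q. \<Sum>g1\<in>UNIV. hmu H g1 q g \<bullet> (ap R c * T g1))"
        by (simp only: lc_swap[of "hant H c"] lc_sum lc_scl ap_def lc_mult_left)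
      also have "\<dots> = Dmu g (\<lambda>b1 b2. hant H b b2 \<bullet> (ap R c * T b1))"
        by (simp only: lc_sum) (simp add: lc_def Dmu_def mult.commute)
      finally show ?thesis .
    qed
    then show ?thesis by simp
  qed
  finally show ?thesis .
qed

text \<open>The exchange rule at the starting vertex. Conjugation by \<open>V\<close> carries
  \<open>Phi ss \<star> ap R\<close> to \<open>ap R\<close>, which commutes with \<open>K\<close>,
  so only the exchange of \<open>T\<close> with \<open>ap R\<close> contributes.\<close>

lemma star_out: "Hol s * (Phi ss \<star> ap R) w = DD w (\<lambda>q w2. Cop1 False q s (\<lambda>t. (Phi ss \<star> ap R) w2 * Hol t))"
proof -
  obtain a g where s: "s = (a, g)" by fastforce
  have cKR: "K x * ap R y = ap R y * K x" for x y
  proof -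
    have "cm (K x) (R y)" for y
      unfolding K_def by (intro cm_convm cm_R)
    then show ?thesis using cm_ap[of R "K x" y] cm_sym by (simp add: cm_def)
  qed
  have A: "(Phi ss \<star> ap R) w2 * (V' * Z) = V' * (ap R w2 * Z)" for w2 Z
  proof -
    have "(Phi ss \<star> ap R) w2 * (V' * Z) = V' * (V * (Phi ss \<star> ap R) w2) * (V' * Z)"
      by (simp add: V_cancel mult.assoc)
    then show ?thesis unfolding V_ap_R by (simp add: V_cancel mult.assoc)
  qed
  have "DD w (\<lambda>q w2. Cop1 False q s (\<lambda>t. (Phi ss \<star> ap R) w2 * Hol t))
    = DD w (\<lambda>q w2. Dmu g (\<lambda>b1 b2. hant H q b2 \<bullet> (V' * K a * (ap R w2 * T b1) * V)))"
  proof -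
    have "(Phi ss \<star> ap R) w2 * Hol (a, b1) = V' * K a * (ap R w2 * T b1) * V" for w2 b1
    proof -
      have "(Phi ss \<star> ap R) w2 * Hol (a, b1) = V' * ((ap R w2 * K a) * (T b1 * V))"
        by (simp add: Hol_def mult.assoc A)
      then show ?thesis by (simp only: cKR[symmetric] mult.assoc)
    qed
    then show ?thesis by (simp only: s Cop1_False)
  qed
  also have "\<dots> = V' * K a * (T g * ap R w) * V"
    by (simp add: T_ap_R DD_mult_left DD_mult_right Dmu_mult_left Dmu_mult_right)
  also have "\<dots> = V' * K a * T g * (V * (Phi ss \<star> ap R) w)"
    by (simp only: V_ap_R mult.assoc)
  also have "\<dots> = Hol s * (Phi ss \<star> ap R) w"
    by (simp add: Hol_def s mult.assoc)
  finally show ?thesis by simp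
qed

end

section \<open>From exchange rules at one edge to relation (R3)\<close>

context hopf_coords
begin

lemma Cop1_mult_left: "Cop1 inn q s G * X = Cop1 inn q s (\<lambda>t. G t * X)"
  by (simp add: Cop1_def lc_mult_left)

lemma Cop1_DD: "Cop1 inn q s (\<lambda>t. DD a (\<lambda>b c. G b c t)) = DD a (\<lambda>b c. Cop1 inn q s (G b c))"
  by (simp add: Cop1_def DD_lc flip: DD_scl)

lemma Pop_mult_left: "Pop inn s F * X = Pop inn s (\<lambda>q t. F q t * X)"
  by (simp add: Pop_def lc_mult_left)

lemma Pop_mult_right: "X * Pop inn s F = Pop inn s (\<lambda>q t. X * F q t)"
  by (simp add: Pop_def lc_mult_right)

lemma Pop_Cop1: "Pop inn s (\<lambda>q t. Cop1 inn' p s' (G q t)) = Cop1 inn' p s' (\<lambda>r. Pop inn s (\<lambda>q t. G q t r))"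
  by (simp add: Pop_def Cop1_def lc_swap[of "popv _ _"] flip: lc_scl)

text \<open>Ends between the two edges at the common vertex commute with the holonomy of the smaller
  edge and only add a convolution factor.\<close>

lemma star_extend:
  assumes star: "\<And>s w. He s * A w = DD w (\<lambda>q w2. Cop1 inn q s (\<lambda>t. A w2 * He t))"
    and c: "\<And>s w. cm (B w) (He s)"
  shows "He s * (A \<star> B) w = DD w (\<lambda>q w2. Cop1 inn q s (\<lambda>t. (A \<star> B) w2 * He t))"
proof -
  have c': "He t * B x = B x * He t" for t x
    using c by (simp add: cm_def)
  have "He s * (A \<star> B) w = DD w (\<lambda>w1 w2. (He s * A w1) * B w2)"
    by (simp add: convm_def DD_mult_right mult.assoc)
  also have "\<dots> = DD w (\<lambda>w1 w2. DD w1 (\<lambda>q u. Cop1 inn q s (\<lambda>t. A u * B w2 * He t)))"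
    by (simp add: star DD_mult_left Cop1_mult_left mult.assoc c')
  also have "\<dots> = DD w (\<lambda>q m. DD m (\<lambda>u w2. Cop1 inn q s (\<lambda>t. A u * B w2 * He t)))"
    by (rule DD_coassoc)
  finally show ?thesis
    by (simp add: convm_def DD_mult_left Cop1_DD)
qed

text \<open>The exchange rule splits the element extracted from \<open>t\<close> into two. By
  \<open>Pop_coassoc\<close> these are two successive extractions: the first feeds the pairing, and
  the second reassembles \<open>Hf\<close>.\<close>

lemma rel3_basis:
  assumes star: "\<And>s w. He s * A w = DD w (\<lambda>q w2. Cop1 ina q s (\<lambda>t. A w2 * He t))"
    and f: "\<And>t. Hf t = Pop inb t (\<lambda>q t'. A q * X t')"
    and c: "\<And>s t. cm (X t) (He s)"
  shows "He s * Hf t = Pop inb t (\<lambda>q t'. Cop1 ina q s (\<lambda>r. Hf t' * He r))"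
proof -
  have c': "He t * X x = X x * He t" for t x
    using c by (simp add: cm_def)
  have "He s * Hf t = Pop inb t (\<lambda>q t'. (He s * A q) * X t')"
    by (simp add: f[of t] Pop_mult_right mult.assoc)
  also have "\<dots> = Pop inb t (\<lambda>q t'. DD q (\<lambda>p q2. Cop1 ina p s (\<lambda>r. A q2 * X t' * He r)))"
    by (simp add: star DD_mult_left Cop1_mult_left mult.assoc c')
  also have "\<dots> = Pop inb t (\<lambda>p t1. Pop inb t1 (\<lambda>q2 t'. Cop1 ina p s (\<lambda>r. A q2 * X t' * He r)))"
    by (rule Pop_coassoc[symmetric])
  also have "\<dots> = Pop inb t (\<lambda>p t1. Cop1 ina p s (\<lambda>r. Hf t1 * He r))"
    by (simp only: Pop_Cop1 f Pop_mult_left)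
  finally show ?thesis .
qed

lemma split_G_selG: "split_G inn (fst x) (snd x) = bv (selG inn x)"
  by (simp add: split_G_def selG_def)

text \<open>The common coefficient of (R1) and (R3); the components of \<open>z\<close> are the two
  legs of the comultiplication of \<open>a\<close> and of \<open>b\<close>.\<close>

definition R_coeff :: "bool \<Rightarrow> bool \<Rightarrow> ('i \<times> 'i \<Rightarrow> 'k) \<Rightarrow> ('i \<times> 'i \<Rightarrow> 'k) \<Rightarrow> (('i \<times> 'i) \<times> ('i \<times> 'i)) \<times> (('i \<times> 'i) \<times> ('i \<times> 'i)) \<Rightarrow> 'k" where
  "R_coeff ina inb a b z = DeltaD H a (fst z) * DeltaD H b (snd z) *
      Rpair H (split_R H ina (fst (fst z)) (snd (fst z))) (split_R H inb (fst (snd z)) (snd (snd z)))"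

lemma R_matrix_sum:
  "(\<Sum>z\<in>UNIV. R_coeff ina inb a b z \<bullet>
      M (selG ina (fst z)) (selG inb (snd z)))
   = lc b (\<lambda>t. lc a (\<lambda>s. Pop inb t (\<lambda>q t'. Cop1 ina q s (\<lambda>r. M r t'))))"
proof -
  have "lc b (\<lambda>t. lc a (\<lambda>s. Pop inb t (\<lambda>q t'. Cop1 ina q s (\<lambda>r. M r t'))))
     = lc a (\<lambda>s. lc (DeltaD H b) (\<lambda>y. lc (DeltaD H (bv s)) (\<lambda>x. lc (pieV (split_R H inb (fst y) (snd y)))
         (\<lambda>q. kapV (split_R H ina (fst x) (snd x)) q \<bullet> M (selG ina x) (selG inb y)))))"
    by (simp only: Pop_eq Cop1_def lc_swap[of b a] lc_DeltaD_bv[of b, symmetric] lc_swap[of "pieV _" "DeltaD H _"])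
  also have "\<dots> = lc (DeltaD H a) (\<lambda>x. lc (DeltaD H b) (\<lambda>y. lc (pieV (split_R H inb (fst y) (snd y)))
         (\<lambda>q. kapV (split_R H ina (fst x) (snd x)) q \<bullet> M (selG ina x) (selG inb y))))"
    by (simp only: lc_swap[of "DeltaD H b" "DeltaD H (bv _)"] lc_DeltaD_bv[of a, symmetric])
  also have "\<dots> = lc (DeltaD H a) (\<lambda>x. lc (DeltaD H b) (\<lambda>y.
         Rpair H (split_R H ina (fst x) (snd x)) (split_R H inb (fst y) (snd y)) \<bullet> M (selG ina x) (selG inb y)))"
    by (simp add: Rpair_eq lc_def[of "pieV _"] mult.commute flip: sum_scl)
  finally show ?thesis
    by (subst sum_UNIV_pair) (simp add: R_coeff_def lc_def[of "DeltaD H _"] scl_sum mult.assoc)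
qed

end

context edge_ends
begin

lemma cm_Hol:
  assumes "\<And>x b. x \<in> set ts \<union> set ss \<Longrightarrow> cm (phi x b) Z" "\<And>B. cm (emb e B) Z"
  shows "cm (Hol s) Z"
proof -
  have "cm (Phi ss b) Z" "cm (Phi ts b) Z" for b
    using assms(1) by (auto intro!: cm_Phi)
  then show ?thesis
    unfolding Hol_def K_def V_def V'_def L_def T_def
    by (intro cm_mult cm_can cm_convm cm_ap assms(2))
qed

text \<open>What is left of the holonomy after splitting off the lower ends at the target,
  respectively at the starting vertex. In the second case the conjugation by \<open>V\<close> is
  generated by the extraction itself, so it does not occur in \<open>X_out\<close>.\<close>

definition "X_in t = V' * L (fst t) * T (snd t) * V"
definition "X_out t = K (fst t) * T (snd t)"

lemma Hol_X_in: "Hol t = Pop True t (\<lambda>q t'. Phi ts q * X_in t')"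
proof -
  obtain z d where t: "t = (z, d)" by fastforce
  have "Phi ts q * (V' * L r * T d * V) = V' * (Phi ts q * L r) * T d * V" for q r
    using cm_ts_V(2)[of q] by (simp add: cm_def flip: mult.assoc)
  then show ?thesis
    by (simp add: t Pop_True X_in_def Hol_def K_def convm_def DD_mult_left DD_mult_right)
qed

lemma Hol_X_out: "Hol t = Pop False t (\<lambda>q t'. Phi ss q * X_out t')"
proof -
  obtain z d where t: "t = (z, d)" by fastforce
  have "Pop False (z, d) (\<lambda>q t'. Phi ss q * X_out t') = DD z (\<lambda>z1 z2. K z1 * (V' * (T d * ap (Phi ss) z2) * V))"
    unfolding X_out_def V'_def V_def
    by (rule Pop_False_prod) (simp_all add: dhom_T hom_Phi dist cm_ss cm_sym[OF cm_K_ss])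
  also have "\<dots> = V' * ((K \<star> Phi ss) \<star> ap (Phi ss)) z * T d * V"
  proof -
    have "K z1 * (V' * (T d * ap (Phi ss) z2) * V) = V' * ((K \<star> Phi ss) z1 * ap (Phi ss) z2 * T d * V)" for z1 z2
    proof -
      have "K z1 * (V' * (T d * ap (Phi ss) z2) * V) = (K z1 * V') * (ap (Phi ss) z2 * T d) * V"
        using cm_ap[of "Phi ss" "T d" z2] cm_ss(2) by (simp add: cm_def mult.assoc)
      then show ?thesis by (simp only: K_V' mult.assoc)
    qed
    then show ?thesis
      by (simp add: convm_def[of _ "ap _"] DD_mult_left DD_mult_right mult.assoc)
  qed
  also have "\<dots> = Hol t"
    by (simp add: convm_assoc hom_convm_ap hom_Phi dist Hol_def t)
  finally show ?thesis by (simp add: t)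
qed

lemma cm_X_in:
  assumes "\<And>x b. x \<in> set ss \<Longrightarrow> cm (phi x b) Z" "\<And>B. cm (emb e B) Z"
  shows "cm (X_in s) Z"
  unfolding X_in_def V_def V'_def L_def T_def
  by (intro cm_mult cm_can cm_ap cm_Phi assms)

lemma cm_X_out:
  assumes "\<And>x b. x \<in> set ts \<Longrightarrow> cm (phi x b) Z" "\<And>B. cm (emb e B) Z"
  shows "cm (X_out s) Z"
  unfolding X_out_def K_def L_def T_def
  by (intro cm_mult cm_convm cm_Phi assms)

end

section \<open>Ciliated graphs\<close>

locale hopf_gauge = hopf_coords H for H :: "('i::finite, 'k::field) hopf" +
  fixes G :: "('v::finite, 'e::finite) cgraph"
  assumes ciliated: "ciliated_graph G"
    and no_loop: "gsrc G e \<noteq> gtgt G e"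
    and no_multi: "e \<noteq> f \<Longrightarrow> {gsrc G e, gtgt G e} \<noteq> {gsrc G f, gtgt G f}"
begin

definition lower :: "'e \<times> bool \<Rightarrow> ('e \<times> bool) list" where
  "lower x = takeWhile (\<lambda>y. y \<noteq> x) (gord G (end_vertex G x))"

lemma gord: "distinct (gord G v)" "set (gord G v) = ends_at G v"
  using ciliated by (simp_all add: ciliated_graph_def)

lemma lower_D: "y \<in> set (lower x) \<Longrightarrow> end_vertex G y = end_vertex G x \<and> y \<noteq> x"
  using set_takeWhileD[of y "\<lambda>y. y \<noteq> x"] gord(2) by (auto simp: lower_def ends_at_def)

lemma end_eqI: "fst x = fst y \<Longrightarrow> end_vertex G x = end_vertex G y \<Longrightarrow> x = y"
  using no_loop[of "fst y"] by (cases x; cases y) (auto simp: end_vertex_def split: if_splits)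

lemma lower_fst: "y \<in> set (lower x) \<Longrightarrow> fst y \<noteq> fst x"
  using end_eqI lower_D by blast

lemma distinct_lower: "distinct (map fst (lower x))"
proof -
  have "distinct (lower x)" unfolding lower_def by (intro distinct_takeWhile gord)
  then show ?thesis
    unfolding distinct_map by (metis inj_onI end_eqI lower_D)
qed

lemma edge_vertices: "end_vertex G x \<in> {gsrc G (fst x), gtgt G (fst x)}"
  by (simp add: end_vertex_def)

lemma common_ends:
  assumes "fst x = fst y" "end_vertex G x = u" "end_vertex G y = v" "u \<noteq> v"
  shows "{gsrc G (fst x), gtgt G (fst x)} = {u, v}"
  using assms by (auto simp: end_vertex_def split: if_splits)

sublocale edge: edge_ends H e "lower (e, True)" "lower (e, False)" for e
proof
  show "fst ` set (lower (e, True)) \<inter> fst ` set (lower (e, False)) = {}"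
  proof (rule ccontr)
    assume "fst ` set (lower (e, True)) \<inter> fst ` set (lower (e, False)) \<noteq> {}"
    then obtain x y where xy: "x \<in> set (lower (e, True))" "y \<in> set (lower (e, False))" "fst x = fst y"
      by auto
    \<comment> \<open>An edge with a lower end at both vertices of \<open>e\<close> joins the same
      two vertices and would be parallel to \<open>e\<close>.\<close>
    have "{gsrc G (fst x), gtgt G (fst x)} = {gtgt G e, gsrc G e}"
      using common_ends[OF xy(3)] lower_D[OF xy(1)] lower_D[OF xy(2)] no_loop[of e] by (simp add: end_vertex_def)
    then show False using no_multi[of "fst x" e] lower_fst[OF xy(1)] by auto
  qed
qed (use distinct_lower lower_fst in fastforce)+

lemma rhol_plus: "rhol (p_plus G e) = edge.Hol e" and rhol_minus: "rhol (p_minus G e) = edge.Hol e"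
proof -
  have "p_plus G e = map inc_letter (lower (e, True)) @ (TRB e, False) # (TR e, False) # inv_path (map inc_letter (lower (e, False)))"
       "p_minus G e = map inc_letter (lower (e, True)) @ (TL e, False) # (TLB e, False) # inv_path (map inc_letter (lower (e, False)))"
    by (simp_all add: p_plus_def p_minus_def p_ta_def p_st_def lower_def end_vertex_def)
  then show "rhol (p_plus G e) = edge.Hol e" "rhol (p_minus G e) = edge.Hol e"
    by (simp_all add: edge.rhol_path)
qed

lemma Hol_comm:
  assumes "no_common_vertex G e f"
  shows "cm (edge.Hol e s) (edge.Hol f t)"
proof -
  have ends: "end_vertex G x \<in> {gsrc G g, gtgt G g}" if "x \<in> set (lower (g, True)) \<union> set (lower (g, False))" for x g
    using that lower_D by (fastforce simp: end_vertex_def)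
  have ne: "end_vertex G x \<noteq> end_vertex G y"
    if "end_vertex G x \<in> {gsrc G e, gtgt G e}" "end_vertex G y \<in> {gsrc G f, gtgt G f}" for x y
    using that assms by (auto simp: no_common_vertex_def)
  have ef: "e \<noteq> f" using assms by (auto simp: no_common_vertex_def)
  have "cm (phi x a) (edge.Hol f t)" if "x \<in> set (lower (e, True)) \<union> set (lower (e, False))" for x a
  proof (rule cm_sym, rule edge.cm_Hol)
    show "cm (phi y b) (phi x a)" if "y \<in> set (lower (f, True)) \<union> set (lower (f, False))" for y b
      using ends[OF that] ends[OF \<open>x \<in> _\<close>] ne by (intro cm_phi) metis
    have "fst x \<noteq> f"
      using ne[of x x] ends[OF \<open>x \<in> _\<close>] edge_vertices[of x] by auto
    then show "cm (emb f B) (phi x a)" for B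
      by (intro cm_sym[OF cm_phi_emb])
  qed
  moreover have "cm (emb e B) (edge.Hol f t)" for B
  proof (rule cm_sym, rule edge.cm_Hol)
    show "cm (phi y b) (emb e B)" if "y \<in> set (lower (f, True)) \<union> set (lower (f, False))" for y b
      using ne[of y y] ends[OF that] edge_vertices[of y] by (intro cm_phi_emb) auto
    show "cm (emb f A) (emb e B)" for A
      using ef by (intro cm_emb) simp
  qed
  ultimately show ?thesis by (rule edge.cm_Hol)
qed

lemma lower_split:
  assumes "pos (gord G v) x < pos (gord G v) y" "end_vertex G x = v" "end_vertex G y = v"
  shows "\<exists>mid. lower y = lower x @ x # mid"
proof -
  let ?l = "gord G v"
  have yl: "y \<in> set ?l" and xl: "x \<in> set ?l" using assms gord(2) by (auto simp: ends_at_def)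
  obtain as bs where l: "?l = as @ x # bs" "x \<notin> set as" using split_list_first[OF xl] by blast
  have tx: "takeWhile (\<lambda>z. z \<noteq> x) ?l = as" unfolding l(1) by (subst takeWhile_append2) (use l(2) in auto)
  have "y \<notin> set as"
  proof
    assume "y \<in> set as"
    then have "takeWhile (\<lambda>z. z \<noteq> y) ?l = takeWhile (\<lambda>z. z \<noteq> y) as"
      unfolding l by (intro takeWhile_append1) auto
    then have "pos ?l y \<le> length as"
      by (simp add: pos_def length_takeWhile_le)
    then show False using assms(1) tx by (simp add: pos_def)
  qed
  moreover have "x \<noteq> y" using assms(1) by auto
  ultimately have "takeWhile (\<lambda>z. z \<noteq> y) ?l = as @ x # takeWhile (\<lambda>z. z \<noteq> y) bs"
    unfolding l by (subst takeWhile_append2) auto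
  then show ?thesis using tx assms by (auto simp: lower_def)
qed

lemma lower_distinct: "distinct (lower x)"
  using distinct_lower distinct_map by blast

lemma edge_star:
  "edge.Hol e s * (Phi (lower (e, b)) \<star> phi (e, b)) w =
   DD w (\<lambda>q w2. Cop1 b q s (\<lambda>t. (Phi (lower (e, b)) \<star> phi (e, b)) w2 * edge.Hol e t))"
proof (cases b)
  case True
  have "phi (e, True) = edge.L e" by (simp add: fun_eq_iff phi_def edge.L_def)
  then show ?thesis using True edge.star_in[of e s w] by (simp add: edge.K_def)
next
  case False
  have "phi (e, False) = ap (edge.R e)" by (simp add: fun_eq_iff phi_def edge.ap_R)
  then show ?thesis using False edge.star_out[of e s w] by simp
qed

text \<open>The ends below \<open>f\<close> at \<open>v\<close> are those below \<open>e\<close>,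
  then \<open>e\<close> itself, then \<open>mid\<close>. The first two groups obey the exchange rule
  of \<open>e\<close>; the ends in \<open>mid\<close> and the remainder \<open>Xf\<close> of the
  holonomy of \<open>f\<close> commute with the holonomy of \<open>e\<close>.\<close>

lemma Hol_rel3:
  assumes ef: "e \<noteq> f" and less: "less_at G v e f"
  shows "edge.Hol e s * edge.Hol f t =
    Pop (gtgt G f = v) t (\<lambda>q t'. Cop1 (gtgt G e = v) q s (\<lambda>r. edge.Hol f t' * edge.Hol e r))"
proof -
  define x where "x = (e, gtgt G e = v)"
  define y where "y = (f, gtgt G f = v)"
  have inc: "incident G v e" "incident G v f" and pos: "pos (gord G v) x < pos (gord G v) y"
    using less by (simp_all add: less_at_def end_at_def x_def y_def)
  have xv: "end_vertex G x = v" and yv: "end_vertex G y = v"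
    using inc by (auto simp: incident_def end_vertex_def x_def y_def)
  define x' where "x' = (e, gtgt G e \<noteq> v)"
  define y' where "y' = (f, gtgt G f \<noteq> v)"
  have x'v: "end_vertex G x' \<noteq> v" and y'v: "end_vertex G y' \<noteq> v"
    using end_eqI[of x' x] end_eqI[of y' y] xv yv by (auto simp: x_def x'_def y_def y'_def)
  \<comment> \<open>\<open>x'\<close> and \<open>y'\<close> are the ends away from \<open>v\<close>.
    If \<open>f\<close> also met the far vertex of \<open>e\<close>, the two edges would be
    parallel; \<open>no_fe\<close> is the same with the roles exchanged.\<close>
  have no_ef: False if "fst z = f" "end_vertex G z = end_vertex G x'" for z
  proof -
    have "{gsrc G f, gtgt G f} = {end_vertex G x', v}"
      using common_ends[of z y] that x'v yv by (simp add: y_def)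
    moreover have "{gsrc G e, gtgt G e} = {end_vertex G x', v}"
      using common_ends[of x' x] x'v xv by (simp add: x_def x'_def)
    ultimately show False using no_multi[OF ef] by simp
  qed
  have no_fe: False if "fst z = e" "end_vertex G z = end_vertex G y'" for z
  proof -
    have "{gsrc G e, gtgt G e} = {end_vertex G y', v}"
      using common_ends[of z x] that y'v xv by (simp add: x_def)
    moreover have "{gsrc G f, gtgt G f} = {end_vertex G y', v}"
      using common_ends[of y' y] y'v yv by (simp add: y_def y'_def)
    ultimately show False using no_multi[OF ef] by simp
  qed
  have x'y': "end_vertex G x' \<noteq> end_vertex G y'"
    using no_ef[of y'] by (auto simp: y'_def)
  have ends_e: "set (lower (e, True)) \<union> set (lower (e, False)) = set (lower x) \<union> set (lower x')"
    by (cases "gtgt G e = v") (auto simp: x_def x'_def)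
  obtain mid where mid: "lower y = lower x @ x # mid"
    using lower_split[OF pos xv yv] by blast
  have dy: "distinct (lower x @ x # mid)" using lower_distinct[of y] mid by simp
  have mid_v: "end_vertex G z = v" "fst z \<noteq> e" if "z \<in> set mid" for z
  proof -
    show *: "end_vertex G z = v" using lower_D[of z y] that mid yv by simp
    have "z \<noteq> x" using dy that by auto
    then show "fst z \<noteq> e" using end_eqI[of z x] * xv by (auto simp: x_def)
  qed
  have cmid: "cm (Phi mid w) (edge.Hol e s)" for w s
  proof (rule cm_Phi, rule cm_sym, rule edge.cm_Hol)
    fix z b assume z: "z \<in> set mid"
    show "cm (phi u a) (phi z b)" if "u \<in> set (lower (e, True)) \<union> set (lower (e, False))" for u a
    proof (rule cm_phi)
      show "u \<noteq> z"
        using that[unfolded ends_e] dy z mid_v[OF z] lower_D[of u x'] x'v by auto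
    qed
    show "cm (emb e B) (phi z b)" for B
      by (intro cm_sym[OF cm_phi_emb] mid_v z)
  qed
  define Xf where "Xf = (if gtgt G f = v then edge.X_in f else edge.X_out f)"
  have Hf: "edge.Hol f t = Pop (gtgt G f = v) t (\<lambda>q t'. Phi (lower y) q * Xf t')" for t
    using edge.Hol_X_in[of f t] edge.Hol_X_out[of f t] by (auto simp: Xf_def y_def)
  have cX: "cm (Xf t) (edge.Hol e s)" for s t
  proof -
    have 1: "cm (phi z b) (edge.Hol e s)" if z: "z \<in> set (lower y')" for z b
    proof (rule cm_sym, rule edge.cm_Hol)
      have zv: "end_vertex G z = end_vertex G y'" using lower_D[OF z] by simp
      show "cm (phi u a) (phi z b)" if "u \<in> set (lower (e, True)) \<union> set (lower (e, False))" for u a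
      proof (rule cm_phi)
        show "u \<noteq> z"
          using that[unfolded ends_e] zv lower_D[of u x] lower_D[of u x'] x'y' y'v xv by auto
      qed
      show "cm (emb e B) (phi z b)" for B
        using no_fe[OF _ zv] by (intro cm_sym[OF cm_phi_emb]) auto
    qed
    have 2: "cm (emb f B) (edge.Hol e s)" for B
    proof (rule cm_sym, rule edge.cm_Hol)
      show "cm (phi u a) (emb f B)" if u: "u \<in> set (lower (e, True)) \<union> set (lower (e, False))" for u a
      proof (rule cm_phi_emb)
        have "u \<in> set (lower y)" if "u \<in> set (lower x)" using that mid by simp
        then show "fst u \<noteq> f"
          using u[unfolded ends_e] lower_fst[of u y] no_ef[of u] lower_D[of u x'] by (auto simp: y_def)
      qed
      show "cm (emb e A) (emb f B)" for A using ef by (rule cm_emb)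
    qed
    show ?thesis
      using edge.cm_X_in[of f "edge.Hol e s" t] edge.cm_X_out[of f "edge.Hol e s" t] 1 2
      by (auto simp: Xf_def y'_def)
  qed
  have Phi_y: "Phi (lower y) = (Phi (lower x) \<star> phi x) \<star> Phi mid"
    by (simp add: mid Phi_append Phi_simps convm_assoc)
  show ?thesis
  proof (rule rel3_basis[where A = "Phi (lower y)" and X = Xf])
    show "edge.Hol e s * Phi (lower y) w = DD w (\<lambda>q w2. Cop1 (gtgt G e = v) q s (\<lambda>t. Phi (lower y) w2 * edge.Hol e t))" for s w
      unfolding Phi_y x_def by (rule star_extend[OF edge_star cmid])
  qed (fact Hf, fact cX)
qed

end

section \<open>The free algebra\<close>

lemma fa_carrier_simps:
  "fa_one \<in> fa_carrier" "fa_zero \<in> fa_carrier"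
  "P \<in> fa_carrier \<Longrightarrow> Q \<in> fa_carrier \<Longrightarrow> fa_add P Q \<in> fa_carrier"
  "P \<in> fa_carrier \<Longrightarrow> Q \<in> fa_carrier \<Longrightarrow> fa_diff P Q \<in> fa_carrier"
  "P \<in> fa_carrier \<Longrightarrow> fa_scale c P \<in> fa_carrier"
proof -
  assume P: "P \<in> fa_carrier"
  then show "fa_scale c P \<in> fa_carrier"
    by (auto simp: fa_carrier_def fa_scale_def elim!: rev_finite_subset)
  assume Q: "Q \<in> fa_carrier"
  have fin: "finite ({w. P w \<noteq> 0} \<union> {w. Q w \<noteq> 0})"
    using P Q by (simp add: fa_carrier_def)
  then show "fa_add P Q \<in> fa_carrier" "fa_diff P Q \<in> fa_carrier"
    unfolding fa_carrier_def mem_Collect_eq fa_add_def fa_diff_def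
    by (auto intro!: finite_subset[OF _ fin])
qed (simp_all add: fa_carrier_def fa_one_def fa_zero_def)

text \<open>Turns the sum over cut positions into a sum over factorisations with factors in
  prescribed finite supports, which can be summed over all words.\<close>

lemma fa_mul_pairs:
  assumes "finite S" "finite T" "{w. P w \<noteq> 0} \<subseteq> S" "{w. Q w \<noteq> 0} \<subseteq> T"
  shows "fa_mul P Q w = (\<Sum>x | x \<in> S \<times> T \<and> fst x @ snd x = w. P (fst x) * Q (snd x))"
proof -
  have img: "(\<lambda>k. (take k w, drop k w)) ` {0..length w} = {x. fst x @ snd x = w}"
  proof (intro equalityI subsetI)
    fix x assume "x \<in> {x. fst x @ snd x = w}"
    then have "x = (take (length (fst x)) w, drop (length (fst x)) w)" "length (fst x) \<le> length w" by auto
    then show "x \<in> (\<lambda>k. (take k w, drop k w)) ` {0..length w}" by force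
  qed auto
  then have fin: "finite {x. fst x @ snd x = w}"
    by (metis finite_atLeastAtMost finite_imageI)
  have "fa_mul P Q w = (\<Sum>x\<in>(\<lambda>k. (take k w, drop k w)) ` {0..length w}. P (fst x) * Q (snd x))"
    unfolding fa_mul_def
  proof (subst sum.reindex)
    show "inj_on (\<lambda>k. (take k w, drop k w)) {0..length w}"
    proof (rule inj_onI)
      fix j k assume "j \<in> {0..length w}" "k \<in> {0..length w}" "(take j w, drop j w) = (take k w, drop k w)"
      then have "length (take j w) = length (take k w)" by simp
      with \<open>j \<in> _\<close> \<open>k \<in> _\<close> show "j = k" by simp
    qed
  qed simp
  also have "\<dots> = (\<Sum>x | x \<in> S \<times> T \<and> fst x @ snd x = w. P (fst x) * Q (snd x))"
    unfolding img by (rule sum.mono_neutral_right[OF fin]) (use assms in auto)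
  finally show ?thesis .
qed

lemma fa_mul_supp:
  assumes "{w. P w \<noteq> 0} \<subseteq> S" "{w. Q w \<noteq> 0} \<subseteq> T"
  shows "{w. fa_mul P Q w \<noteq> 0} \<subseteq> (\<lambda>x. fst x @ snd x) ` (S \<times> T)"
proof
  fix w assume "w \<in> {w. fa_mul P Q w \<noteq> 0}"
  then have "(\<Sum>k\<in>{0..length w}. P (take k w) * Q (drop k w)) \<noteq> 0"
    by (simp add: fa_mul_def)
  then obtain k where "P (take k w) * Q (drop k w) \<noteq> 0"
    by (rule sum.not_neutral_contains_not_neutral)
  then have "(take k w, drop k w) \<in> S \<times> T" using assms by auto
  then show "w \<in> (\<lambda>x. fst x @ snd x) ` (S \<times> T)"
    by (intro image_eqI[of _ _ "(take k w, drop k w)"]) simp_all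
qed

lemma fa_mul_carrier: "P \<in> fa_carrier \<Longrightarrow> Q \<in> fa_carrier \<Longrightarrow> fa_mul P Q \<in> fa_carrier"
  unfolding fa_carrier_def mem_Collect_eq
  by (rule finite_subset[OF fa_mul_supp[OF subset_refl subset_refl]]) simp

lemma gen_supp: "{w. gen e a w \<noteq> 0} \<subseteq> range (\<lambda>s. [(e, s)])"
  by (auto simp: gen_def length_Suc_conv split: if_splits)

lemma gen_carrier: "gen e (a :: 'i::finite \<times> 'i \<Rightarrow> 'k::field) \<in> fa_carrier"
  unfolding fa_carrier_def mem_Collect_eq by (rule finite_subset[OF gen_supp]) simp

lemma fa_vsum_carrier: "finite A \<Longrightarrow> (\<And>s. s \<in> A \<Longrightarrow> F s \<in> fa_carrier) \<Longrightarrow> fa_vsum F A \<in> fa_carrier"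
proof (induction A rule: finite_induct)
  case (insert x A)
  then have "fa_vsum F (insert x A) = fa_add (F x) (fa_vsum F A)"
    by (simp add: fa_vsum_def fa_add_def fun_eq_iff)
  then show ?case using insert by (simp add: fa_carrier_simps)
next
  case empty
  then show ?case by (simp add: fa_vsum_def fa_carrier_def)
qed

definition fa_word :: "'g list \<Rightarrow> ('g, 'k::field) fa" where
  "fa_word u = (\<lambda>w. if w = u then 1 else 0)"

lemma fa_word_carrier: "fa_word u \<in> fa_carrier"
  by (simp add: fa_carrier_def fa_word_def)

lemma fa_word_Nil: "fa_word [] = fa_one"
  by (simp add: fa_word_def fa_one_def)

lemma fa_word_Cons: "fa_word ((e, s) # u) = fa_mul (gen e (bv s)) (fa_word u :: ('e \<times> ('i::finite \<times> 'i), 'k::field) fa)"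
proof
  fix w
  have "fa_mul (gen e (bv s)) (fa_word u :: ('e \<times> ('i \<times> 'i), 'k) fa) w
     = (\<Sum>x | x \<in> range (\<lambda>s. [(e, s)]) \<times> {u} \<and> fst x @ snd x = w. gen e (bv s) (fst x) * fa_word u (snd x))"
    by (rule fa_mul_pairs[OF _ _ gen_supp]) (auto simp: fa_word_def)
  also have "\<dots> = (\<Sum>t | [(e, t)] @ u = w. bv s t)"
    by (rule sum.reindex_bij_witness[of _ "\<lambda>t. ([(e, t)], u)" "\<lambda>x. snd (hd (fst x))"]) (auto simp: gen_def fa_word_def)
  also have "\<dots> = fa_word ((e, s) # u) w"
  proof (cases "\<exists>t. w = (e, t) # u")
    case True
    then obtain t where w: "w = (e, t) # u" by blast
    then have "{t. [(e, t)] @ u = w} = {t}" by auto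
    then show ?thesis by (simp add: w fa_word_def bv_def)
  next
    case False
    then have ne: "[(e, t)] @ u \<noteq> w" for t by (metis append_Cons append_Nil)
    have "{t. [(e, t)] @ u = w} = {}" using ne by blast
    moreover have "w \<noteq> (e, s) # u" using ne[of s] by auto
    ultimately show ?thesis by (simp only: fa_word_def if_False sum.empty)
  qed
  finally show "fa_word ((e, s) # u) w = fa_mul (gen e (bv s)) (fa_word u :: ('e \<times> ('i \<times> 'i), 'k) fa) w" by (rule sym)
qed

lemma fa_carrier_induct [consumes 1, case_names zero add]:
  assumes "P \<in> fa_carrier" and z: "Q fa_zero"
    and a: "\<And>c u R. R \<in> fa_carrier \<Longrightarrow> Q R \<Longrightarrow> Q (fa_add (fa_scale c (fa_word u)) R)"
  shows "Q P"
proof -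
  have "finite S \<Longrightarrow> Q (\<lambda>w. if w \<in> S then P w else 0)" for S
  proof (induction S rule: finite_induct)
    case empty
    then show ?case using z by (simp add: fa_zero_def)
  next
    case (insert x S)
    have "(\<lambda>w. if w \<in> insert x S then P w else 0) = fa_add (fa_scale (P x) (fa_word x)) (\<lambda>w. if w \<in> S then P w else 0)"
      using insert by (auto simp: fun_eq_iff fa_add_def fa_scale_def fa_word_def)
    moreover have "(\<lambda>w. if w \<in> S then P w else 0) \<in> fa_carrier"
      using insert by (auto simp: fa_carrier_def elim!: rev_finite_subset split: if_splits)
    ultimately show ?case using insert a by simp
  qed
  from this[of "{w. P w \<noteq> 0}"] have "Q (\<lambda>w. if w \<in> {w. P w \<noteq> 0} then P w else 0)"
    using assms(1) by (simp add: fa_carrier_def)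
  moreover have "(\<lambda>w. if w \<in> {w. P w \<noteq> 0} then P w else 0) = P" by auto
  ultimately show ?thesis by simp
qed

text \<open>Both maps agree on words, which are products of generators at basis vectors, and the
  words span the free algebra.\<close>

lemma alg_hom_op_unique:
  assumes h: "alg_hom_op H G \<chi>" and h': "alg_hom_op H G \<chi>'" and eq: "\<And>e a. \<chi> (gen e a) = \<chi>' (gen e a)"
    and P: "P \<in> fa_carrier"
  shows "\<chi> P = \<chi>' P"
proof -
  have w: "\<chi> (fa_word u) = \<chi>' (fa_word u)" for u
  proof (induction u)
    case Nil
    then show ?case using h h' by (simp add: fa_word_Nil alg_hom_op_def)
  next
    case (Cons g u)
    then show ?case using h h' eq
      by (cases g) (simp add: fa_word_Cons alg_hom_op_def gen_carrier fa_word_carrier)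
  qed
  have z: "fa_zero = fa_scale 0 fa_one" by (simp add: fa_zero_def fa_scale_def)
  from P show ?thesis
  proof (induction rule: fa_carrier_induct)
    case zero
    then show ?case unfolding z using h h' by (simp add: alg_hom_op_def fa_carrier_simps)
  next
    case (add c u R)
    then show ?case using h h' w by (simp add: alg_hom_op_def fa_carrier_simps fa_word_carrier)
  qed
qed

section \<open>The homomorphism\<close>

context hopf_gauge
begin

text \<open>The holonomy of the first letter stands on the right because the target carries the
  opposite multiplication.\<close>

fun word :: "('e \<times> ('i \<times> 'i)) list \<Rightarrow> ('e \<Rightarrow> 'i \<times> 'i) \<Rightarrow> 'k" where
  "word [] = tone H"
| "word (g # w) = tmul (heis H) (word w) (hol_path H (p_plus G (fst g)) (bv (snd g)))"

fun mword :: "('e \<times> ('i \<times> 'i)) list \<Rightarrow> ('e \<Rightarrow> 'i, 'k) mat" where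
  "mword [] = 1"
| "mword (g # w) = mword w * edge.Hol (fst g) (snd g)"

lemma rhoE_hol: "rhoE (hol_path H (p_plus G e) a) = lc a (edge.Hol e)" "rhoE (hol_path H (p_minus G e) a) = lc a (edge.Hol e)"
  by (simp_all add: rhoE_hol_path rhol_plus rhol_minus)

lemma rhoE_word: "rhoE (word w) = mword w"
  by (induction w) (simp_all add: rhoE_tone rhoE_heis rhoE_hol)

lemma mword_append: "mword (u @ w) = mword w * mword u"
  by (induction u) (simp_all add: mult.assoc)

definition chi :: "('e \<times> ('i \<times> 'i), 'k) fa \<Rightarrow> ('e \<Rightarrow> 'i \<times> 'i) \<Rightarrow> 'k" where
  "chi P = (\<lambda>h. \<Sum>w | P w \<noteq> 0. P w * word w h)"

text \<open>Allows sums for different elements to be taken over one common finite set of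
  words.\<close>

lemma rhoE_chi:
  assumes "finite S" "{w. P w \<noteq> 0} \<subseteq> S"
  shows "rhoE (chi P) = (\<Sum>w\<in>S. P w \<bullet> mword w)"
proof -
  have "rhoE (chi P) = (\<Sum>w | P w \<noteq> 0. P w \<bullet> mword w)"
    by (simp add: chi_def rhoE_sum rhoE_scale rhoE_word)
  also have "\<dots> = (\<Sum>w\<in>S. P w \<bullet> mword w)"
    by (rule sum.mono_neutral_left) (use assms in auto)
  finally show ?thesis .
qed

lemma rhoE_chi_add:
  assumes "P \<in> fa_carrier" "Q \<in> fa_carrier"
  shows "rhoE (chi (fa_add P Q)) = rhoE (chi P) + rhoE (chi Q)"
proof -
  let ?S = "{w. P w \<noteq> 0} \<union> {w. Q w \<noteq> 0}"
  have fin: "finite ?S" using assms by (simp add: fa_carrier_def)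
  show ?thesis
    using fin by (subst (1 2 3) rhoE_chi[of ?S]) (auto simp: fa_add_def scl_add sum.distrib)
qed

lemma rhoE_chi_scale:
  assumes "P \<in> fa_carrier"
  shows "rhoE (chi (fa_scale c P)) = c \<bullet> rhoE (chi P)"
  using assms by (subst (1 2) rhoE_chi[of "{w. P w \<noteq> 0}"]) (auto simp: fa_carrier_def fa_scale_def scl_sum)

lemma rhoE_chi_mul:
  assumes "P \<in> fa_carrier" "Q \<in> fa_carrier"
  shows "rhoE (chi (fa_mul P Q)) = rhoE (chi Q) * rhoE (chi P)"
proof -
  let ?S = "{w. P w \<noteq> 0}" and ?T = "{w. Q w \<noteq> 0}"
  let ?f = "\<lambda>x. fst x @ snd x"
  have fin: "finite ?S" "finite ?T" using assms by (simp_all add: fa_carrier_def)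
  have "rhoE (chi (fa_mul P Q)) = (\<Sum>w\<in>?f ` (?S \<times> ?T). fa_mul P Q w \<bullet> mword w)"
    using fin fa_mul_supp[OF subset_refl subset_refl] by (intro rhoE_chi) auto
  also have "\<dots> = (\<Sum>w\<in>?f ` (?S \<times> ?T). \<Sum>x | x \<in> ?S \<times> ?T \<and> ?f x = w. (P (fst x) * Q (snd x)) \<bullet> mword (?f x))"
    by (simp add: fa_mul_pairs[OF fin subset_refl subset_refl] sum_scl)
  also have "\<dots> = (\<Sum>x\<in>?S \<times> ?T. (P (fst x) * Q (snd x)) \<bullet> mword (?f x))"
    using fin by (intro sum.image_gen[symmetric]) simp
  also have "\<dots> = (\<Sum>v\<in>?T. \<Sum>u\<in>?S. (Q v \<bullet> mword v) * (P u \<bullet> mword u))"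
    by (subst sum.swap) (simp add: sum.cartesian_product split_def mword_append mult.commute)
  also have "\<dots> = rhoE (chi Q) * rhoE (chi P)"
    using fin by (simp add: rhoE_chi[of ?S] rhoE_chi[of ?T] sum_product)
  finally show ?thesis .
qed

lemma rhoE_chi_one: "rhoE (chi fa_one) = 1"
  by (subst rhoE_chi[of "{[]}"]) (auto simp: fa_one_def)

lemma rhoE_chi_diff:
  assumes "P \<in> fa_carrier" "Q \<in> fa_carrier"
  shows "rhoE (chi (fa_diff P Q)) = rhoE (chi P) - rhoE (chi Q)"
proof -
  have "fa_diff P Q = fa_add P (fa_scale (-1) Q)"
    by (simp add: fa_diff_def fa_add_def fa_scale_def)
  moreover have "(-1) \<bullet> X = - X" for X :: "('e \<Rightarrow> 'i, 'k) mat"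
    using scl_add(2)[of 1 "-1" X] by (simp add: eq_neg_iff_add_eq_0 add.commute)
  ultimately show ?thesis
    using assms by (simp add: rhoE_chi_add rhoE_chi_scale fa_carrier_simps)
qed

lemma rhoE_chi_vsum:
  assumes "finite A" "\<And>s. s \<in> A \<Longrightarrow> F s \<in> fa_carrier"
  shows "rhoE (chi (fa_vsum F A)) = (\<Sum>s\<in>A. rhoE (chi (F s)))"
  using assms
proof (induction A rule: finite_induct)
  case empty
  then show ?case by (simp add: fa_vsum_def chi_def rhoE_zero)
next
  case (insert x A)
  then have "fa_vsum F (insert x A) = fa_add (F x) (fa_vsum F A)"
    by (simp add: fa_vsum_def fa_add_def fun_eq_iff)
  then show ?case using insert by (simp add: rhoE_chi_add fa_vsum_carrier)
qed

lemma rhoE_chi_gen: "rhoE (chi (gen e a)) = lc a (edge.Hol e)"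
proof -
  have "rhoE (chi (gen e a)) = (\<Sum>w\<in>range (\<lambda>s. [(e, s)]). gen e a w \<bullet> mword w)"
    by (intro rhoE_chi gen_supp) simp
  also have "\<dots> = lc a (edge.Hol e)"
    by (subst sum.reindex) (auto simp: inj_on_def gen_def lc_def)
  finally show ?thesis .
qed

lemma chi_relation:
  assumes "r \<in> relations H G"
  shows "r \<in> fa_carrier \<and> rhoE (chi r) = 0"
proof -
  note carrier = fa_carrier_simps fa_mul_carrier gen_carrier fa_vsum_carrier
  note rho = rhoE_chi_diff rhoE_chi_vsum rhoE_chi_scale rhoE_chi_mul rhoE_chi_gen rhoE_chi_one carrier
  from assms consider
    (unit) e where "r = fa_diff (gen e (unitD H)) fa_one"
  | (R1) e a b where "r = fa_diff (fa_mul (gen e b) (gen e a))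
        (fa_vsum (\<lambda>((s, t), (s', t')). fa_scale (DeltaD H a (s, t) * DeltaD H b (s', t') * Rpair H (bv s) (bv s'))
           (gen e (dmul H (bv t) (bv t')))) UNIV)"
  | (R2) e f a b where "no_common_vertex G e f" "r = fa_diff (fa_mul (gen f b) (gen e a)) (fa_mul (gen e a) (gen f b))"
  | (R3) e f v a b where "e \<noteq> f" "less_at G v e f" "r = fa_diff (fa_mul (gen f b) (gen e a))
        (fa_vsum (\<lambda>((s, t), (s', t')). fa_scale (DeltaD H a (s, t) * DeltaD H b (s', t') *
              Rpair H (split_R H (gtgt G e = v) s t) (split_R H (gtgt G f = v) s' t'))
           (fa_mul (gen e (split_G (gtgt G e = v) s t)) (gen f (split_G (gtgt G f = v) s' t')))) UNIV)"
    unfolding relations_def by blast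
  then show ?thesis
  proof cases
    case unit
    then show ?thesis by (simp add: rho edge.Hol_unit)
  next
    case R1
    \<comment> \<open>(R1) is written with the coefficients for two incoming ends, so that
      \<open>R_matrix_sum\<close> covers it together with (R3).\<close>
    let ?F = "\<lambda>z. fa_scale (R_coeff True True a b z)
           (gen e (dmul H (bv (selG True (fst z))) (bv (selG True (snd z)))))"
    have r: "r = fa_diff (fa_mul (gen e b) (gen e a)) (fa_vsum ?F UNIV)"
      by (simp add: R1 R_coeff_def split_def split_R_def selG_def)
    have "rhoE (chi (fa_vsum ?F UNIV)) = (\<Sum>z\<in>UNIV. R_coeff True True a b z \<bullet>
        lc (dmul H (bv (selG True (fst z))) (bv (selG True (snd z)))) (edge.Hol e))"
      by (simp add: rho)
    also have "\<dots> = lc b (\<lambda>t. lc a (\<lambda>s. edge.Hol e s * edge.Hol e t))"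
      by (simp only: R_matrix_sum[where M = "\<lambda>r t'. lc (dmul H (bv r) (bv t')) (edge.Hol e)"] edge.rel1_basis)
    also have "\<dots> = lc a (edge.Hol e) * lc b (edge.Hol e)"
      by (simp only: lc_mult lc_swap[of b a])
    finally show ?thesis by (simp add: r rho)
  next
    case R2
    have "lc a (edge.Hol e) * lc b (edge.Hol f) = lc b (edge.Hol f) * lc a (edge.Hol e)"
      using cm_lc[OF cm_sym[OF cm_lc[OF cm_sym[OF Hol_comm[OF R2(1)]]]]] by (simp add: cm_def)
    then show ?thesis by (simp add: R2 rho)
  next
    case R3
    let ?F = "\<lambda>z. fa_scale (R_coeff (gtgt G e = v) (gtgt G f = v) a b z)
           (fa_mul (gen e (bv (selG (gtgt G e = v) (fst z)))) (gen f (bv (selG (gtgt G f = v) (snd z)))))"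
    have r: "r = fa_diff (fa_mul (gen f b) (gen e a)) (fa_vsum ?F UNIV)"
      by (simp add: R3(3) R_coeff_def split_def flip: split_G_selG)
    have "rhoE (chi (fa_vsum ?F UNIV)) = (\<Sum>z\<in>UNIV. R_coeff (gtgt G e = v) (gtgt G f = v) a b z \<bullet>
        (edge.Hol f (selG (gtgt G f = v) (snd z)) * edge.Hol e (selG (gtgt G e = v) (fst z))))"
      by (simp add: rho)
    also have "\<dots> = lc b (\<lambda>t. lc a (\<lambda>s. edge.Hol e s * edge.Hol f t))"
      by (simp only: R_matrix_sum[where M = "\<lambda>r t'. edge.Hol f t' * edge.Hol e r"] Hol_rel3[OF R3(1,2)])
    also have "\<dots> = lc a (edge.Hol e) * lc b (edge.Hol f)"
      by (simp only: lc_mult lc_swap[of b a])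
    finally show ?thesis by (simp add: r rho)
  qed
qed

text \<open>Membership in the carrier is proved along the way, since additivity and multiplicativity
  of \<open>chi\<close> are only available for finitely supported elements.\<close>

lemma chi_ideal:
  assumes "P \<in> fa_ideal (relations H G)"
  shows "P \<in> fa_carrier \<and> rhoE (chi P) = 0"
  using assms
proof (induction rule: fa_ideal.induct)
  case zero
  then show ?case by (simp add: fa_carrier_simps) (simp add: fa_zero_def chi_def rhoE_zero)
next
  case (gen r X Y)
  then show ?case using chi_relation[of r] by (simp add: rhoE_chi_mul fa_mul_carrier)
next
  case (add P Q)
  then show ?case by (simp add: rhoE_chi_add fa_carrier_simps)
next
  case (scale P c)
  then show ?case by (simp add: rhoE_chi_scale fa_carrier_simps)
qed

lemma chi_hom: "alg_hom_op H G chi"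
  unfolding alg_hom_op_def
proof (intro conjI ballI allI)
  fix P Q :: "('e \<times> ('i \<times> 'i), 'k) fa" and c
  assume P: "P \<in> fa_carrier"
  then show "chi (fa_scale c P) = (\<lambda>h. c * chi P h)"
    by (intro rhoE_inj) (simp add: rhoE_chi_scale rhoE_scale)
  assume Q: "Q \<in> fa_carrier"
  show "chi (fa_add P Q) = (\<lambda>h. chi P h + chi Q h)"
    using P Q by (intro rhoE_inj) (simp add: rhoE_chi_add rhoE_add)
  show "chi (fa_mul P Q) = tmul (heis H) (chi Q) (chi P)"
    using P Q by (intro rhoE_inj) (simp add: rhoE_chi_mul rhoE_heis)
next
  show "chi fa_one = tone H"
    by (intro rhoE_inj) (simp add: rhoE_chi_one rhoE_tone)
next
  fix P assume "P \<in> fa_ideal (relations H G)"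
  then show "chi P = (\<lambda>h. 0)"
    by (intro rhoE_inj) (simp add: chi_ideal rhoE_zero)
qed

lemma chi_gen: "chi (gen e a) = hol_path H (p_plus G e) a" "chi (gen e a) = hol_path H (p_minus G e) a"
  by (intro rhoE_inj, simp add: rhoE_chi_gen rhoE_hol)+

lemma rhoE_foldr: "rhoE (foldr (tmul (heis H)) Xs (tone H)) = prod_list (map rhoE Xs)"
  by (induction Xs) (simp_all add: rhoE_tone rhoE_heis)

text \<open>Multiplicativity into the opposite algebra reverses the list; the comparison is made
  after \<open>rhoE\<close>, where both sides are products of matrices.\<close>

lemma chi_foldr:
  assumes "length es = length as"
  shows "chi (foldr fa_mul (map2 gen es as) fa_one) =
    foldr (tmul (heis H)) (rev (map2 (\<lambda>e a. hol_path H (p_plus G e) a) es as)) (tone H)"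
proof (rule rhoE_inj)
  have "foldr fa_mul (map2 gen es as) fa_one \<in> fa_carrier \<and>
      rhoE (chi (foldr fa_mul (map2 gen es as) fa_one)) =
      prod_list (map rhoE (rev (map2 (\<lambda>e a. hol_path H (p_plus G e) a) es as)))"
    using assms
  proof (induction es as rule: list_induct2)
    case Nil
    then show ?case by (simp add: fa_carrier_simps rhoE_chi_one)
  next
    case (Cons e es a as)
    then show ?case
      by (simp add: fa_mul_carrier gen_carrier rhoE_chi_mul rhoE_chi_gen rhoE_hol)
  qed
  then show "rhoE (chi (foldr fa_mul (map2 gen es as) fa_one)) =
      rhoE (foldr (tmul (heis H)) (rev (map2 (\<lambda>e a. hol_path H (p_plus G e) a) es as)) (tone H))"
    by (simp only: rhoE_foldr)
qed

end

theorem mainTheorem15: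
  fixes H :: "('i::finite, 'k::field_char_0) hopf"
    and G :: "('v::finite, 'e::finite) cgraph"
  assumes "hopf_algebra H"
    and "semisimple H"
    and "\<forall>x. hS H (hS H x) = x"
    and "regular_ciliated G"
  shows "(\<exists>\<chi>. alg_hom_op H G \<chi> \<and>
            (\<forall>e a. \<chi> (gen e a) = hol_path H (p_plus G e) a) \<and>
            (\<forall>e a. \<chi> (gen e a) = hol_path H (p_minus G e) a) \<and>
            (\<forall>es as. length es = length as \<longrightarrow> successively (edge_less G) es \<longrightarrow>
               \<chi> (foldr fa_mul (map2 gen es as) fa_one) =
               foldr (tmul (heis H)) (rev (map2 (\<lambda>e a. hol_path H (p_plus G e) a) es as)) (tone H)))
       \<and> (\<forall>\<chi> \<chi>'. alg_hom_op H G \<chi> \<and> (\<forall>e a. \<chi> (gen e a) = hol_path H (p_plus G e) a) \<longrightarrow>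
              alg_hom_op H G \<chi>' \<and> (\<forall>e a. \<chi>' (gen e a) = hol_path H (p_plus G e) a) \<longrightarrow>
              (\<forall>P\<in>fa_carrier. \<chi> P = \<chi>' P))"
proof -
  interpret hopf_gauge H G
    using assms by unfold_locales (auto simp: regular_ciliated_def)
  show ?thesis
  proof (intro conjI allI impI ballI)
    show "\<exists>\<chi>. alg_hom_op H G \<chi> \<and>
            (\<forall>e a. \<chi> (gen e a) = hol_path H (p_plus G e) a) \<and>
            (\<forall>e a. \<chi> (gen e a) = hol_path H (p_minus G e) a) \<and>
            (\<forall>es as. length es = length as \<longrightarrow> successively (edge_less G) es \<longrightarrow>
               \<chi> (foldr fa_mul (map2 gen es as) fa_one) =
               foldr (tmul (heis H)) (rev (map2 (\<lambda>e a. hol_path H (p_plus G e) a) es as)) (tone H))"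
      using chi_hom chi_gen chi_foldr by (intro exI[of _ chi]) blast
  next
    fix \<chi> \<chi>' and P :: "('e \<times> ('i \<times> 'i), 'k) fa"
    assume "alg_hom_op H G \<chi> \<and> (\<forall>e a. \<chi> (gen e a) = hol_path H (p_plus G e) a)"
      "alg_hom_op H G \<chi>' \<and> (\<forall>e a. \<chi>' (gen e a) = hol_path H (p_plus G e) a)"
      and "P \<in> fa_carrier"
    then show "\<chi> P = \<chi>' P" by - (rule alg_hom_op_unique[of H G \<chi> \<chi>'], simp_all)
  qed
qed

end
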